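(* Let $\eta:\mathbb{R}_+\to\mathbb{R}_+$ be a non-decreasing function and $a\ge1$ be such that $\lim_{n\to\infty}\eta(n)=+\infty$ and $\eta(n+1)\le a\,\eta(n)$ for every $n\in\mathbb{N}$. Let $k,q\in\mathbb{N}$ and $m\in\mathbb{N}_*$ be fixed. Let $f_n$, $n\in\mathbb{N}$, be a sequence of functions on $\mathbb{R}^d$, let $\mu_{f_n}(dx)=f_n(x)dx$, and let $\mu$ be a finite signed measure on $\mathbb{R}^d$. (i) Let $p\ge1$ with conjugate exponent $p_*$. If there exists $\alpha>\frac{q+k+d/p_*}{m}$ such that for every $n$ $$\|f_n\|_{q+2m,2m,p}\le\eta(n)^{1/\alpha}\quad\text{and}\quad d_k(\mu,\mu_{f_n})\le\frac1{\eta(n)},$$ then $\mu(dx)=f(x)dx$ for some $f\in W^{q,p}$. Moreover there exists a constant $C$ depending on $a,\alpha$ such that for every $n\in\mathbb{N}$ $$\|f-f_n\|_{q,p}\le C\eta(n)^{-\theta}\quad\text{with}\quad\theta=\frac1\alpha\wedge\Big(1-\frac{q+k+d/p_*}{\alpha m}\Big).$$ (ii) If there exists $\alpha>\frac{q+k}{m}$ such that for every $n$ $$\|f_n\|_{q+2m,2m,1+}\le\eta(n)^{1/\alpha}\quad\text{and}\quad d_k(\mu,\mu_{f_n})\le\frac1{\eta(n)},$$ then $\mu(dx)=f(x)dx$ for some $f\in W^{q,\mathbf{e}_{\log}}$. Moreover there exists a constant $C$ depending on $a,\alpha$ such that for every $n\in\mathbb{N}$ $$\|f-f_n\|_{q,\mathbf{e}_{\log}}\le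 C\Big(\eta(n)^{-1/\alpha}+(\log_2\eta(n))\,\eta(n)^{-(1-\frac{q+k}{\alpha m})}\Big)=:\varepsilon_n(\alpha).$$ And if $\varepsilon_n(\alpha)\le1$ then $$\sum_{0\le|\alpha'|\le q}\int|(\partial_{\alpha'}f-\partial_{\alpha'}f_n)(x)|\Big(1+\ln^+|(\partial_{\alpha'}f-\partial_{\alpha'}f_n)(x)|\Big)dx\le2C_*\,\varepsilon_n(\alpha),$$ where the sum is over multi-indices $\alpha'\in\mathbb{N}^d$.
   Context: $\mathbb{N}=\{0,1,\dots\}$, $\mathbb{N}_*=\mathbb{N}\setminus\{0\}$; $d/p_*=0$ when $p=1$. For multi-indices $\beta,\gamma\in\mathbb{N}^d$: $\|f\|_{k,l,p}=\sum_{0\le|\beta|\le k}\sum_{0\le|\gamma|\le l}\|x^\gamma\partial_\beta f(x)\|_{L^p(\mathbb{R}^d)}$; $\|f\|_{q,p}=\sum_{0\le|\beta|\le q}\|\partial_\beta f\|_{L^p}$ is the norm of the standard Sobolev space $W^{q,p}$. With $\ln^+(x)=\max\{0,\ln|x|\}$: $\|f\|_{p,1+}=\int(1+|x|)^p|f(x)|(1+\ln^+|x|+\ln^+|f(x)|)dx$ and $\|f\|_{k,p,1+}=\sum_{0\le|\beta|\le k}\|\partial_\beta f\|_{p,1+}$. $\mathbf{e}_{\log}(t)=(1+|t|)\ln(1+|t|)$, $\|f\|_{\mathbf{e}_{\log}}=\inf\{c>0:\int\mathbf{e}_{\log}(f(x)/c)dx\le1\}$, $\|f\|_{q,\mathbf{e}_{\log}}=\sum_{0\le|\beta|\le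 q}\|\partial_\beta f\|_{\mathbf{e}_{\log}}$, $W^{q,\mathbf{e}_{\log}}=\{f:\|f\|_{q,\mathbf{e}_{\log}}<\infty\}$. $d_k(\mu,\nu)=\sup\{|\int\phi d\mu-\int\phi d\nu|:\phi\in C^\infty(\mathbb{R}^d),\ \sum_{0\le|\beta|\le k}\|\partial_\beta\phi\|_\infty\le1\}$. $C_*=2+1/\ln(1+\varepsilon_* )$, where $\varepsilon_*>0$ is a number such that $t\le2\ln(1+t)$ for $0<t\le\varepsilon_*$.
   Formalization: In (ii), log_2 η(n) is read as max(0, log_2 η(n)), since for η(n)<1 the stated bound can be negative and is then false; for η(n)≥1 nothing changes. The f_n are assumed integrable so that d_k(μ,μ_{f_n}) is defined. *)

theory Defs
  imports "HOL-Analysis.Analysis"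
begin

section \<open>Multi-indices and classical derivatives\<close>

text \<open>A multi-index in \<open>\<nat>\<^sup>d\<close> is a function \<open>'d \<Rightarrow> nat\<close>, where \<open>d = CARD('d)\<close>.\<close>

definition mi_order :: "('d::finite \<Rightarrow> nat) \<Rightarrow> nat" where
  "mi_order \<beta> = (\<Sum>i\<in>UNIV. \<beta> i)"

definition multi_indices :: "nat \<Rightarrow> ('d::finite \<Rightarrow> nat) set" where
  "multi_indices k = {\<beta>. mi_order \<beta> \<le> k}"

definition monomial :: "('d::finite \<Rightarrow> nat) \<Rightarrow> real^'d \<Rightarrow> real" where
  "monomial \<gamma> x = (\<Prod>i\<in>UNIV. (x $ i) ^ \<gamma> i)"

definition partial :: "'d::finite \<Rightarrow> (real^'d \<Rightarrow> real) \<Rightarrow> real^'d \<Rightarrow> real" where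
  "partial i f x = deriv (\<lambda>t. f (x + t *\<^sub>R axis i 1)) 0"

text \<open>\<open>'d\<close> carries no order, so an enumeration of the coordinates is fixed once and for all.
  Iterated derivatives are only taken of smooth functions, for which the order is irrelevant.\<close>

definition coord_list :: "'d::finite list" where
  "coord_list = (SOME xs. distinct xs \<and> set xs = UNIV)"

definition mpartial :: "('d::finite \<Rightarrow> nat) \<Rightarrow> (real^'d \<Rightarrow> real) \<Rightarrow> real^'d \<Rightarrow> real" where
  "mpartial \<beta> f = foldr (\<lambda>i g. (partial i ^^ \<beta> i) g) coord_list f"

primrec C_class :: "nat \<Rightarrow> (real^'d::finite \<Rightarrow> real) \<Rightarrow> bool" where
  "C_class 0 f \<longleftrightarrow> continuous_on UNIV f"
| "C_class (Suc k) f \<longleftrightarrow> (\<forall>x. f differentiable (at x)) \<and> (\<forall>i. C_class k (partial i f))"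

definition smooth :: "(real^'d::finite \<Rightarrow> real) \<Rightarrow> bool" where
  "smooth f \<longleftrightarrow> (\<forall>k. C_class k f)"

definition test_function :: "(real^'d::finite \<Rightarrow> real) \<Rightarrow> bool" where
  "test_function \<phi> \<longleftrightarrow> smooth \<phi> \<and> (\<exists>K. compact K \<and> (\<forall>x. x \<notin> K \<longrightarrow> \<phi> x = 0))"


section \<open>Weak derivatives and norms\<close>

definition locally_integrable :: "(real^'d::finite \<Rightarrow> real) \<Rightarrow> bool" where
  "locally_integrable f \<longleftrightarrow> (\<forall>K. compact K \<longrightarrow> set_integrable lborel K f)"

definition has_weak_deriv ::
  "('d::finite \<Rightarrow> nat) \<Rightarrow> (real^'d \<Rightarrow> real) \<Rightarrow> (real^'d \<Rightarrow> real) \<Rightarrow> bool" where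
  "has_weak_deriv \<beta> f g \<longleftrightarrow> locally_integrable f \<and> locally_integrable g \<and>
     (\<forall>\<phi>. test_function \<phi> \<longrightarrow>
        (\<integral>x. f x * mpartial \<beta> \<phi> x \<partial>lborel) = (-1) ^ mi_order \<beta> * (\<integral>x. g x * \<phi> x \<partial>lborel))"

text \<open>The weak derivative is determined up to a null set, provided it exists.\<close>

definition weak_deriv :: "('d::finite \<Rightarrow> nat) \<Rightarrow> (real^'d \<Rightarrow> real) \<Rightarrow> real^'d \<Rightarrow> real" where
  "weak_deriv \<beta> f = (SOME g. has_weak_deriv \<beta> f g)"

text \<open>\<open>\<Sum>\<^bsub>|\<beta>| \<le> k\<^esub> N (\<partial>\<^sub>\<beta> f)\<close>, which is \<open>\<infinity>\<close> if one of the weak derivatives does not exist.\<close>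

definition deriv_norm ::
  "nat \<Rightarrow> ((real^'d::finite \<Rightarrow> real) \<Rightarrow> ennreal) \<Rightarrow> (real^'d \<Rightarrow> real) \<Rightarrow> ennreal" where
  "deriv_norm k N f =
     (if \<forall>\<beta>\<in>multi_indices k. \<exists>g. has_weak_deriv \<beta> f g
      then \<Sum>\<beta>\<in>multi_indices k. N (weak_deriv \<beta> f) else \<infinity>)"

definition Lp_norm :: "real \<Rightarrow> (real^'d::finite \<Rightarrow> real) \<Rightarrow> ennreal" where
  "Lp_norm p f =
     (let I = (\<integral>\<^sup>+x. ennreal (\<bar>f x\<bar> powr p) \<partial>lborel)
      in if I = \<infinity> then \<infinity> else ennreal (enn2real I powr (1 / p)))"

definition sobolev_norm :: "nat \<Rightarrow> real \<Rightarrow> (real^'d::finite \<Rightarrow> real) \<Rightarrow> ennreal" where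
  "sobolev_norm q p = deriv_norm q (Lp_norm p)"

definition sobolev_space :: "nat \<Rightarrow> real \<Rightarrow> (real^'d::finite \<Rightarrow> real) set" where
  "sobolev_space q p = {f. sobolev_norm q p f < \<infinity>}"

definition weighted_norm :: "nat \<Rightarrow> nat \<Rightarrow> real \<Rightarrow> (real^'d::finite \<Rightarrow> real) \<Rightarrow> ennreal" where
  "weighted_norm k l p =
     deriv_norm k (\<lambda>g. \<Sum>\<gamma>\<in>multi_indices l. Lp_norm p (\<lambda>x. monomial \<gamma> x * g x))"

text \<open>Here \<open>ln 0 = 0\<close> in the library, so that \<open>lnp 0 = 0\<close> as it should be.\<close>

definition lnp :: "real \<Rightarrow> real" where
  "lnp t = max 0 (ln \<bar>t\<bar>)"

definition log_weight_norm :: "nat \<Rightarrow> (real^'d::finite \<Rightarrow> real) \<Rightarrow> ennreal" where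
  "log_weight_norm l f =
     (\<integral>\<^sup>+x. ennreal ((1 + norm x) ^ l * \<bar>f x\<bar> * (1 + lnp (norm x) + lnp (f x))) \<partial>lborel)"

definition weighted_log_norm :: "nat \<Rightarrow> nat \<Rightarrow> (real^'d::finite \<Rightarrow> real) \<Rightarrow> ennreal" where
  "weighted_log_norm k l = deriv_norm k (log_weight_norm l)"

definition e_log :: "real \<Rightarrow> real" where
  "e_log t = (1 + \<bar>t\<bar>) * ln (1 + \<bar>t\<bar>)"

definition e_log_norm :: "(real^'d::finite \<Rightarrow> real) \<Rightarrow> ennreal" where
  "e_log_norm f = (INF c\<in>{c::real. c > 0 \<and> (\<integral>\<^sup>+x. ennreal (e_log (f x / c)) \<partial>lborel) \<le> 1}. ennreal c)"

definition sobolev_e_log_norm :: "nat \<Rightarrow> (real^'d::finite \<Rightarrow> real) \<Rightarrow> ennreal" where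
  "sobolev_e_log_norm q = deriv_norm q e_log_norm"

definition sobolev_e_log_space :: "nat \<Rightarrow> (real^'d::finite \<Rightarrow> real) set" where
  "sobolev_e_log_space q = {f. sobolev_e_log_norm q f < \<infinity>}"


section \<open>Finite signed measures and the distances $d_k$\<close>

text \<open>A signed measure is represented by its values on Borel sets; the values of the
  set function elsewhere are irrelevant.\<close>

definition finite_signed_measure :: "('a::topological_space set \<Rightarrow> real) \<Rightarrow> bool" where
  "finite_signed_measure \<nu> \<longleftrightarrow> \<nu> {} = 0 \<and>
     (\<forall>A :: nat \<Rightarrow> 'a set. range A \<subseteq> sets borel \<longrightarrow> disjoint_family A \<longrightarrow>
        (\<lambda>i. \<nu> (A i)) sums \<nu> (\<Union>i. A i))"

text \<open>The positive part of the Jordan decomposition. Since \<open>\<nu> {} = 0\<close>, it does no harm that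
  \<open>ennreal\<close> maps negative numbers to \<open>0\<close>.\<close>

definition pos_variation :: "('a::topological_space set \<Rightarrow> real) \<Rightarrow> 'a measure" where
  "pos_variation \<nu> =
     measure_of UNIV (sets borel) (\<lambda>A. SUP B\<in>{B\<in>sets borel. B \<subseteq> A}. ennreal (\<nu> B))"

definition neg_variation :: "('a::topological_space set \<Rightarrow> real) \<Rightarrow> 'a measure" where
  "neg_variation \<nu> = pos_variation (\<lambda>A. - \<nu> A)"

definition signed_integral :: "('a::topological_space set \<Rightarrow> real) \<Rightarrow> ('a \<Rightarrow> real) \<Rightarrow> real" where
  "signed_integral \<nu> \<phi> = (\<integral>x. \<phi> x \<partial>pos_variation \<nu>) - (\<integral>x. \<phi> x \<partial>neg_variation \<nu>)"

text \<open>The signed measure \<open>f(x) dx\<close>, for integrable \<open>f\<close>.\<close>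

definition density_sm :: "(real^'d::finite \<Rightarrow> real) \<Rightarrow> (real^'d) set \<Rightarrow> real" where
  "density_sm f A = (\<integral>x\<in>A. f x \<partial>lborel)"

definition has_density :: "((real^'d::finite) set \<Rightarrow> real) \<Rightarrow> (real^'d \<Rightarrow> real) \<Rightarrow> bool" where
  "has_density \<nu> f \<longleftrightarrow> integrable lborel f \<and> (\<forall>A\<in>sets borel. \<nu> A = density_sm f A)"

definition sup_norm :: "(real^'d::finite \<Rightarrow> real) \<Rightarrow> ennreal" where
  "sup_norm g = (SUP x. ennreal \<bar>g x\<bar>)"

definition dist_k ::
  "nat \<Rightarrow> ((real^'d::finite) set \<Rightarrow> real) \<Rightarrow> ((real^'d) set \<Rightarrow> real) \<Rightarrow> ennreal" where
  "dist_k k \<mu> \<nu> =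
     (SUP \<phi>\<in>{\<phi>. smooth \<phi> \<and> (\<Sum>\<beta>\<in>multi_indices k. sup_norm (mpartial \<beta> \<phi>)) \<le> 1}.
        ennreal \<bar>signed_integral \<mu> \<phi> - signed_integral \<nu> \<phi>\<bar>)"


section \<open>Rates\<close>

definition growth_function :: "real \<Rightarrow> (real \<Rightarrow> real) \<Rightarrow> bool" where
  "growth_function a \<eta> \<longleftrightarrow>
     (\<forall>t\<ge>0. \<eta> t \<ge> 0) \<and> mono_on {0..} \<eta> \<and>
     filterlim (\<lambda>n::nat. \<eta> (real n)) at_top sequentially \<and>
     (\<forall>n::nat. \<eta> (real (n + 1)) \<le> a * \<eta> (real n))"

text \<open>\<open>d / p\<^sub>*\<close> with \<open>p\<^sub>* = p / (p - 1)\<close> the conjugate exponent.\<close>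

definition dim_over_conj :: "nat \<Rightarrow> real \<Rightarrow> real" where
  "dim_over_conj d p = (if p = 1 then 0 else real d / (p / (p - 1)))"

text \<open>The logarithm is cut off at \<open>0\<close>: for the finitely many \<open>n\<close> with \<open>\<eta>(n) < 1\<close> the expression
  with a plain \<open>log\<^sub>2\<close> can be negative and then cannot bound a norm. If \<open>\<eta>(n) \<ge> 1\<close>, the cut-off has
  no effect.\<close>

definition log_rate :: "real \<Rightarrow> nat \<Rightarrow> nat \<Rightarrow> nat \<Rightarrow> real \<Rightarrow> real" where
  "log_rate \<alpha> k q m s =
     s powr (- (1 / \<alpha>)) + max 0 (log 2 s) * s powr (- (1 - (real q + real k) / (\<alpha> * real m)))"

definition admissible_eps :: "real \<Rightarrow> bool" where
  "admissible_eps \<epsilon> \<longleftrightarrow> \<epsilon> > 0 \<and> (\<forall>t. 0 < t \<and> t \<le> \<epsilon> \<longrightarrow> t \<le> 2 * ln (1 + t))"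

definition C_star :: "real \<Rightarrow> real" where
  "C_star \<epsilon> = 2 + 1 / ln (1 + \<epsilon>)"

end

theory Submission
  imports Defs "HOL-Probability.Probability"
begin

text \<open>
  The theorem is an interpolation statement: the functions \<open>f\<^sub>n\<close> have many derivatives of moderate size,
  they are close to \<open>\<mu>\<close> when tested against functions with \<open>k\<close> bounded derivatives, and a balance of
  the two gives convergence in a strong norm.

  Both norms, \<open>L\<^sup>p\<close> and the Orlicz norm of \<open>e\<^sub>l\<^sub>o\<^sub>g\<close>, are Luxemburg norms \<open>\<parallel>\<cdot>\<parallel>\<close> of a Young function \<open>\<Phi>\<close>, and
  the argument is carried out for any such \<open>\<Phi>\<close>. Let \<open>h\<close> be the difference of two members of the sequence and let
  \<open>w = \<partial>\<^sub>\<beta>h\<close> with \<open>|\<beta>| \<le> q\<close>. The average over \<open>z\<close> of the \<open>2m\<close>-th difference of \<open>w\<close> with step \<open>\<delta> z\<close> is \<open>w\<close> minus a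
  combination of mollifications of \<open>w\<close> at scales comparable to \<open>\<delta>\<close>.

  \<^item> The average of differences has norm at most \<open>C \<delta>\<^sup>2\<^sup>m max\<^sub>\<gamma> \<parallel>\<partial>\<^sub>\<gamma>h\<parallel>\<close> with \<open>|\<gamma>| \<le> q + 2m\<close>, since a
    difference of step \<open>\<delta>\<close> in a Luxemburg norm is bounded by \<open>\<delta>\<close> times the norm of the gradient
    (\<open>lux_step_diff_funpow\<close>, \<open>smoothing_error\<close>).
  \<^item> A mollification of \<open>w\<close> is the pairing of \<open>h\<close> with derivatives of a rescaled kernel. Its supremum is at
    most \<open>C \<delta>\<^sup>-\<^sup>(\<^sup>q\<^sup>+\<^sup>k\<^sup>)\<^sup>-\<^sup>d \<epsilon>\<close>, where \<open>\<epsilon>\<close> is the distance, and its \<open>L\<^sup>1\<close> norm, which is the pairing of \<open>h\<close> with a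
    smoothed sign, at most \<open>C \<delta>\<^sup>-\<^sup>(\<^sup>q\<^sup>+\<^sup>k\<^sup>) \<epsilon>\<close> (\<open>pairing_bounds\<close>, \<open>smoothing_bounds\<close>). Interpolation between the two
    (\<open>lux_interpolation\<close>) bounds the norm by \<open>C \<delta>\<^sup>-\<^sup>(\<^sup>q\<^sup>+\<^sup>k\<^sup>) b(\<delta>) \<epsilon>\<close>, with \<open>b(\<delta>) = \<delta>\<^sup>-\<^sup>d\<^sup>/\<^sup>p\<^sup>*\<close> for \<open>L\<^sup>p\<close> and
    \<open>b(\<delta>) = 1 + ln (1 + \<delta>\<^sup>-\<^sup>d)\<close> for \<open>e\<^sub>l\<^sub>o\<^sub>g\<close>.

  For two indices at the levels \<open>s\<close> and between \<open>2 s\<close> and \<open>2 a s\<close> of \<open>\<eta>\<close>, with \<open>s \<ge> 1\<close>, the derivatives have size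
  \<open>s\<^sup>1\<^sup>/\<^sup>\<alpha>\<close> and the distance is of order \<open>1/s\<close>. The scale \<open>\<delta> = s\<^sup>-\<^sup>1\<^sup>/\<^sup>(\<^sup>\<alpha>\<^sup>m\<^sup>)\<close> gives the two terms of the
  rate (\<open>interpolation_step\<close>). The growth condition on \<open>\<eta>\<close> provides, from each index, a chain of such pairs along
  which \<open>\<eta>\<close> at least doubles, so the errors sum up like a geometric series and the chain converges together
  with its derivatives (\<open>limit_of_chain\<close>). The limit has the same integrals as \<open>\<mu>\<close> against all test functions. By
  the Jordan decomposition of \<open>\<mu>\<close> it is therefore integrable and the density of \<open>\<mu>\<close> (\<open>has_densityI\<close>), and
  does not depend on the chain. All this is collected in \<open>approximation_rate\<close>.

  The test functions are tensor products of smooth compactly supported functions of one variable.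
  They are enough to approximate the indicators of boxes, hence to determine locally integrable functions
  and finite measures.
\<close>

section \<open>Smooth compactly supported functions of one variable\<close>

text \<open>\<open>n\<close> times differentiable on the whole line. Derivatives are two-sided at every point, so that membership
  for all \<open>n\<close> is smoothness.\<close>
primrec diff_times :: "nat \<Rightarrow> (real \<Rightarrow> real) \<Rightarrow> bool" where
  "diff_times 0 u \<longleftrightarrow> True"
| "diff_times (Suc n) u \<longleftrightarrow> (\<forall>t. u field_differentiable at t) \<and> diff_times n (deriv u)"

lemma diff_timesI:
  assumes "\<And>t. (u has_real_derivative u' t) (at t)" "diff_times n u'"
  shows "diff_times (Suc n) u"
proof -
  have "deriv u = u'" using assms(1) by (auto intro!: DERIV_imp_deriv)
  then show ?thesis using assms by (auto simp: field_differentiable_def)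
qed

lemma diff_timesD:
  assumes "diff_times (Suc n) u"
  shows "(u has_real_derivative deriv u t) (at t)" "diff_times n (deriv u)"
  using assms by (auto simp: DERIV_deriv_iff_field_differentiable)

lemma diff_times_Suc: "diff_times (Suc n) u \<Longrightarrow> diff_times n u"
  by (induction n arbitrary: u) auto

lemma diff_times_add: "diff_times n u \<Longrightarrow> diff_times n v \<Longrightarrow> diff_times n (\<lambda>t. u t + v t)"
proof (induction n arbitrary: u v)
  case (Suc n)
  show ?case
    by (rule diff_timesI[where u'="\<lambda>t. deriv u t + deriv v t"])
      (use Suc in \<open>auto intro!: derivative_eq_intros diff_timesD simp del: diff_times.simps\<close>)
qed simp

lemma diff_times_mult: "diff_times n u \<Longrightarrow> diff_times n v \<Longrightarrow> diff_times n (\<lambda>t. u t * v t)"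
proof (induction n arbitrary: u v)
  case (Suc n)
  show ?case
  proof (rule diff_timesI[where u'="\<lambda>t. deriv u t * v t + u t * deriv v t"])
    show "diff_times n (\<lambda>t. deriv u t * v t + u t * deriv v t)"
      using Suc by (intro diff_times_add Suc.IH) (auto intro: diff_timesD diff_times_Suc simp del: diff_times.simps)
  qed (use Suc in \<open>auto intro!: derivative_eq_intros diff_timesD simp del: diff_times.simps\<close>)
qed simp

lemma diff_times_const: "diff_times n (\<lambda>t. c)"
proof (induction n arbitrary: c)
  case (Suc n)
  show ?case by (rule diff_timesI[where u'="\<lambda>t. 0"]) (auto intro: Suc)
qed simp

lemma diff_times_affine: "diff_times n u \<Longrightarrow> diff_times n (\<lambda>t. u (a * t + b))"
proof (induction n arbitrary: u)
  case (Suc n)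
  show ?case
  proof (rule diff_timesI[where u'="\<lambda>t. a * deriv u (a * t + b)"])
    show "diff_times n (\<lambda>t. a * deriv u (a * t + b))"
      using Suc by (intro diff_times_mult diff_times_const) auto
    show "((\<lambda>t. u (a * t + b)) has_real_derivative a * deriv u (a * t + b)) (at t)" for t
    proof -
      have "((\<lambda>t. u (a * t + b)) has_real_derivative deriv u (a * t + b) * a) (at t)"
        by (rule DERIV_chain2[OF diff_timesD(1)[OF Suc.prems]]) (auto intro!: derivative_eq_intros)
      then show ?thesis by (simp add: mult.commute)
    qed
  qed
qed simp

text \<open>The functions \<open>p(1/t) exp(-1/t)\<close> for \<open>t > 0\<close>, extended by \<open>0\<close>. The family is closed under
  differentiation, which is why \<open>exp(-1/t)\<close> extended by \<open>0\<close> is smooth at the origin.\<close>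
definition flat :: "real poly \<Rightarrow> real \<Rightarrow> real" where
  "flat p t = (if t > 0 then poly p (1 / t) * exp (- (1 / t)) else 0)"

lemma poly_times_exp_tendsto_0:
  fixes p :: "real poly"
  shows "((\<lambda>x. poly p x * exp (- x)) \<longlongrightarrow> 0) at_top"
proof -
  have "((\<lambda>x. \<Sum>i\<le>degree p. coeff p i * (x ^ i / exp x)) \<longlongrightarrow> (\<Sum>i\<le>degree p. coeff p i * 0)) at_top"
    by (intro tendsto_sum tendsto_mult tendsto_const tendsto_power_div_exp_0)
  moreover have "(\<Sum>i\<le>degree p. coeff p i * (x ^ i / exp x)) = poly p x * exp (- x)" for x
    by (simp add: poly_altdef sum_distrib_right exp_minus divide_inverse mult.assoc)
  ultimately show ?thesis by simp
qed

lemma flat_tendsto_0: "(flat p \<longlongrightarrow> 0) (at 0)"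
proof -
  have "((\<lambda>t. poly p (inverse t) * exp (- inverse t)) \<longlongrightarrow> 0) (at_right 0)"
    using filterlim_compose[OF poly_times_exp_tendsto_0 filterlim_inverse_at_top_right] .
  then have R: "(flat p \<longlongrightarrow> 0) (at_right 0)"
    by (rule Lim_transform_eventually)
      (auto simp: flat_def eventually_at_right_field inverse_eq_divide intro: exI[of _ 1])
  have L: "(flat p \<longlongrightarrow> 0) (at_left 0)"
    by (rule Lim_transform_eventually[OF tendsto_const])
      (auto simp: flat_def eventually_at_left_field intro: exI[of _ "-1"])
  show ?thesis using L R by (simp add: filterlim_split_at)
qed

lemma flat_has_derivative:
  "(flat p has_real_derivative flat ([:0, 0, 1:] * (p - pderiv p)) t) (at t)"
proof -
  consider "t > 0" | "t < 0" | "t = 0" by linarith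
  then show ?thesis
  proof cases
    case 1
    have "((\<lambda>t. poly p (1 / t) * exp (- (1 / t))) has_real_derivative
        poly (pderiv p) (1 / t) * (- 1 / t ^ 2) * exp (- (1 / t))
        + poly p (1 / t) * (exp (- (1 / t)) * (1 / t ^ 2))) (at t)"
      using 1 by (auto intro!: derivative_eq_intros DERIV_chain2[OF poly_DERIV]
          simp: power2_eq_square)
    moreover have "poly (pderiv p) (1 / t) * (- 1 / t ^ 2) * exp (- (1 / t))
        + poly p (1 / t) * (exp (- (1 / t)) * (1 / t ^ 2)) = flat ([:0, 0, 1:] * (p - pderiv p)) t"
      using 1 by (simp add: flat_def field_simps power2_eq_square)
    ultimately have "((\<lambda>t. poly p (1 / t) * exp (- (1 / t))) has_real_derivative
       flat ([:0, 0, 1:] * (p - pderiv p)) t) (at t)" by simp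
    then show ?thesis
      by (rule has_field_derivative_transform_within_open[where S="{0<..}"]) (use 1 in \<open>auto simp: flat_def\<close>)
  next
    case 2
    have "((\<lambda>t. 0) has_real_derivative flat ([:0, 0, 1:] * (p - pderiv p)) t) (at t)"
      using 2 by (simp add: flat_def)
    then show ?thesis
      by (rule has_field_derivative_transform_within_open[where S="{..<0}"]) (use 2 in \<open>auto simp: flat_def\<close>)
  next
    case 3
    have eq: "flat ([:0, 1:] * p) h = flat p h / h" if "h \<noteq> 0" for h
      using that by (simp add: flat_def field_simps)
    have "((\<lambda>h. flat p h / h) \<longlongrightarrow> 0) (at 0)"
      by (rule Lim_transform_eventually[OF flat_tendsto_0[of "[:0, 1:] * p"]])
        (auto simp: eventually_at_filter eq simp del: mult_pCons_left)
    then show ?thesis using 3 by (simp add: DERIV_def flat_def)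
  qed
qed

lemma diff_times_flat: "diff_times n (flat p)"
proof (induction n arbitrary: p)
  case (Suc n)
  show ?case by (rule diff_timesI[OF flat_has_derivative Suc])
qed simp

text \<open>The space \<open>C\<^sub>c\<^sup>\<infinity>(\<real>)\<close>.\<close>
definition bumps :: "(real \<Rightarrow> real) set" where
  "bumps = {u. (\<forall>n. diff_times n u) \<and> (\<exists>R. \<forall>t. R < \<bar>t\<bar> \<longrightarrow> u t = 0)}"

lemma bumps_deriv: "u \<in> bumps \<Longrightarrow> (u has_real_derivative deriv u t) (at t)"
  using diff_timesD(1)[of 0 u t] by (simp add: bumps_def del: diff_times.simps)

lemma bumps_deriv_eq: "(\<And>t. (u has_real_derivative u' t) (at t)) \<Longrightarrow> deriv u = u'"
  by (auto intro!: DERIV_imp_deriv)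

lemma deriv_support:
  fixes u :: "real \<Rightarrow> real"
  assumes "\<And>t. R < \<bar>t\<bar> \<Longrightarrow> u t = 0" "R < \<bar>t\<bar>" shows "deriv u t = 0"
proof -
  have "((\<lambda>t. 0) has_real_derivative 0) (at t)" by simp
  then have "(u has_real_derivative 0) (at t)"
    by (rule has_field_derivative_transform_within_open[where S="{t. R < \<bar>t\<bar>}"])
      (use assms in \<open>auto intro!: open_Collect_less continuous_intros\<close>)
  then show ?thesis by (rule DERIV_imp_deriv)
qed

lemma deriv_funpow_support:
  fixes u :: "real \<Rightarrow> real"
  shows "(\<And>t. R < \<bar>t\<bar> \<Longrightarrow> u t = 0) \<Longrightarrow> R < \<bar>t\<bar> \<Longrightarrow> (deriv ^^ n) u t = 0"
  by (induction n arbitrary: t) (auto intro: deriv_support)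

lemma deriv_in_bumps: "u \<in> bumps \<Longrightarrow> deriv u \<in> bumps"
proof -
  assume u: "u \<in> bumps"
  then obtain R where "\<And>t. R < \<bar>t\<bar> \<Longrightarrow> u t = 0" by (auto simp: bumps_def)
  then have "\<forall>t. R < \<bar>t\<bar> \<longrightarrow> deriv u t = 0" using deriv_support by blast
  moreover have "diff_times n (deriv u)" for n
    using u diff_timesD(2)[of n u] by (simp add: bumps_def del: diff_times.simps)
  ultimately show ?thesis by (auto simp: bumps_def)
qed

lemma deriv_funpow_in_bumps: "u \<in> bumps \<Longrightarrow> (deriv ^^ n) u \<in> bumps"
  by (induction n) (auto intro: deriv_in_bumps)

lemma bumps_continuous: "u \<in> bumps \<Longrightarrow> continuous_on UNIV u"
  using bumps_deriv by (meson DERIV_continuous_on)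

lemma bumps_bounded:
  assumes "u \<in> bumps" obtains M where "M > 0" "\<And>t. \<bar>u t\<bar> \<le> M"
proof -
  obtain R where R: "\<And>t. R < \<bar>t\<bar> \<Longrightarrow> u t = 0" using assms by (auto simp: bumps_def)
  have "compact (u ` {-R..R})"
    by (intro compact_continuous_image continuous_on_subset[OF bumps_continuous[OF assms]]) auto
  then obtain M where M: "\<And>t. t \<in> {-R..R} \<Longrightarrow> \<bar>u t\<bar> \<le> M"
    by (metis bounded_iff compact_imp_bounded image_eqI real_norm_def)
  show thesis
  proof (rule that[of "max M 1"])
    show "\<bar>u t\<bar> \<le> max M 1" for t
      using M[of t] R[of t] by (smt (verit) atLeastAtMost_iff)
  qed simp
qed

lemma bumps_affine:
  assumes "u \<in> bumps" "a \<noteq> 0" shows "(\<lambda>t. u (a * t + b)) \<in> bumps"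
proof -
  obtain R where R: "\<And>t. R < \<bar>t\<bar> \<Longrightarrow> u t = 0" using assms by (auto simp: bumps_def)
  have "u (a * t + b) = 0" if "(R + \<bar>b\<bar>) / \<bar>a\<bar> < \<bar>t\<bar>" for t
  proof -
    have "R + \<bar>b\<bar> < \<bar>t\<bar> * \<bar>a\<bar>" using that assms(2) by (simp add: pos_divide_less_eq)
    also have "\<dots> \<le> \<bar>a * t + b\<bar> + \<bar>b\<bar>" using abs_triangle_ineq4[of "a * t + b" b] by (simp add: abs_mult mult.commute)
    finally show ?thesis by (intro R) simp
  qed
  moreover have "diff_times n (\<lambda>t. u (a * t + b))" for n
    using assms by (intro diff_times_affine) (auto simp: bumps_def)
  ultimately show ?thesis unfolding bumps_def by blast
qed

lemma deriv_affine:
  assumes "u \<in> bumps"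
  shows "deriv (\<lambda>t. u (a * t + b)) = (\<lambda>t. a * deriv u (a * t + b))"
proof (rule bumps_deriv_eq)
  show "((\<lambda>t. u (a * t + b)) has_real_derivative a * deriv u (a * t + b)) (at t)" for t
  proof -
    have "((\<lambda>t. u (a * t + b)) has_real_derivative deriv u (a * t + b) * a) (at t)"
      by (rule DERIV_chain2[OF bumps_deriv[OF assms]]) (auto intro!: derivative_eq_intros)
    then show ?thesis by (simp add: mult.commute)
  qed
qed

lemma deriv_funpow_affine:
  assumes "u \<in> bumps"
  shows "(deriv ^^ n) (\<lambda>t. u (a * t + b)) = (\<lambda>t. a ^ n * (deriv ^^ n) u (a * t + b))"
proof (induction n)
  case (Suc n)
  let ?v = "(deriv ^^ n) u"
  have v: "?v \<in> bumps" by (rule deriv_funpow_in_bumps[OF assms])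
  have "deriv (\<lambda>t. a ^ n * ?v (a * t + b)) = (\<lambda>t. a ^ n * (a * deriv ?v (a * t + b)))"
  proof (rule bumps_deriv_eq)
    have "((\<lambda>t. ?v (a * t + b)) has_real_derivative deriv ?v (a * t + b) * a) (at t)" for t
      by (rule DERIV_chain2[OF bumps_deriv[OF v]]) (auto intro!: derivative_eq_intros)
    from DERIV_cmult[OF this, of "a ^ n"]
    show "((\<lambda>t. a ^ n * ?v (a * t + b)) has_real_derivative a ^ n * (a * deriv ?v (a * t + b))) (at t)" for t
      by (simp add: mult.commute[of a])
  qed
  then show ?case using Suc by (simp add: mult_ac)
qed simp

lemma flat_product_in_bumps:
  assumes "l > 0"
  shows "(\<lambda>t. flat 1 (l * (t - a)) * flat 1 (l * (b - t))) \<in> bumps"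
proof -
  have "diff_times n (\<lambda>t. flat 1 (l * (t - a)) * flat 1 (l * (b - t)))" for n
    using diff_times_mult[OF diff_times_affine[OF diff_times_flat, of n 1 l "- l * a"]
        diff_times_affine[OF diff_times_flat, of n 1 "-l" "l * b"]] by (simp add: algebra_simps)
  moreover have "flat 1 (l * (t - a)) * flat 1 (l * (b - t)) = 0" if "max \<bar>a\<bar> \<bar>b\<bar> < \<bar>t\<bar>" for t
    using that assms by (auto simp: flat_def zero_less_mult_iff)
  ultimately show ?thesis unfolding bumps_def by blast
qed

lemma flat_product_tendsto:
  "(\<lambda>n. flat 1 (real (Suc n) * (t - a)) * flat 1 (real (Suc n) * (b - t)))
     \<longlonglongrightarrow> indicator {a<..<b} t"
proof -
  have *: "(\<lambda>n. flat 1 (real (Suc n) * c)) \<longlonglongrightarrow> (if c > 0 then 1 else 0)" for c :: real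
  proof (cases "c > 0")
    case True
    have "(\<lambda>n. exp (- (1 / c * (1 / real (Suc n))))) \<longlonglongrightarrow> exp (- (1 / c * 0))"
      by (intro tendsto_intros LIMSEQ_Suc[OF lim_1_over_n])
    then show ?thesis using True by (simp add: flat_def mult.commute)
  qed (auto simp: flat_def zero_less_mult_iff)
  have "(\<lambda>n. flat 1 (real (Suc n) * (t - a)) * flat 1 (real (Suc n) * (b - t)))
     \<longlonglongrightarrow> (if t - a > 0 then 1 else 0) * (if b - t > 0 then 1 else 0)"
    by (intro tendsto_mult *)
  also have "(if t - a > 0 then 1 else 0) * (if b - t > 0 then 1 else 0) = (indicator {a<..<b} t :: real)"
    by (auto simp: indicator_def)
  finally show ?thesis .
qed

lemma flat_one_bounds: "0 \<le> flat 1 t" "flat 1 t \<le> 1"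
  by (auto simp: flat_def)

section \<open>Tensor products of bumps\<close>

text \<open>The function \<open>x \<mapsto> \<Prod>\<^sub>i u\<^sub>i(x\<^sub>i)\<close>. When all factors are bumps, a partial derivative only replaces one factor by its derivative, so iterated partial
  derivatives of a tensor product commute trivially, and the symmetry of second derivatives of general
  functions is never needed.\<close>
definition tensor :: "('d::finite \<Rightarrow> real \<Rightarrow> real) \<Rightarrow> real^'d \<Rightarrow> real" where
  "tensor u x = (\<Prod>i\<in>UNIV. u i (x $ i))"

lemma tensor_upd: "tensor (u(i := v)) x = v (x $ i) * (\<Prod>j\<in>UNIV - {i}. u j (x $ j))"
  unfolding tensor_def by (subst prod.remove[of _ i]) (auto intro!: prod.cong)

lemma tensor_has_derivative:
  fixes u :: "'d::finite \<Rightarrow> real \<Rightarrow> real"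
  assumes "\<forall>i. u i \<in> bumps"
  shows "(tensor u has_derivative (\<lambda>h. \<Sum>i\<in>UNIV. h $ i * tensor (u(i := deriv (u i))) x)) (at x)"
proof -
  have 1: "((\<lambda>x. u i (x $ i)) has_derivative (\<lambda>h. deriv (u i) (x $ i) * h $ i)) (at x)" for i
  proof -
    have "(u i has_derivative (\<lambda>h. deriv (u i) (x $ i) * h)) (at (x $ i))"
      using bumps_deriv[of "u i" "x $ i"] assms by (simp add: has_field_derivative_def)
    then show ?thesis
      using has_derivative_compose[OF bounded_linear.has_derivative[OF bounded_linear_vec_nth has_derivative_ident]]
      by blast
  qed
  have "((\<lambda>x. \<Prod>i\<in>UNIV. u i (x $ i)) has_derivative
      (\<lambda>h. \<Sum>i\<in>UNIV. deriv (u i) (x $ i) * h $ i * (\<Prod>j\<in>UNIV - {i}. u j (x $ j)))) (at x)"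
    by (rule has_derivative_prod) (rule 1)
  moreover have "tensor u = (\<lambda>x. \<Prod>i\<in>UNIV. u i (x $ i))" by (auto simp: tensor_def)
  ultimately show ?thesis by (simp add: tensor_upd mult_ac)
qed

lemma tensor_continuous:
  assumes "\<forall>i. u i \<in> bumps" shows "continuous_on UNIV (tensor u)"
  using tensor_has_derivative[OF assms] by (intro continuous_at_imp_continuous_on) (auto intro: has_derivative_continuous)

lemma tensor_measurable [measurable]:
  assumes "\<forall>i. u i \<in> bumps" shows "tensor u \<in> borel_measurable borel"
  by (intro borel_measurable_continuous_onI tensor_continuous assms)

lemma tensor_bounded:
  fixes u :: "'d::finite \<Rightarrow> real \<Rightarrow> real"
  assumes "\<forall>i. u i \<in> bumps" obtains M where "M > 0" "\<And>x. \<bar>tensor u x\<bar> \<le> M"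
proof -
  have "\<exists>M. M > 0 \<and> (\<forall>t. \<bar>u i t\<bar> \<le> M)" for i using bumps_bounded[of "u i"] assms by metis
  then obtain M where M: "\<And>i. M i > (0::real)" "\<And>i t. \<bar>u i t\<bar> \<le> M i" by metis
  have "\<bar>tensor u x\<bar> \<le> (\<Prod>i\<in>UNIV. M i)" for x
    unfolding tensor_def abs_prod by (intro prod_mono) (auto intro: M)
  then show thesis using M(1) by (intro that[of "\<Prod>i\<in>UNIV. M i"]) (auto intro: prod_pos)
qed

lemma tensor_support:
  fixes u :: "'d::finite \<Rightarrow> real \<Rightarrow> real"
  assumes "\<forall>i. u i \<in> bumps" obtains R where "R > 0" "\<And>x. R < norm x \<Longrightarrow> tensor u x = 0"
proof -
  have "\<exists>R. \<forall>t. R < \<bar>t\<bar> \<longrightarrow> u i t = 0" for i using assms by (auto simp: bumps_def)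
  then obtain R where R: "\<And>i t. R i < \<bar>t\<bar> \<Longrightarrow> u i t = 0" by metis
  have "tensor u x = 0" if "max 1 (\<Sum>i\<in>UNIV. R i) < norm x" for x
  proof -
    have "\<not> (\<forall>i. \<bar>x $ i\<bar> \<le> R i)"
      using sum_mono[of UNIV "\<lambda>i. \<bar>x $ i\<bar>" R] norm_le_l1_cart[of x] that by auto
    then show ?thesis unfolding tensor_def using R by (auto simp: not_le)
  qed
  then show thesis by (intro that[of "max 1 (\<Sum>i\<in>UNIV. R i)"]) auto
qed

lemma tensor_upd_deriv_bumps: "(\<forall>i. u i \<in> bumps) \<Longrightarrow> \<forall>j. (u(i := deriv (u i))) j \<in> bumps"
  by (auto intro: deriv_in_bumps)

lemma tensor_Lipschitz:
  fixes u :: "'d::finite \<Rightarrow> real \<Rightarrow> real"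
  assumes "\<forall>i. u i \<in> bumps"
  obtains L where "L > 0" "\<And>x y. \<bar>tensor u x - tensor u y\<bar> \<le> L * norm (x - y)"
    "\<And>x h. \<bar>\<Sum>i\<in>UNIV. h $ i * tensor (u(i := deriv (u i))) x\<bar> \<le> L * norm h"
proof -
  have "\<exists>M. M > 0 \<and> (\<forall>x. \<bar>tensor (u(i := deriv (u i))) x\<bar> \<le> M)" for i
    using tensor_bounded[OF tensor_upd_deriv_bumps[OF assms, of i]] by metis
  then obtain M where M: "\<And>i. M i > (0::real)" "\<And>i x. \<bar>tensor (u(i := deriv (u i))) x\<bar> \<le> M i" by metis
  let ?L = "\<Sum>i\<in>UNIV. M i"
  have b: "\<bar>\<Sum>i\<in>UNIV. h $ i * tensor (u(i := deriv (u i))) x\<bar> \<le> ?L * norm h" for x h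
  proof -
    have "\<bar>\<Sum>i\<in>UNIV. h $ i * tensor (u(i := deriv (u i))) x\<bar> \<le> (\<Sum>i\<in>UNIV. norm h * M i)"
      by (rule order_trans[OF sum_abs], rule sum_mono, unfold abs_mult, rule mult_mono)
        (auto intro: M component_le_norm_cart)
    then show ?thesis by (simp add: sum_distrib_left mult.commute)
  qed
  show thesis
  proof (rule that[OF _ _ b])
    show "?L > 0" by (intro sum_pos) (auto intro: M)
    fix x y :: "real^'d"
    have "norm (tensor u x - tensor u y) \<le> ?L * norm (x - y)"
    proof (rule differentiable_bound[OF convex_UNIV _ _ UNIV_I UNIV_I])
      show "(tensor u has_derivative (\<lambda>h. \<Sum>i\<in>UNIV. h $ i * tensor (u(i := deriv (u i))) x)) (at x within UNIV)" for x
        using tensor_has_derivative[OF assms] by simp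
      show "onorm (\<lambda>h. \<Sum>i\<in>UNIV. h $ i * tensor (u(i := deriv (u i))) x) \<le> ?L" for x
        by (rule onorm_le) (use b in auto)
    qed
    then show "\<bar>tensor u x - tensor u y\<bar> \<le> ?L * norm (x - y)" by simp
  qed
qed

lemma integrable_bounded_support:
  fixes f :: "'a::euclidean_space \<Rightarrow> real"
  assumes [measurable]: "f \<in> borel_measurable borel" and "\<And>x. \<bar>f x\<bar> \<le> M" "\<And>x. R < norm x \<Longrightarrow> f x = 0"
  shows "integrable lborel f"
proof (rule Bochner_Integration.integrable_bound)
  show "integrable lborel (\<lambda>x. M * indicator (cball (0::'a) R) x)"
    by (intro integrable_mult_right integrable_real_indicator) (use emeasure_lborel_cball_finite in \<open>auto simp: less_top\<close>)
  have M: "0 \<le> M" using assms(2)[of 0] by linarith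
  show "AE x in lborel. norm (f x) \<le> norm (M * indicator (cball (0::'a) R) x)"
  proof (rule AE_I2)
    fix x show "norm (f x) \<le> norm (M * indicator (cball (0::'a) R) x)"
      using assms(2)[of x] assms(3)[of x] M by (cases "R < norm x") (auto simp: indicator_def)
  qed
qed auto

lemma tensor_integrable:
  assumes "\<forall>i. u i \<in> bumps" shows "integrable lborel (tensor u)"
proof -
  obtain M where "\<And>x. \<bar>tensor u x\<bar> \<le> M" by (rule tensor_bounded[of u]) (use assms in auto)
  moreover obtain R where "\<And>x. R < norm x \<Longrightarrow> tensor u x = 0" by (rule tensor_support[of u]) (use assms in auto)
  ultimately show ?thesis by (intro integrable_bounded_support[of _ M R] tensor_measurable assms) auto
qed

text \<open>The convolution of \<open>s\<close> with a tensor product, as a function of the factors.\<close>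
definition tensor_conv :: "(real^'d \<Rightarrow> real) \<Rightarrow> ('d::finite \<Rightarrow> real \<Rightarrow> real) \<Rightarrow> real^'d \<Rightarrow> real" where
  "tensor_conv s u y = (\<integral>x. tensor u (y - x) * s x \<partial>lborel)"

lemma tensor_conv_integrable:
  fixes u :: "'d::finite \<Rightarrow> real \<Rightarrow> real"
  assumes u: "\<forall>i. u i \<in> bumps" and s[measurable]: "s \<in> borel_measurable borel" and s1: "\<And>x. \<bar>s x\<bar> \<le> 1"
  shows "integrable lborel (\<lambda>x. tensor u (y - x) * s x)"
proof -
  note [measurable] = tensor_measurable[OF u]
  obtain M where M: "\<And>x. \<bar>tensor u x\<bar> \<le> M" by (rule tensor_bounded[of u]) (use assms in auto)
  obtain R where R: "\<And>x. R < norm x \<Longrightarrow> tensor u x = 0" by (rule tensor_support[of u]) (use assms in auto)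
  show ?thesis
  proof (rule integrable_bounded_support[of _ M "R + norm y"])
    show "\<bar>tensor u (y - x) * s x\<bar> \<le> M" for x
      using mult_mono[OF M[of "y - x"] s1[of x]] M[of 0] by (simp add: abs_mult)
    show "tensor u (y - x) * s x = 0" if "R + norm y < norm x" for x
      using that R[of "y - x"] norm_triangle_ineq2[of x y] by (simp add: norm_minus_commute)
  qed measurable
qed

text \<open>Differentiation under the integral sign, for a function \<open>s\<close> that is merely measurable and bounded.
  The difference quotients are dominated because a tensor product of bumps is Lipschitz with compact
  support.\<close>
lemma tensor_conv_has_derivative:
  fixes u :: "'d::finite \<Rightarrow> real \<Rightarrow> real"
  assumes u: "\<forall>i. u i \<in> bumps" and s[measurable]: "s \<in> borel_measurable borel" and s1: "\<And>x. \<bar>s x\<bar> \<le> 1"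
  shows "(tensor_conv s u has_derivative
    (\<lambda>h. \<Sum>i\<in>UNIV. h $ i * tensor_conv s (u(i := deriv (u i))) y)) (at y)"
proof -
  let ?D = "\<lambda>x h. \<Sum>i\<in>UNIV. h $ i * tensor (u(i := deriv (u i))) x"
  have ud: "\<forall>j. (u(i := deriv (u i))) j \<in> bumps" for i by (rule tensor_upd_deriv_bumps[OF u])
  note [measurable] = tensor_measurable[OF u] tensor_measurable[OF ud]
  obtain L where L: "L > 0" "\<And>x y. \<bar>tensor u x - tensor u y\<bar> \<le> L * norm (x - y)"
    "\<And>x h. \<bar>?D x h\<bar> \<le> L * norm h" by (rule tensor_Lipschitz[of u]) (use u in auto)
  obtain R0 where R0: "\<And>x. R0 < norm x \<Longrightarrow> tensor u x = 0" by (rule tensor_support[of u]) (use u in auto)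
  have "\<exists>R. \<forall>x. R < norm x \<longrightarrow> tensor (u(i := deriv (u i))) x = 0" for i
    using tensor_support[OF ud[of i]] by metis
  then obtain R1 where R1: "\<And>i x. R1 i < norm x \<Longrightarrow> tensor (u(i := deriv (u i))) x = 0" by metis
  define R where "R = max R0 (Max (range R1))"
  have R: "tensor u x = 0" "?D x h = 0" if "R < norm x" for x h
  proof -
    have "R1 i \<le> R" for i unfolding R_def by (rule max.coboundedI2, rule Max_ge) auto
    then show "tensor u x = 0" "?D x h = 0" using that R0 R1
      by (force simp: R_def intro!: sum.neutral)+
  qed
  define Q where "Q h x = (tensor u (y + h - x) - tensor u (y - x) - ?D (y - x) h) / norm h" for h x
  have int: "integrable lborel (\<lambda>x. tensor u (y - x) * s x)" for y
    by (rule tensor_conv_integrable[OF u s s1])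
  have intd: "integrable lborel (\<lambda>x. tensor (u(i := deriv (u i))) (y - x) * s x)" for i y
    by (rule tensor_conv_integrable[OF ud s s1])
  have eq: "(tensor_conv s u (y + h) - tensor_conv s u y -
      (\<Sum>i\<in>UNIV. h $ i * tensor_conv s (u(i := deriv (u i))) y)) / norm h = (\<integral>x. Q h x * s x \<partial>lborel)" for h
  proof -
    have "(\<integral>x. Q h x * s x \<partial>lborel) = (\<integral>x. (tensor u (y + h - x) * s x - tensor u (y - x) * s x
        - (\<Sum>i\<in>UNIV. h $ i * (tensor (u(i := deriv (u i))) (y - x) * s x))) / norm h \<partial>lborel)"
      by (intro Bochner_Integration.integral_cong)
        (simp_all add: Q_def sum_distrib_left sum_distrib_right algebra_simps diff_divide_distrib)
    also have "\<dots> = (tensor_conv s u (y + h) - tensor_conv s u y -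
      (\<Sum>i\<in>UNIV. h $ i * tensor_conv s (u(i := deriv (u i))) y)) / norm h"
      unfolding tensor_conv_def using int intd
      by (simp add: Bochner_Integration.integral_diff Bochner_Integration.integral_sum
          Bochner_Integration.integrable_sum)
    finally show ?thesis by simp
  qed
  have bl: "bounded_linear (\<lambda>h. \<Sum>i\<in>UNIV. h $ i * tensor_conv s (u(i := deriv (u i))) y)"
    by (intro bounded_linear_sum bounded_linear_mult_const bounded_linear_vec_nth)
  have "((\<lambda>h. \<integral>x. Q h x * s x \<partial>lborel) \<longlongrightarrow> 0) (at 0)"
    unfolding tendsto_at_iff_sequentially
  proof (intro allI impI)
    fix X :: "nat \<Rightarrow> real^'d" assume X: "\<forall>i. X i \<in> UNIV - {0}" "X \<longlonglongrightarrow> 0"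
    obtain B where B: "\<And>n. norm (X n) \<le> B" using X(2) by (metis Bseq_def convergentI convergent_imp_Bseq)
    have B0: "0 \<le> B" using order_trans[OF norm_ge_zero B[of 0]] by simp
    have "(\<lambda>n. \<integral>x. Q (X n) x * s x \<partial>lborel) \<longlonglongrightarrow> (\<integral>x. 0 \<partial>(lborel :: (real^'d) measure))"
    proof (rule integral_dominated_convergence)
      show "integrable lborel (\<lambda>x. 2 * L * indicator (cball y (R + B)) x)"
        by (intro integrable_mult_right integrable_real_indicator) (use emeasure_lborel_cball_finite in \<open>auto simp: less_top\<close>)
      show "AE x in lborel. (\<lambda>n. Q (X n) x * s x) \<longlonglongrightarrow> 0"
      proof (rule AE_I2)
        fix x
        have "((\<lambda>h. norm (tensor u (y - x + h) - tensor u (y - x) - ?D (y - x) h) / norm h) \<longlongrightarrow> 0) (at 0)"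
          using tensor_has_derivative[OF u, of "y - x"] unfolding has_derivative_at by blast
        then have "(\<lambda>n. norm (tensor u (y - x + X n) - tensor u (y - x) - ?D (y - x) (X n)) / norm (X n)) \<longlonglongrightarrow> 0"
          using X unfolding tendsto_at_iff_sequentially by (auto simp: comp_def)
        then have "(\<lambda>n. \<bar>Q (X n) x\<bar>) \<longlonglongrightarrow> 0" by (simp add: Q_def algebra_simps)
        then have "(\<lambda>n. Q (X n) x) \<longlonglongrightarrow> 0" by (simp add: tendsto_rabs_zero_iff)
        from tendsto_mult[OF this tendsto_const[of "s x"]] show "(\<lambda>n. Q (X n) x * s x) \<longlonglongrightarrow> 0" by simp
      qed
      show "AE x in lborel. norm (Q (X n) x * s x) \<le> 2 * L * indicator (cball y (R + B)) x" for n
      proof (rule AE_I2)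
        fix x
        have n0: "norm (X n) > 0" using X by auto
        have "\<bar>tensor u (y + X n - x) - tensor u (y - x) - ?D (y - x) (X n)\<bar> \<le> L * norm (X n) + L * norm (X n)"
          using L(2)[of "y + X n - x" "y - x"] L(3)[where h = "X n" and x = "y - x"] by (simp add: algebra_simps)
        then have q: "\<bar>Q (X n) x\<bar> \<le> 2 * L" using n0 by (simp add: Q_def pos_divide_le_eq)
        have q2: "\<bar>Q (X n) x * s x\<bar> \<le> 2 * L"
          using mult_mono[OF q s1[of x]] L(1) by (simp add: abs_mult)
        show "norm (Q (X n) x * s x) \<le> 2 * L * indicator (cball y (R + B)) x"
        proof (cases "x \<in> cball y (R + B)")
          case True then show ?thesis using q2 by simp
        next
          case False
          then have "R + B < norm (y - x)" by (simp add: dist_norm)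
          moreover have "norm (y - x) \<le> norm (X n) + norm (y + X n - x)"
            using norm_triangle_ineq2[of "y - x" "- X n"] by (simp add: algebra_simps)
          ultimately have "R < norm (y - x)" "R < norm (y + X n - x)"
            using B[of n] B0 by linarith+
          then have "Q (X n) x = 0" by (simp add: Q_def R)
          then show ?thesis using False by simp
        qed
      qed
    qed (simp_all add: Q_def)
    then show "((\<lambda>h. \<integral>x. Q h x * s x \<partial>lborel) \<circ> X) \<longlonglongrightarrow> 0" by (simp add: comp_def)
  qed
  then have "((\<lambda>h. norm ((tensor_conv s u (y + h) - tensor_conv s u y -
      (\<Sum>i\<in>UNIV. h $ i * tensor_conv s (u(i := deriv (u i))) y)) / norm h)) \<longlongrightarrow> 0) (at 0)"
    unfolding eq by (rule tendsto_norm_zero)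
  then show ?thesis using bl unfolding has_derivative_at by simp
qed

section \<open>Smoothness and iterated partial derivatives of families indexed by bumps\<close>

lemma partial_eqI:
  fixes f :: "real^'d::finite \<Rightarrow> real"
  assumes "(f has_derivative (\<lambda>h. \<Sum>i\<in>UNIV. h $ i * g i)) (at x)"
  shows "partial i f x = g i"
proof -
  have "((\<lambda>t. x + t *\<^sub>R axis i 1) has_derivative (\<lambda>t. t *\<^sub>R axis i 1)) (at 0)"
    by (auto intro!: derivative_eq_intros)
  from has_derivative_compose[OF this, of f "\<lambda>h. \<Sum>i\<in>UNIV. h $ i * g i"]
  have "((\<lambda>t. f (x + t *\<^sub>R axis i 1)) has_derivative (\<lambda>t. \<Sum>j\<in>UNIV. (t *\<^sub>R axis i 1) $ j * g j)) (at 0)"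
    using assms by simp
  moreover have "(\<Sum>j\<in>UNIV. (t *\<^sub>R axis i 1) $ j * g j) = g i * t" for t
  proof -
    have "(\<Sum>j\<in>UNIV. (t *\<^sub>R axis i 1) $ j * g j) = (\<Sum>j\<in>UNIV. if j = i then g i * t else 0)"
      by (intro sum.cong) (auto simp: axis_def)
    then show ?thesis by simp
  qed
  ultimately have "((\<lambda>t. f (x + t *\<^sub>R axis i 1)) has_field_derivative g i) (at 0)"
    by (simp add: has_field_derivative_def)
  then show ?thesis unfolding partial_def by (rule DERIV_imp_deriv)
qed

lemma coord_list: "distinct (coord_list :: 'd::finite list)" "set (coord_list :: 'd list) = UNIV"
proof -
  have "\<exists>xs :: 'd list. distinct xs \<and> set xs = UNIV"
    using finite_distinct_list[OF finite[of "UNIV :: 'd set"]] by blast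
  from someI_ex[OF this] show "distinct (coord_list :: 'd list)" "set (coord_list :: 'd list) = UNIV"
    unfolding coord_list_def by auto
qed

text \<open>A family of functions, indexed by tuples of bumps, in which partial differentiation in
  direction \<open>i\<close> amounts to differentiating the \<open>i\<close>-th bump. Tensor products and their convolutions with a
  bounded function are the two instances.\<close>
locale bump_family =
  fixes F :: "('d::finite \<Rightarrow> real \<Rightarrow> real) \<Rightarrow> real^'d \<Rightarrow> real"
  assumes F_deriv: "\<And>u x. (\<forall>i. u i \<in> bumps) \<Longrightarrow>
    (F u has_derivative (\<lambda>h. \<Sum>i\<in>UNIV. h $ i * F (u(i := deriv (u i))) x)) (at x)"
begin

lemma partial_F: "(\<forall>i. u i \<in> bumps) \<Longrightarrow> partial i (F u) = F (u(i := deriv (u i)))"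
  using partial_eqI[OF F_deriv] by blast

lemma smooth_F: "(\<forall>i. u i \<in> bumps) \<Longrightarrow> smooth (F u)"
proof -
  have "C_class n (F u)" if "\<forall>i. u i \<in> bumps" for n
    using that
  proof (induction n arbitrary: u)
    case 0
    then show ?case using has_derivative_continuous[OF F_deriv] by (simp add: continuous_at_imp_continuous_on)
  next
    case (Suc n)
    have "C_class n (F (u(i := deriv (u i))))" for i
      by (rule Suc.IH) (rule tensor_upd_deriv_bumps[OF Suc.prems])
    then show ?case using F_deriv[OF Suc.prems] by (auto simp: partial_F[OF Suc.prems] differentiable_def)
  qed
  then show "(\<forall>i. u i \<in> bumps) \<Longrightarrow> smooth (F u)" by (auto simp: smooth_def)
qed

lemma partial_funpow_F:
  "(\<forall>i. u i \<in> bumps) \<Longrightarrow> (partial i ^^ n) (F u) = F (u(i := (deriv ^^ n) (u i)))"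
proof (induction n)
  case (Suc n)
  have b: "\<forall>j. (u(i := (deriv ^^ n) (u i))) j \<in> bumps"
    using Suc.prems by (auto intro: deriv_funpow_in_bumps)
  have "(partial i ^^ Suc n) (F u) = partial i (F (u(i := (deriv ^^ n) (u i))))"
    using Suc by (simp del: fun_upd_apply)
  also have "\<dots> = F (u(i := (deriv ^^ Suc n) (u i)))" using partial_F[OF b, of i] by (simp del: fun_upd_apply) simp
  finally show ?case .
qed simp

lemma mpartial_F:
  assumes "\<forall>i. u i \<in> bumps"
  shows "mpartial \<beta> (F u) = F (\<lambda>i. (deriv ^^ \<beta> i) (u i))"
proof -
  have "foldr (\<lambda>i g. (partial i ^^ \<beta> i) g) xs (F u) = F (\<lambda>i. if i \<in> set xs then (deriv ^^ \<beta> i) (u i) else u i)"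
    if "distinct xs" for xs
    using that
  proof (induction xs)
    case (Cons j xs)
    let ?v = "\<lambda>i. if i \<in> set xs then (deriv ^^ \<beta> i) (u i) else u i"
    have v: "\<forall>i. ?v i \<in> bumps" using assms by (auto intro: deriv_funpow_in_bumps)
    have "foldr (\<lambda>i g. (partial i ^^ \<beta> i) g) (j # xs) (F u) = F (?v(j := (deriv ^^ \<beta> j) (?v j)))"
      using Cons partial_funpow_F[OF v] by simp
    also have "?v(j := (deriv ^^ \<beta> j) (?v j)) = (\<lambda>i. if i \<in> set (j # xs) then (deriv ^^ \<beta> i) (u i) else u i)"
      using Cons.prems by auto
    finally show ?case .
  qed simp
  from this[OF coord_list(1)] show ?thesis unfolding mpartial_def by (simp add: coord_list(2))
qed

end

interpretation tensor: bump_family tensor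
  by standard (rule tensor_has_derivative)

lemma bump_family_tensor_conv:
  assumes "s \<in> borel_measurable borel" "\<And>x. \<bar>s x\<bar> \<le> 1"
  shows "bump_family (tensor_conv s)"
  by standard (rule tensor_conv_has_derivative[OF _ assms])

lemma test_function_tensor:
  assumes "\<forall>i. u i \<in> bumps" shows "test_function (tensor u)"
proof -
  obtain R where "\<And>x. R < norm x \<Longrightarrow> tensor u x = 0" by (rule tensor_support[of u]) (use assms in auto)
  then have "\<forall>x. x \<notin> cball 0 R \<longrightarrow> tensor u x = 0" by auto
  then show ?thesis unfolding test_function_def using tensor.smooth_F[OF assms] by (meson compact_cball)
qed

section \<open>Approximation of boxes by tensor products\<close>

text \<open>Factors whose tensor product lies between \<open>0\<close> and the indicator of the open box with corners
  \<open>a\<close> and \<open>b\<close>, and converges to it pointwise as \<open>n\<close> tends to infinity.\<close>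
definition box_bump :: "nat \<Rightarrow> real^'d::finite \<Rightarrow> real^'d \<Rightarrow> 'd \<Rightarrow> real \<Rightarrow> real" where
  "box_bump n a b i t = flat 1 (real (Suc n) * (t - a $ i)) * flat 1 (real (Suc n) * (b $ i - t))"

lemma box_bump_in_bumps: "\<forall>i. box_bump n a b i \<in> bumps"
  unfolding box_bump_def[abs_def] by (auto intro: flat_product_in_bumps)

lemma tensor_box_bump_nonneg: "0 \<le> tensor (box_bump n a b) x"
  by (auto simp: tensor_def box_bump_def intro!: prod_nonneg flat_one_bounds mult_nonneg_nonneg)

lemma tensor_box_bump_le: "tensor (box_bump n a b) x \<le> indicator (box a b) x"
proof (cases "x \<in> box a b")
  case True
  then show ?thesis
    by (auto simp: tensor_def box_bump_def intro!: prod_le_1 mult_le_one flat_one_bounds mult_nonneg_nonneg)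
next
  case False
  then obtain i where "x $ i \<le> a $ i \<or> b $ i \<le> x $ i" by (auto simp: mem_box_cart not_less)
  then have "box_bump n a b i (x $ i) = 0" by (auto simp: box_bump_def flat_def zero_less_mult_iff)
  then have "tensor (box_bump n a b) x = 0" unfolding tensor_def by (auto intro!: prod_zero)
  then show ?thesis by simp
qed

lemma tensor_box_bump_tendsto: "(\<lambda>n. tensor (box_bump n a b) x) \<longlonglongrightarrow> indicator (box a b) x"
proof -
  have "(\<lambda>n. tensor (box_bump n a b) x) \<longlonglongrightarrow> (\<Prod>i\<in>UNIV. indicator {a $ i<..<b $ i} (x $ i))"
    unfolding tensor_def box_bump_def by (intro tendsto_prod flat_product_tendsto)
  also have "(\<Prod>i\<in>UNIV. indicator {a $ i<..<b $ i} (x $ i)) = (indicator (box a b) x :: real)"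
  proof (cases "x \<in> box a b")
    case True then show ?thesis by (auto simp: mem_box_cart intro!: prod.neutral)
  next
    case False
    then obtain i where "x $ i \<notin> {a $ i<..<b $ i}" by (force simp: mem_box_cart)
    then have "indicator {a $ i<..<b $ i} (x $ i) = (0::real)" by simp
    then have "(\<Prod>i\<in>UNIV. indicator {a $ i<..<b $ i} (x $ i)) = (0::real)" by (intro prod_zero) auto
    then show ?thesis using False by simp
  qed
  finally show ?thesis .
qed

lemma measure_eqI_boxes:
  fixes M N :: "'a::euclidean_space measure"
  assumes sM: "sets M = sets borel" and sN: "sets N = sets borel"
    and eq: "\<And>a b. emeasure M (box a b) = emeasure N (box a b)"
    and fin: "\<And>a b. emeasure M (box a b) \<noteq> \<infinity>"
  shows "M = N"
proof (rule measure_eqI_generator_eq)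
  let ?E = "range (\<lambda>(a, b). box a b :: 'a set)"
  show "Int_stable ?E" by (auto simp: Int_stable_def box_Int_box)
  show "sets M = sigma_sets UNIV ?E" "sets N = sigma_sets UNIV ?E"
    using sM sN by (simp_all add: borel_eq_box)
  let ?A = "\<lambda>n::nat. box (- (real n *\<^sub>R One)) (real n *\<^sub>R One) :: 'a set"
  show "range ?A \<subseteq> ?E" "(\<Union>i. ?A i) = UNIV"
    unfolding UN_box_eq_UNIV by auto
  show "emeasure M (?A i) \<noteq> \<infinity>" for i by (rule fin)
qed (use eq in auto)

section \<open>Locally integrable functions\<close>

lemma locally_integrable_measurable [measurable_dest]:
  fixes f :: "real^'d::finite \<Rightarrow> real"
  assumes "locally_integrable f" shows "f \<in> borel_measurable borel"
proof (rule borel_measurable_LIMSEQ_real)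
  fix n :: nat
  have "set_integrable lborel (cball 0 (real n)) f" using assms by (auto simp: locally_integrable_def)
  from borel_measurable_integrable[OF this[unfolded set_integrable_def]]
  show "(\<lambda>x. indicator (cball 0 (real n)) x *\<^sub>R f x) \<in> borel_measurable borel" by simp
next
  fix x :: "real^'d"
  obtain N :: nat where "norm x \<le> real N" using real_arch_simple by blast
  then have "\<forall>\<^sub>F n in sequentially. indicator (cball 0 (real n)) x *\<^sub>R f x = f x"
    by (auto simp: eventually_sequentially intro!: exI[of _ N])
  then show "(\<lambda>n. indicator (cball 0 (real n)) x *\<^sub>R f x) \<longlonglongrightarrow> f x"
    by (rule tendsto_eventually)
qed

lemma locally_integrableI:
  fixes f :: "real^'d::finite \<Rightarrow> real"
  assumes [measurable]: "f \<in> borel_measurable borel"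
    and "\<And>R. (\<integral>\<^sup>+x. ennreal \<bar>f x\<bar> * indicator (cball 0 R) x \<partial>lborel) < \<infinity>"
  shows "locally_integrable f"
  unfolding locally_integrable_def
proof (intro allI impI)
  fix K :: "(real^'d) set" assume K: "compact K"
  then obtain R where "\<forall>x\<in>K. norm x \<le> R" using compact_imp_bounded bounded_iff by blast
  then have R: "K \<subseteq> cball 0 R" by auto
  have "set_integrable lborel (cball 0 R) f"
    unfolding set_integrable_def
  proof (rule integrableI_bounded)
    have "(\<integral>\<^sup>+x. ennreal (norm (indicator (cball 0 R) x *\<^sub>R f x)) \<partial>lborel) =
       (\<integral>\<^sup>+x. ennreal \<bar>f x\<bar> * indicator (cball 0 R) x \<partial>lborel)"
      by (intro nn_integral_cong) (simp add: indicator_def)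
    then show "(\<integral>\<^sup>+x. ennreal (norm (indicator (cball 0 R) x *\<^sub>R f x)) \<partial>lborel) < \<infinity>" using assms(2) by simp
  qed (auto intro!: borel_measurable_times borel_measurable_indicator)
  then show "set_integrable lborel K f"
    using R K by (rule_tac set_integrable_subset) (auto simp: compact_imp_closed borel_closed)
qed

lemma locally_integrableD:
  fixes f :: "real^'d::finite \<Rightarrow> real"
  assumes f: "locally_integrable f"
  shows "(\<integral>\<^sup>+x. ennreal \<bar>f x\<bar> * indicator (cball 0 R) x \<partial>lborel) < \<infinity>"
proof -
  have "set_integrable lborel (cball 0 R) f" using f by (auto simp: locally_integrable_def)
  then have "(\<integral>\<^sup>+x. ennreal (norm (indicator (cball 0 R) x *\<^sub>R f x)) \<partial>lborel) < \<infinity>"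
    unfolding set_integrable_def by (simp add: integrable_iff_bounded)
  also have "(\<integral>\<^sup>+x. ennreal (norm (indicator (cball 0 R) x *\<^sub>R f x)) \<partial>lborel) =
       (\<integral>\<^sup>+x. ennreal \<bar>f x\<bar> * indicator (cball 0 R) x \<partial>lborel)"
    by (intro nn_integral_cong) (simp add: indicator_def)
  finally show ?thesis .
qed

lemma locally_integrable_add:
  "locally_integrable f \<Longrightarrow> locally_integrable g \<Longrightarrow> locally_integrable (\<lambda>x. f x + g x)"
  unfolding locally_integrable_def by (auto intro: set_integral_add(1))

lemma locally_integrable_diff:
  "locally_integrable f \<Longrightarrow> locally_integrable g \<Longrightarrow> locally_integrable (\<lambda>x. f x - g x)"
  unfolding locally_integrable_def by (auto intro: set_integral_diff(1))

lemma nn_integral_lborel_translate: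
  fixes f :: "'a::euclidean_space \<Rightarrow> ennreal"
  assumes [measurable]: "f \<in> borel_measurable borel"
  shows "(\<integral>\<^sup>+x. f (x + h) \<partial>lborel) = (\<integral>\<^sup>+x. f x \<partial>lborel)"
proof -
  have "(\<integral>\<^sup>+x. f x \<partial>lborel) = (\<integral>\<^sup>+x. f x \<partial>distr lborel borel ((+) h))" by (simp add: lborel_distr_plus)
  also have "\<dots> = (\<integral>\<^sup>+x. f (h + x) \<partial>lborel)" by (rule nn_integral_distr) auto
  finally show ?thesis by (simp add: add.commute)
qed

lemma integral_lborel_translate:
  fixes f :: "'a::euclidean_space \<Rightarrow> real"
  assumes [measurable]: "f \<in> borel_measurable borel"
  shows "(\<integral>x. f (x + h) \<partial>lborel) = (\<integral>x. f x \<partial>lborel)"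
proof -
  have "(\<integral>x. f x \<partial>lborel) = (\<integral>x. f x \<partial>distr lborel borel ((+) h))" by (simp add: lborel_distr_plus)
  also have "\<dots> = (\<integral>x. f (h + x) \<partial>lborel)" by (rule integral_distr) auto
  finally show ?thesis by (simp add: add.commute)
qed

lemma locally_integrable_translate:
  fixes f :: "real^'d::finite \<Rightarrow> real"
  assumes f: "locally_integrable f"
  shows "locally_integrable (\<lambda>x. f (x + h))"
proof (rule locally_integrableI)
  note [measurable] = locally_integrable_measurable[OF f]
  show "(\<lambda>x. f (x + h)) \<in> borel_measurable borel" by simp
  fix R
  have "(\<integral>\<^sup>+x. ennreal \<bar>f (x + h)\<bar> * indicator (cball 0 R) x \<partial>lborel)
     \<le> (\<integral>\<^sup>+x. ennreal \<bar>f (h + x)\<bar> * indicator (cball 0 (R + norm h)) (h + x) \<partial>lborel)"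
    by (intro nn_integral_mono mult_mono)
      (auto simp: indicator_def add.commute intro: norm_triangle_le)
  also have "\<dots> = (\<integral>\<^sup>+x. ennreal \<bar>f x\<bar> * indicator (cball 0 (R + norm h)) x \<partial>distr lborel borel ((+) h))"
    by (subst nn_integral_distr) (auto intro!: borel_measurable_times_ennreal borel_measurable_indicator)
  also have "\<dots> < \<infinity>" unfolding lborel_distr_plus by (rule locally_integrableD[OF f])
  finally show "(\<integral>\<^sup>+x. ennreal \<bar>f (x + h)\<bar> * indicator (cball 0 R) x \<partial>lborel) < \<infinity>" .
qed

lemma integrable_locally_integrable_mult:
  fixes f g :: "real^'d::finite \<Rightarrow> real"
  assumes f: "locally_integrable f" and [measurable]: "g \<in> borel_measurable borel"
    and "\<And>x. \<bar>g x\<bar> \<le> M" "\<And>x. R < norm x \<Longrightarrow> g x = 0"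
  shows "integrable lborel (\<lambda>x. f x * g x)"
proof (rule Bochner_Integration.integrable_bound)
  note [measurable] = locally_integrable_measurable[OF f]
  show "integrable lborel (\<lambda>x. M * (indicator (cball 0 R) x *\<^sub>R f x))"
    using f by (auto simp: locally_integrable_def set_integrable_def)
  show "(\<lambda>x. f x * g x) \<in> borel_measurable lborel" by simp
  show "AE x in lborel. norm (f x * g x) \<le> norm (M * (indicator (cball 0 R) x *\<^sub>R f x))"
  proof (rule AE_I2)
    fix x show "norm (f x * g x) \<le> norm (M * (indicator (cball 0 R) x *\<^sub>R f x))"
    proof (cases "R < norm x")
      case True then show ?thesis using assms(4) by simp
    next
      case False
      have "\<bar>g x\<bar> * \<bar>f x\<bar> \<le> \<bar>M\<bar> * \<bar>f x\<bar>" using assms(3)[of x] by (intro mult_right_mono) auto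
      then show ?thesis using False by (simp add: abs_mult indicator_def mult.commute)
    qed
  qed
qed

lemma integrable_locally_integrable_tensor:
  assumes "locally_integrable f" "\<forall>i. u i \<in> bumps"
  shows "integrable lborel (\<lambda>x. f x * tensor u x)"
proof -
  obtain M where "\<And>x. \<bar>tensor u x\<bar> \<le> M" by (rule tensor_bounded[OF assms(2)]) auto
  moreover obtain R where "\<And>x. R < norm x \<Longrightarrow> tensor u x = 0" by (rule tensor_support[OF assms(2)]) auto
  ultimately show ?thesis by (intro integrable_locally_integrable_mult[OF assms(1) tensor_measurable[OF assms(2)]])
qed

section \<open>Tensor products of bumps separate measures\<close>

lemma emeasure_sum_measure:
  assumes sM: "sets M = sets borel" and sN: "sets N = sets borel"
  obtains S :: "'a::topological_space measure" where "sets S = sets borel"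
    "\<And>A. A \<in> sets borel \<Longrightarrow> emeasure S A = emeasure M A + emeasure N A"
proof
  let ?\<mu> = "\<lambda>A. emeasure M A + emeasure N A"
  let ?S = "measure_of UNIV (sets borel) ?\<mu> :: 'a measure"
  have sa: "sigma_algebra UNIV (sets borel)"
    using sets.sigma_algebra_axioms[of borel] by simp
  show s: "sets ?S = sets borel" using sigma_algebra.sigma_sets_eq[OF sa] by simp
  fix A :: "'a set" assume A: "A \<in> sets borel"
  show "emeasure ?S A = ?\<mu> A"
  proof (rule emeasure_measure_of_sigma[OF sa _ _ A])
    show "positive (sets borel) ?\<mu>" by (simp add: positive_def)
    show "countably_additive (sets borel) ?\<mu>"
      unfolding countably_additive_def
    proof (intro allI impI)
      fix F :: "nat \<Rightarrow> 'a set" assume F: "range F \<subseteq> sets borel" "disjoint_family F"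
      have "(\<Sum>i. emeasure M (F i)) = emeasure M (\<Union>i. F i)" "(\<Sum>i. emeasure N (F i)) = emeasure N (\<Union>i. F i)"
        using F sM sN by (auto intro: suminf_emeasure)
      then show "(\<Sum>i. ?\<mu> (F i)) = ?\<mu> (\<Union>i. F i)" by (simp flip: suminf_add)
    qed
  qed
qed

text \<open>A finite signed measure \<open>P - N\<close> and a locally integrable function with the same integrals against
  all tensor products of bumps coincide. To avoid differences of infinite quantities, the negative parts
  are moved to the other side, which leaves two measures that agree on open boxes.\<close>
lemma density_identification:
  fixes g :: "real^'d::finite \<Rightarrow> real"
  assumes P: "finite_measure P" and sP: "sets P = sets borel"
    and N: "finite_measure N" and sN: "sets N = sets borel"
    and g: "locally_integrable g"
    and eq: "\<And>u. \<forall>i. u i \<in> bumps \<Longrightarrow>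
      (\<integral>x. tensor u x \<partial>P) - (\<integral>x. tensor u x \<partial>N) = (\<integral>x. g x * tensor u x \<partial>lborel)"
    and A: "A \<in> sets borel"
  shows "emeasure P A + (\<integral>\<^sup>+x. ennreal (- g x) * indicator A x \<partial>lborel) =
    emeasure N A + (\<integral>\<^sup>+x. ennreal (g x) * indicator A x \<partial>lborel)"
proof -
  note [measurable] = locally_integrable_measurable[OF g] and [measurable_cong] = sP sN
  interpret P: finite_measure P by fact
  interpret N: finite_measure N by fact
  let ?Dm = "density lborel (\<lambda>x. ennreal (- g x))" and ?Dp = "density lborel (\<lambda>x. ennreal (g x))"
  obtain S1 where S1: "sets S1 = sets borel" "\<And>A. A \<in> sets borel \<Longrightarrow> emeasure S1 A = emeasure P A + emeasure ?Dm A"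
    by (rule emeasure_sum_measure[OF sP, of ?Dm]) auto
  obtain S2 where S2: "sets S2 = sets borel" "\<And>A. A \<in> sets borel \<Longrightarrow> emeasure S2 A = emeasure N A + emeasure ?Dp A"
    by (rule emeasure_sum_measure[OF sN, of ?Dp]) auto
  have box: "emeasure S1 (box a b) = emeasure S2 (box a b) \<and> emeasure S1 (box a b) \<noteq> \<infinity>" for a b
  proof -
    let ?I = "indicator (box a b) :: real^'d \<Rightarrow> real" and ?t = "\<lambda>n. tensor (box_bump n a b)"
    note [measurable] = tensor_measurable[OF box_bump_in_bumps]
    have b: "\<bar>?t n x\<bar> \<le> ?I x" for n x
      using tensor_box_bump_nonneg[of n a b x] tensor_box_bump_le[of n a b x] by simp
    then have b1: "\<bar>?t n x\<bar> \<le> 1" for n x by (rule order_trans) (simp add: indicator_def)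
    have int: "integrable lborel (\<lambda>x. g x * ?I x)"
    proof -
      have "set_integrable lborel (box a b) g"
        using g by (rule_tac set_integrable_subset[of _ "cbox a b"])
          (auto simp: locally_integrable_def box_subset_cbox)
      then show ?thesis by (simp add: set_integrable_def mult.commute)
    qed
    have L: "(\<lambda>n. \<integral>x. g x * ?t n x \<partial>lborel) \<longlonglongrightarrow> (\<integral>x. g x * ?I x \<partial>lborel)"
    proof (rule integral_dominated_convergence[where w="\<lambda>x. \<bar>g x * ?I x\<bar>"])
      show "AE x in lborel. (\<lambda>n. g x * ?t n x) \<longlonglongrightarrow> g x * ?I x"
        by (intro AE_I2 tendsto_mult tendsto_const tensor_box_bump_tendsto)
      show "AE x in lborel. norm (g x * ?t n x) \<le> \<bar>g x * ?I x\<bar>" for n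
        by (intro AE_I2) (simp add: abs_mult mult_left_mono b)
    qed (use int in auto)
    have F: "(\<lambda>n. \<integral>x. ?t n x \<partial>M) \<longlonglongrightarrow> (\<integral>x. ?I x \<partial>M)" if "finite_measure M" and [measurable_cong]: "sets M = sets borel" for M
    proof (rule integral_dominated_convergence[where w="\<lambda>x. 1"])
      interpret finite_measure M by fact
      show "integrable M (\<lambda>x. 1 :: real)" by simp
      show "AE x in M. (\<lambda>n. ?t n x) \<longlonglongrightarrow> ?I x" by (intro AE_I2 tensor_box_bump_tendsto)
    qed (use b1 in auto)
    have "(\<lambda>n. (\<integral>x. ?t n x \<partial>P) - (\<integral>x. ?t n x \<partial>N)) \<longlonglongrightarrow> (\<integral>x. ?I x \<partial>P) - (\<integral>x. ?I x \<partial>N)"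
      by (intro tendsto_diff F P N sP sN)
    then have "(\<integral>x. ?I x \<partial>P) - (\<integral>x. ?I x \<partial>N) = (\<integral>x. g x * ?I x \<partial>lborel)"
      using L unfolding eq[OF box_bump_in_bumps] by (rule LIMSEQ_unique)
    moreover have "(\<integral>x. ?I x \<partial>P) = measure P (box a b)"
      by (subst Bochner_Integration.integral_indicator) (simp add: sets_eq_imp_space_eq[OF sP])
    moreover have "(\<integral>x. ?I x \<partial>N) = measure N (box a b)"
      by (subst Bochner_Integration.integral_indicator) (simp add: sets_eq_imp_space_eq[OF sN])
    ultimately have PN: "measure P (box a b) - measure N (box a b) = (\<integral>x. g x * ?I x \<partial>lborel)"
      by (simp only:)
    obtain r q where rq: "0 \<le> r" "0 \<le> q"
        "(\<integral>\<^sup>+x. ennreal (g x * ?I x) \<partial>lborel) = ennreal r"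
        "(\<integral>\<^sup>+x. ennreal (- (g x * ?I x)) \<partial>lborel) = ennreal q"
        "(\<integral>x. g x * ?I x \<partial>lborel) = r - q"
      by (rule integrableE[OF int]) blast
    have p: "emeasure ?Dp (box a b) = ennreal r"
      unfolding rq(3)[symmetric] by (subst emeasure_density) (auto intro!: nn_integral_cong simp: indicator_def)
    have m: "emeasure ?Dm (box a b) = ennreal q"
      unfolding rq(4)[symmetric] by (subst emeasure_density) (auto intro!: nn_integral_cong simp: indicator_def)
    have B: "box a b \<in> sets borel" by simp
    have 1: "emeasure S1 (box a b) = ennreal (measure P (box a b) + q)"
      unfolding S1(2)[OF B] m P.emeasure_eq_measure using rq(2) by (simp add: ennreal_plus)
    have 2: "emeasure S2 (box a b) = ennreal (measure N (box a b) + r)"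
      unfolding S2(2)[OF B] p N.emeasure_eq_measure using rq(1) by (simp add: ennreal_plus)
    have "measure P (box a b) + q = measure N (box a b) + r" using PN rq(5) by linarith
    then show ?thesis unfolding 1 2 by simp
  qed
  have "S1 = S2" by (rule measure_eqI_boxes[OF S1(1) S2(1)]) (use box in blast)+
  then have "emeasure P A + emeasure ?Dm A = emeasure N A + emeasure ?Dp A" using S1(2)[OF A] S2(2)[OF A] by simp
  then show ?thesis using A by (simp add: emeasure_density)
qed

text \<open>The fundamental lemma of the calculus of variations: the case \<open>P = N = 0\<close> of the previous lemma.\<close>
lemma AE_eq_0_if_orthogonal_tensors:
  fixes g :: "real^'d::finite \<Rightarrow> real"
  assumes g: "locally_integrable g"
    and eq: "\<And>u. \<forall>i. u i \<in> bumps \<Longrightarrow> (\<integral>x. g x * tensor u x \<partial>lborel) = 0"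
  shows "AE x in lborel. g x = 0"
proof -
  note [measurable] = locally_integrable_measurable[OF g]
  let ?Z = "null_measure borel :: (real^'d) measure"
  have Z: "finite_measure ?Z" by (rule finite_measureI) simp
  have I: "(\<integral>\<^sup>+x. ennreal (- g x) * indicator A x \<partial>lborel) = (\<integral>\<^sup>+x. ennreal (g x) * indicator A x \<partial>lborel)"
    if "A \<in> sets borel" for A
    using density_identification[OF Z _ Z _ g _ that] eq by simp
  let ?p = "{x. g x > 0}" and ?m = "{x. g x < 0}"
  have "(\<integral>\<^sup>+x. ennreal (g x) * indicator ?p x \<partial>lborel) = (\<integral>\<^sup>+x. 0 \<partial>(lborel :: (real^'d) measure))"
    by (subst I[symmetric], simp, intro nn_integral_cong) (auto simp: indicator_def ennreal_neg)
  then have p: "AE x in lborel. ennreal (g x) * indicator ?p x = 0" by (subst (asm) nn_integral_const) (simp add: nn_integral_0_iff_AE)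
  have "(\<integral>\<^sup>+x. ennreal (- g x) * indicator ?m x \<partial>lborel) = (\<integral>\<^sup>+x. 0 \<partial>(lborel :: (real^'d) measure))"
    by (subst I, simp, intro nn_integral_cong) (auto simp: indicator_def ennreal_neg)
  then have m: "AE x in lborel. ennreal (- g x) * indicator ?m x = 0" by (subst (asm) nn_integral_const) (simp add: nn_integral_0_iff_AE)
  show ?thesis using p m
  proof eventually_elim
    case (elim x) then show ?case by (cases "g x > 0"; cases "g x < 0") (auto simp: ennreal_eq_0_iff)
  qed
qed

lemma AE_eq_if_tensor_integrals_eq:
  fixes f g :: "real^'d::finite \<Rightarrow> real"
  assumes f: "locally_integrable f" and g: "locally_integrable g"
    and eq: "\<And>u. \<forall>i. u i \<in> bumps \<Longrightarrow> (\<integral>x. f x * tensor u x \<partial>lborel) = (\<integral>x. g x * tensor u x \<partial>lborel)"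
  shows "AE x in lborel. f x = g x"
proof -
  have "AE x in lborel. f x - g x = 0"
  proof (rule AE_eq_0_if_orthogonal_tensors[OF locally_integrable_diff[OF f g]])
    fix u :: "'d \<Rightarrow> real \<Rightarrow> real" assume u: "\<forall>i. u i \<in> bumps"
    show "(\<integral>x. (f x - g x) * tensor u x \<partial>lborel) = 0"
      using integrable_locally_integrable_tensor[OF f u] integrable_locally_integrable_tensor[OF g u] eq[OF u]
      by (simp add: left_diff_distrib)
  qed
  then show ?thesis by simp
qed

section \<open>Weak derivatives\<close>

lemma has_weak_deriv_tensor:
  assumes "has_weak_deriv \<beta> f g" "\<forall>i. u i \<in> bumps"
  shows "(\<integral>x. f x * tensor (\<lambda>i. (deriv ^^ \<beta> i) (u i)) x \<partial>lborel) = (-1) ^ mi_order \<beta> * (\<integral>x. g x * tensor u x \<partial>lborel)"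
  using assms test_function_tensor[OF assms(2)] by (simp add: has_weak_deriv_def tensor.mpartial_F[OF assms(2), symmetric])

lemma has_weak_deriv_unique:
  assumes "has_weak_deriv \<beta> f g" "has_weak_deriv \<beta> f g'"
  shows "AE x in lborel. g x = g' x"
proof (rule AE_eq_if_tensor_integrals_eq)
  fix u :: "'a \<Rightarrow> real \<Rightarrow> real" assume "\<forall>i. u i \<in> bumps"
  from has_weak_deriv_tensor[OF assms(1) this] has_weak_deriv_tensor[OF assms(2) this]
  show "(\<integral>x. g x * tensor u x \<partial>lborel) = (\<integral>x. g' x * tensor u x \<partial>lborel)" by simp
qed (use assms in \<open>auto simp: has_weak_deriv_def\<close>)

lemma weak_deriv_AE_eq:
  assumes "has_weak_deriv \<beta> f g" shows "has_weak_deriv \<beta> f (weak_deriv \<beta> f)" "AE x in lborel. weak_deriv \<beta> f x = g x"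
proof -
  show w: "has_weak_deriv \<beta> f (weak_deriv \<beta> f)" unfolding weak_deriv_def by (rule someI[of "has_weak_deriv \<beta> f", OF assms])
  show "AE x in lborel. weak_deriv \<beta> f x = g x" by (rule has_weak_deriv_unique[OF w assms])
qed

lemma test_function_bounded_support:
  assumes "test_function \<phi>"
  obtains M R where "\<And>x. \<bar>\<phi> x\<bar> \<le> M" "\<And>x. R < norm x \<Longrightarrow> \<phi> x = 0"
proof -
  have c: "continuous_on UNIV \<phi>" using assms by (simp add: test_function_def smooth_def) (metis C_class.simps(1))
  obtain K where K: "compact K" "\<And>x. x \<notin> K \<Longrightarrow> \<phi> x = 0" using assms by (auto simp: test_function_def)
  have "compact (\<phi> ` K)" using K c by (intro compact_continuous_image continuous_on_subset[OF c]) auto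
  then obtain M where M: "\<And>x. x \<in> K \<Longrightarrow> \<bar>\<phi> x\<bar> \<le> M"
    by (metis bounded_iff compact_imp_bounded image_eqI real_norm_def)
  obtain R where "\<forall>x\<in>K. norm x \<le> R" using K(1) compact_imp_bounded bounded_iff by blast
  then have R: "K \<subseteq> cball 0 R" by auto
  show thesis
  proof (rule that[of "\<bar>M\<bar>" R])
    show "\<bar>\<phi> x\<bar> \<le> \<bar>M\<bar>" for x using M[of x] K(2)[of x] by (cases "x \<in> K") auto
    show "\<phi> x = 0" if "R < norm x" for x using that R by (intro K(2)) auto
  qed
qed

lemma partial_support:
  assumes "compact K" "\<And>x. x \<notin> K \<Longrightarrow> \<phi> x = 0" "x \<notin> K" shows "partial i \<phi> x = 0"
proof -
  let ?l = "\<lambda>t. x + t *\<^sub>R axis i 1"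
  have "open (?l -` (- K))"
    by (intro open_vimage continuous_intros) (use assms compact_imp_closed in auto)
  moreover have "0 \<in> ?l -` (- K)" using assms(3) by simp
  moreover have "((\<lambda>t. 0) has_real_derivative 0) (at 0)" by simp
  ultimately have "((\<lambda>t. \<phi> (?l t)) has_real_derivative 0) (at 0)"
    by (rule_tac has_field_derivative_transform_within_open[where S="?l -` (- K)"]) (use assms(2) in auto)
  then show ?thesis unfolding partial_def by (rule DERIV_imp_deriv)
qed

lemma test_function_mpartial:
  assumes "test_function \<phi>" shows "test_function (mpartial \<beta> \<phi>)"
proof -
  have 1: "test_function (partial i \<phi>)" if "test_function \<phi>" for i and \<phi> :: "real^'a \<Rightarrow> real"
  proof -
    obtain K where "compact K" "\<forall>x. x \<notin> K \<longrightarrow> \<phi> x = 0" using \<open>test_function \<phi>\<close> unfolding test_function_def by blast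
    then have "\<forall>x. x \<notin> K \<longrightarrow> partial i \<phi> x = 0" using partial_support by blast
    moreover have "C_class k (partial i \<phi>)" for k
      using that unfolding test_function_def smooth_def by (metis C_class.simps(2))
    ultimately show ?thesis using \<open>compact K\<close> by (auto simp: test_function_def smooth_def)
  qed
  have 2: "test_function ((partial i ^^ n) \<phi>)" if "test_function \<phi>" for i n and \<phi> :: "real^'a \<Rightarrow> real"
    using that by (induction n) (auto intro: 1)
  have "test_function (foldr (\<lambda>i g. (partial i ^^ \<beta> i) g) xs \<phi>)" for xs
    by (induction xs) (auto intro: 2 assms)
  then show ?thesis by (simp add: mpartial_def)
qed

lemma integrable_locally_integrable_test_function:
  assumes "locally_integrable f" "test_function \<phi>"
  shows "integrable lborel (\<lambda>x. f x * \<phi> x)"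
proof -
  have "continuous_on UNIV \<phi>" using assms(2) by (simp add: test_function_def smooth_def) (metis C_class.simps(1))
  then have m: "\<phi> \<in> borel_measurable borel" by (rule borel_measurable_continuous_onI)
  obtain M R where *: "\<And>x. \<bar>\<phi> x\<bar> \<le> M" "\<And>x. R < norm x \<Longrightarrow> \<phi> x = 0"
    by (rule test_function_bounded_support[OF assms(2)]) blast
  show ?thesis by (rule integrable_locally_integrable_mult[OF assms(1) m *])
qed

lemma has_weak_deriv_diff:
  assumes "has_weak_deriv \<beta> f g" "has_weak_deriv \<beta> f' g'"
  shows "has_weak_deriv \<beta> (\<lambda>x. f x - f' x) (\<lambda>x. g x - g' x)"
  unfolding has_weak_deriv_def
proof (intro conjI allI impI)
  note l = assms[unfolded has_weak_deriv_def]
  show "locally_integrable (\<lambda>x. f x - f' x)" "locally_integrable (\<lambda>x. g x - g' x)"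
    using l by (auto intro: locally_integrable_diff)
  fix \<phi> :: "real^'a \<Rightarrow> real" assume t: "test_function \<phi>"
  have "integrable lborel (\<lambda>x. f x * mpartial \<beta> \<phi> x)" "integrable lborel (\<lambda>x. f' x * mpartial \<beta> \<phi> x)"
     "integrable lborel (\<lambda>x. g x * \<phi> x)" "integrable lborel (\<lambda>x. g' x * \<phi> x)"
    using l t test_function_mpartial[OF t] by (auto intro: integrable_locally_integrable_test_function)
  then show "(\<integral>x. (f x - f' x) * mpartial \<beta> \<phi> x \<partial>lborel) = (-1) ^ mi_order \<beta> * (\<integral>x. (g x - g' x) * \<phi> x \<partial>lborel)"
    using l t by (simp add: left_diff_distrib right_diff_distrib)
qed

text \<open>The function \<open>g'\<close> is the \<open>i\<close>-th weak partial derivative of \<open>g\<close>, tested against tensor products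
  of bumps only.\<close>
definition weak_partial :: "'d::finite \<Rightarrow> (real^'d \<Rightarrow> real) \<Rightarrow> (real^'d \<Rightarrow> real) \<Rightarrow> bool" where
  "weak_partial i g g' \<longleftrightarrow> locally_integrable g \<and> locally_integrable g' \<and>
    (\<forall>u. (\<forall>j. u j \<in> bumps) \<longrightarrow>
      (\<integral>x. g x * tensor (u(i := deriv (u i))) x \<partial>lborel) = - (\<integral>x. g' x * tensor u x \<partial>lborel))"

lemma mi_order_upd_Suc: "mi_order (\<beta>(i := Suc (\<beta> i))) = Suc (mi_order \<beta>)"
proof -
  have "mi_order (\<beta>(i := Suc (\<beta> i))) = Suc (\<beta> i) + (\<Sum>j\<in>UNIV - {i}. \<beta> j)"
    unfolding mi_order_def by (subst sum.remove[of _ i]) (auto intro!: sum.cong)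
  also have "\<dots> = Suc (mi_order \<beta>)" unfolding mi_order_def by (subst (2) sum.remove[of _ i]) auto
  finally show ?thesis .
qed

text \<open>\<open>\<partial>\<^sub>i(\<partial>\<^sub>\<beta>f) = \<partial>\<^sub>\<beta>\<^sub>+\<^sub>i f\<close> in the weak sense. This would need the symmetry of iterated derivatives
  of arbitrary test functions; for tensor products it holds by inspection.\<close>
lemma has_weak_deriv_weak_partial:
  assumes g: "has_weak_deriv \<beta> f g" and g': "has_weak_deriv (\<beta>(i := Suc (\<beta> i))) f g'"
  shows "weak_partial i g g'"
  unfolding weak_partial_def
proof (intro conjI allI impI)
  fix u :: "'a \<Rightarrow> real \<Rightarrow> real" assume u: "\<forall>j. u j \<in> bumps"
  let ?v = "u(i := deriv (u i))"
  have "(\<lambda>j. (deriv ^^ \<beta> j) (?v j)) = (\<lambda>j. (deriv ^^ (\<beta>(i := Suc (\<beta> i))) j) (u j))"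
    by (auto simp: fun_eq_iff funpow_swap1)
  then have "(-1) ^ mi_order \<beta> * (\<integral>x. g x * tensor ?v x \<partial>lborel) = (-1) ^ Suc (mi_order \<beta>) * (\<integral>x. g' x * tensor u x \<partial>lborel)"
    using has_weak_deriv_tensor[OF g tensor_upd_deriv_bumps[OF u, of i]] has_weak_deriv_tensor[OF g' u]
    by (simp add: mi_order_upd_Suc del: fun_upd_apply)
  then show "(\<integral>x. g x * tensor ?v x \<partial>lborel) = - (\<integral>x. g' x * tensor u x \<partial>lborel)"
    by (auto simp: power_minus_Bit0 minus_one_power_iff split: if_splits)
qed (use assms in \<open>auto simp: has_weak_deriv_def\<close>)

section \<open>Young functions and Luxemburg bounds\<close>

text \<open>A convex even function that vanishes at \<open>0\<close> and grows at least linearly. The last condition is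
  normalised so that both \<open>|t|\<^sup>p\<close> with \<open>p \<ge> 1\<close> and \<open>e\<^sub>l\<^sub>o\<^sub>g\<close> satisfy it.\<close>
locale young =
  fixes \<Phi> :: "real \<Rightarrow> real"
  assumes convex: "convex_on UNIV \<Phi>" and zero [simp]: "\<Phi> 0 = 0" and even: "\<And>t. \<Phi> (- t) = \<Phi> t"
    and growth: "\<And>t. \<bar>t\<bar> \<le> 1 + \<Phi> t"
begin

lemma convexD: "0 \<le> l \<Longrightarrow> l \<le> 1 \<Longrightarrow> \<Phi> (l * s + (1 - l) * t) \<le> l * \<Phi> s + (1 - l) * \<Phi> t"
  using convex_onD[OF convex, of "1 - l" s t] by simp

lemma nonneg [simp]: "0 \<le> \<Phi> t"
  using convexD[of "1/2" t "- t"] even[of t] by (simp add: field_simps)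

lemma scale: "0 \<le> l \<Longrightarrow> l \<le> 1 \<Longrightarrow> \<Phi> (l * t) \<le> l * \<Phi> t"
  using convexD[of l t 0] by simp

lemma abs_arg: "\<Phi> \<bar>t\<bar> = \<Phi> t"
  by (simp add: abs_if even)

lemma mono: assumes "\<bar>s\<bar> \<le> \<bar>t\<bar>" shows "\<Phi> s \<le> \<Phi> t"
proof (cases "t = 0")
  case False
  have "\<Phi> \<bar>s\<bar> = \<Phi> (\<bar>s\<bar> / \<bar>t\<bar> * \<bar>t\<bar>)" using False by simp
  also have "\<dots> \<le> \<bar>s\<bar> / \<bar>t\<bar> * \<Phi> \<bar>t\<bar>" by (rule scale) (use assms False in auto)
  also have "\<dots> \<le> 1 * \<Phi> \<bar>t\<bar>" by (rule mult_right_mono) (use assms False in auto)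
  finally show ?thesis by (simp add: abs_arg)
qed (use assms in auto)

lemma continuous: "continuous_on UNIV \<Phi>"
  using convex_on_continuous[OF open_UNIV convex] .

lemma measurable [measurable]: "\<Phi> \<in> borel_measurable borel"
  by (rule borel_measurable_continuous_onI[OF continuous])

text \<open>The relation \<open>lux c f\<close> says that \<open>f\<close> is measurable and that its Luxemburg norm for \<open>\<Phi>\<close> is at
  most \<open>c\<close>, where \<open>c > 0\<close>. For \<open>\<Phi>(t) = |t|\<^sup>p\<close> the Luxemburg norm is the \<open>L\<^sup>p\<close> norm.\<close>
definition lux :: "real \<Rightarrow> ('a::euclidean_space \<Rightarrow> real) \<Rightarrow> bool" where
  "lux c f \<longleftrightarrow> 0 < c \<and> f \<in> borel_measurable borel \<and> (\<integral>\<^sup>+x. ennreal (\<Phi> (f x / c)) \<partial>lborel) \<le> 1"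

lemma lux_measurable [measurable_dest]: "lux c f \<Longrightarrow> f \<in> borel_measurable borel"
  and lux_pos: "lux c f \<Longrightarrow> 0 < c"
  by (auto simp: lux_def)

lemma lux_dominated:
  assumes "lux c f" "g \<in> borel_measurable borel" "AE x in lborel. \<bar>g x\<bar> \<le> \<bar>f x\<bar>" "c \<le> c'"
  shows "lux c' g"
proof -
  have c: "0 < c" "0 < c'" using assms by (auto simp: lux_def)
  have "(\<integral>\<^sup>+x. ennreal (\<Phi> (g x / c')) \<partial>lborel) \<le> (\<integral>\<^sup>+x. ennreal (\<Phi> (f x / c)) \<partial>lborel)"
    using assms(3) by (intro nn_integral_mono_AE)
      (auto elim!: eventually_mono intro!: ennreal_leI mono frac_le simp: abs_divide c less_imp_le assms(4))
  then show ?thesis using assms c by (auto simp: lux_def)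
qed

lemma lux_mono: "lux c f \<Longrightarrow> c \<le> c' \<Longrightarrow> lux c' f"
  by (rule lux_dominated[of c f]) auto

lemma lux_AE_cong: "lux c f \<Longrightarrow> g \<in> borel_measurable borel \<Longrightarrow> AE x in lborel. g x = f x \<Longrightarrow> lux c g"
  by (rule lux_dominated[of c f]) (auto elim: eventually_mono)

lemma lux_add:
  assumes "lux c f" "lux c' g" shows "lux (c + c') (\<lambda>x. f x + g x)"
proof -
  note [measurable] = lux_measurable[OF assms(1)] lux_measurable[OF assms(2)]
  have c: "0 < c" "0 < c'" using assms by (auto simp: lux_def)
  define l where "l = c / (c + c')"
  have l: "0 \<le> l" "l \<le> 1" "1 - l = c' / (c + c')" using c by (auto simp: l_def field_simps)
  have "\<Phi> ((f x + g x) / (c + c')) \<le> l * \<Phi> (f x / c) + (1 - l) * \<Phi> (g x / c')" for x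
  proof -
    have "(f x + g x) / (c + c') = l * (f x / c) + (1 - l) * (g x / c')"
      unfolding l(3) using c by (simp add: l_def add_divide_distrib)
    then show ?thesis using convexD[OF l(1,2)] by metis
  qed
  then have "(\<integral>\<^sup>+x. ennreal (\<Phi> ((f x + g x) / (c + c'))) \<partial>lborel)
    \<le> (\<integral>\<^sup>+x. ennreal l * ennreal (\<Phi> (f x / c)) + ennreal (1 - l) * ennreal (\<Phi> (g x / c')) \<partial>lborel)"
  proof (intro nn_integral_mono)
    fix x
    have "ennreal (\<Phi> ((f x + g x) / (c + c'))) \<le> ennreal (l * \<Phi> (f x / c) + (1 - l) * \<Phi> (g x / c'))"
      by (rule ennreal_leI) fact
    also have "\<dots> = ennreal l * ennreal (\<Phi> (f x / c)) + ennreal (1 - l) * ennreal (\<Phi> (g x / c'))"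
      using l(1,2) by (subst ennreal_plus) (auto simp: ennreal_mult simp del: ennreal_plus)
    finally show "ennreal (\<Phi> ((f x + g x) / (c + c'))) \<le> \<dots>" .
  qed
  also have "\<dots> = ennreal l * (\<integral>\<^sup>+x. ennreal (\<Phi> (f x / c)) \<partial>lborel)
      + ennreal (1 - l) * (\<integral>\<^sup>+x. ennreal (\<Phi> (g x / c')) \<partial>lborel)"
    by (subst nn_integral_add) (auto simp: nn_integral_cmult)
  also have "\<dots> \<le> ennreal l * 1 + ennreal (1 - l) * 1"
    using assms by (intro add_mono mult_left_mono) (auto simp: lux_def)
  also have "\<dots> = 1" using l by (simp flip: ennreal_plus)
  finally show ?thesis using c by (auto simp: lux_def)
qed

lemma lux_cmult:
  assumes "lux c f" "\<bar>a\<bar> \<le> K" "0 < K" shows "lux (K * c) (\<lambda>x. a * f x)"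
proof -
  note [measurable] = lux_measurable[OF assms(1)]
  have "0 < c" using assms by (auto simp: lux_def)
  have "lux (K * c) (\<lambda>x. K * f x)" using assms by (auto simp: lux_def)
  then show ?thesis
    by (rule lux_dominated) (use assms in \<open>auto simp: abs_mult intro!: mult_right_mono\<close>)
qed

lemma lux_uminus: "lux c f \<Longrightarrow> lux c (\<lambda>x. - f x)"
  by (auto simp: lux_def even)

lemma lux_diff: "lux c f \<Longrightarrow> lux c' g \<Longrightarrow> lux (c + c') (\<lambda>x. f x - g x)"
  using lux_add[of c f c' "\<lambda>x. - g x"] lux_uminus[of c' g] by simp

lemma lux_sum:
  assumes "finite I" "I \<noteq> {}" "\<And>i. i \<in> I \<Longrightarrow> lux (c i) (f i)"
  shows "lux (\<Sum>i\<in>I. c i) (\<lambda>x. \<Sum>i\<in>I. f i x)"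
  using assms by (induction rule: finite_ne_induct) (auto intro: lux_add)

lemma lux_translate: "lux c f \<Longrightarrow> lux c (\<lambda>x. f (x + h))"
  using nn_integral_lborel_translate[of "\<lambda>x. ennreal (\<Phi> (f x / c))" h] by (auto simp: lux_def)

lemma ennreal_jensen:
  assumes "prob_space M" and [measurable]: "X \<in> borel_measurable M"
  shows "ennreal (\<Phi> (\<integral>s. X s \<partial>M)) \<le> (\<integral>\<^sup>+s. ennreal (\<Phi> (X s)) \<partial>M)"
proof -
  interpret prob_space M by fact
  show ?thesis
  proof (cases "integrable M X \<and> integrable M (\<lambda>s. \<Phi> (X s))")
    case True
    then have "\<Phi> (expectation X) \<le> expectation (\<lambda>s. \<Phi> (X s))"
      by (intro jensens_inequality[where I=UNIV]) (auto simp: convex)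
    then show ?thesis using True by (simp add: nn_integral_eq_integral ennreal_leI)
  next
    case False
    then show ?thesis
    proof (cases "integrable M X")
      case True
      then have *: "\<not> integrable M (\<lambda>s. \<Phi> (X s))" using False by blast
      have "(\<integral>\<^sup>+s. ennreal (\<Phi> (X s)) \<partial>M) = \<infinity>"
      proof (rule ccontr)
        assume "(\<integral>\<^sup>+s. ennreal (\<Phi> (X s)) \<partial>M) \<noteq> \<infinity>"
        then have "(\<integral>\<^sup>+s. ennreal (\<Phi> (X s)) \<partial>M) < \<infinity>"
          unfolding infinity_ennreal_def by (rule top.not_eq_extremum[THEN iffD1])
        then have "integrable M (\<lambda>s. \<Phi> (X s))" by (intro integrableI_nonneg) auto
        with * show False by blast
      qed
      then show ?thesis by simp
    qed (simp add: not_integrable_integral_eq)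
  qed
qed

text \<open>Minkowski's integral inequality. If \<open>F x\<close> is not integrable for some \<open>x\<close>, then the
  Bochner integral is \<open>0\<close> there and the estimate holds all the same, because \<open>\<Phi> 0 = 0\<close>.\<close>
lemma lux_average:
  fixes F :: "'a::euclidean_space \<Rightarrow> 'b \<Rightarrow> real"
  assumes M: "prob_space M"
    and F[measurable]: "(\<lambda>(x, s). F x s) \<in> borel_measurable (borel \<Otimes>\<^sub>M M)"
    and b: "\<And>s. s \<in> space M \<Longrightarrow> lux c (\<lambda>x. F x s)"
  shows "lux c (\<lambda>x. \<integral>s. F x s \<partial>M)"
proof -
  interpret M: prob_space M by fact
  interpret pair_sigma_finite lborel M ..
  have c: "0 < c" using b M.not_empty by (auto simp: lux_def)
  have F'[measurable]: "(\<lambda>(x, s). F x s) \<in> borel_measurable (lborel \<Otimes>\<^sub>M M)"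
    using F measurable_cong_sets[OF sets_pair_measure_cong[OF sets_lborel refl] refl] by blast
  have m: "F x \<in> borel_measurable M" for x using measurable_Pair2[OF F', of x] by simp
  have "(\<integral>\<^sup>+x. ennreal (\<Phi> ((\<integral>s. F x s \<partial>M) / c)) \<partial>lborel) \<le> (\<integral>\<^sup>+x. (\<integral>\<^sup>+s. ennreal (\<Phi> (F x s / c)) \<partial>M) \<partial>lborel)"
  proof (rule nn_integral_mono)
    fix x show "ennreal (\<Phi> ((\<integral>s. F x s \<partial>M) / c)) \<le> (\<integral>\<^sup>+s. ennreal (\<Phi> (F x s / c)) \<partial>M)"
      using ennreal_jensen[OF M, of "\<lambda>s. F x s / c"] m by simp
  qed
  also have "\<dots> = (\<integral>\<^sup>+s. (\<integral>\<^sup>+x. ennreal (\<Phi> (F x s / c)) \<partial>lborel) \<partial>M)"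
    by (rule Fubini'[symmetric]) simp
  also have "\<dots> \<le> (\<integral>\<^sup>+s. 1 \<partial>M)" using b by (intro nn_integral_mono) (auto simp: lux_def)
  also have "\<dots> = 1" by (simp add: M.emeasure_space_1)
  finally show ?thesis unfolding lux_def using c F by auto
qed

lemma lux_ball:
  fixes f :: "'a::euclidean_space \<Rightarrow> real"
  assumes "lux c f"
  shows "(\<integral>\<^sup>+x. ennreal \<bar>f x\<bar> * indicator (cball 0 R) x \<partial>lborel)
    \<le> ennreal c * (emeasure lborel (cball (0::'a) R) + 1)"
proof -
  note [measurable] = lux_measurable[OF assms]
  have [measurable]: "cball (0::'a) R \<in> sets borel" by simp
  have c: "0 < c" using assms by (auto simp: lux_def)
  have "(\<integral>\<^sup>+x. ennreal \<bar>f x\<bar> * indicator (cball 0 R) x \<partial>lborel)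
     \<le> (\<integral>\<^sup>+x. ennreal c * (indicator (cball 0 R) x + ennreal (\<Phi> (f x / c))) \<partial>lborel)"
  proof (rule nn_integral_mono)
    fix x
    have "\<bar>f x\<bar> \<le> c * (1 + \<Phi> (f x / c))" using growth[of "f x / c"] c by (simp add: abs_divide field_simps)
    then show "ennreal \<bar>f x\<bar> * indicator (cball 0 R) x \<le> ennreal c * (indicator (cball 0 R) x + ennreal (\<Phi> (f x / c)))"
      using c by (auto simp: indicator_def ennreal_leI simp flip: ennreal_mult ennreal_plus ennreal_1)
  qed
  also have "\<dots> = ennreal c * (emeasure lborel (cball (0::'a) R) + (\<integral>\<^sup>+x. ennreal (\<Phi> (f x / c)) \<partial>lborel))"
    by (simp add: nn_integral_cmult nn_integral_add)
  also have "\<dots> \<le> ennreal c * (emeasure lborel (cball (0::'a) R) + 1)"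
    using assms by (intro mult_left_mono add_left_mono) (auto simp: lux_def)
  finally show ?thesis .
qed

lemma lux_locally_integrable:
  fixes f :: "real^'d::finite \<Rightarrow> real"
  assumes "lux c f" shows "locally_integrable f"
proof (rule locally_integrableI[OF lux_measurable[OF assms]])
  fix R
  have "ennreal c * (emeasure lborel (cball (0::real^'d) R) + 1) < \<infinity>"
    using emeasure_lborel_cball_finite[of "0::real^'d" R] by (simp add: ennreal_mult_less_top)
  then show "(\<integral>\<^sup>+x. ennreal \<bar>f x\<bar> * indicator (cball 0 R) x \<partial>lborel) < \<infinity>"
    using lux_ball[OF assms] by (rule le_less_trans[rotated])
qed

text \<open>Completeness, in the form of the countable triangle inequality: a series whose bounds are summable
  converges absolutely almost everywhere.\<close>
lemma lux_series:
  fixes u :: "nat \<Rightarrow> 'a::euclidean_space \<Rightarrow> real"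
  assumes u: "\<And>j. lux (c j) (u j)" and c: "summable c"
  shows "AE x in lborel. summable (\<lambda>j. \<bar>u j x\<bar>)" "lux (suminf c) (\<lambda>x. \<Sum>j. \<bar>u j x\<bar>)"
    "lux (suminf c) (\<lambda>x. \<Sum>j. u j x)"
proof -
  note [measurable] = lux_measurable[OF u]
  have cpos: "0 < c j" for j using u by (auto simp: lux_def)
  have spos: "0 < suminf c" by (rule suminf_pos[OF c cpos])
  let ?S = "\<lambda>n x. \<Sum>j<n. \<bar>u j x\<bar>"
  have S: "lux (suminf c) (?S n)" for n
  proof (cases n)
    case (Suc m)
    have "lux (\<Sum>j<n. c j) (?S n)"
      by (rule lux_sum) (use Suc in \<open>auto intro!: lux_dominated[OF u]\<close>)
    then show ?thesis
      by (rule lux_mono, intro sum_le_suminf[OF c]) (auto intro: less_imp_le cpos)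
  qed (auto simp: lux_def spos)
  show ae: "AE x in lborel. summable (\<lambda>j. \<bar>u j x\<bar>)"
  proof -
    have "AE x in lborel. (SUP n. ennreal (?S n x) * indicator (cball 0 (real N)) x) < \<infinity>" for N :: nat
    proof -
      have [measurable]: "cball (0::'a) (real N) \<in> sets borel" by simp
      define G where "G x = (SUP n. ennreal (?S n x) * indicator (cball 0 (real N)) x)" for x
      have "(\<integral>\<^sup>+x. (SUP n. ennreal (?S n x) * indicator (cball 0 (real N)) x) \<partial>lborel)
         = (SUP n. \<integral>\<^sup>+x. ennreal (?S n x) * indicator (cball 0 (real N)) x \<partial>lborel)"
        by (rule nn_integral_monotone_convergence_SUP)
          (auto simp: incseq_def le_fun_def intro!: mult_right_mono ennreal_leI sum_mono2)
      also have "\<dots> \<le> ennreal (suminf c) * (emeasure lborel (cball (0::'a) (real N)) + 1)"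
      proof (rule SUP_least)
        fix n
        have "\<bar>?S n x\<bar> = ?S n x" for x by (simp add: sum_nonneg)
        then show "(\<integral>\<^sup>+x. ennreal (?S n x) * indicator (cball 0 (real N)) x \<partial>lborel)
          \<le> ennreal (suminf c) * (emeasure lborel (cball (0::'a) (real N)) + 1)"
          using lux_ball[OF S[of n], of "real N"] by simp
      qed
      also have "\<dots> < \<infinity>"
        using emeasure_lborel_cball_finite[of "0::'a" "real N"] by (simp add: ennreal_mult_less_top)
      finally have fin: "(\<integral>\<^sup>+x. G x \<partial>lborel) \<noteq> \<infinity>" unfolding G_def by (rule less_imp_neq)
      have "AE x in lborel. G x \<noteq> \<infinity>"
        by (rule nn_integral_noteq_infinite[OF _ fin]) (simp add: G_def)
      then have "AE x in lborel. G x < \<infinity>" by (simp add: less_top)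
      then show ?thesis unfolding G_def .
    qed
    then have "AE x in lborel. \<forall>N::nat. (SUP n. ennreal (?S n x) * indicator (cball 0 (real N)) x) < \<infinity>"
      by (simp add: AE_all_countable)
    then show ?thesis
    proof eventually_elim
      case (elim x)
      obtain N :: nat where N: "norm x \<le> real N" using real_arch_simple by blast
      have "(SUP n. ennreal (?S n x) * indicator (cball 0 (real N)) x) < \<infinity>" using elim by blast
      then have "(SUP n. ennreal (?S n x)) < \<infinity>" using N by simp
      then obtain B where B: "(SUP n. ennreal (?S n x)) = ennreal B" "0 \<le> B" by (cases "SUP n. ennreal (?S n x)") auto
      have "?S n x \<le> B" for n
      proof -
        have "ennreal (?S n x) \<le> ennreal B" unfolding B(1)[symmetric] by (rule SUP_upper) simp
        then show ?thesis using B(2) by (simp add: ennreal_le_iff)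
      qed
      then show ?case by (intro summableI_nonneg_bounded[of _ B]) auto
    qed
  qed
  show V: "lux (suminf c) (\<lambda>x. \<Sum>j. \<bar>u j x\<bar>)"
    unfolding lux_def
  proof (intro conjI spos)
    have "(\<integral>\<^sup>+x. ennreal (\<Phi> ((\<Sum>j. \<bar>u j x\<bar>) / suminf c)) \<partial>lborel)
       = (\<integral>\<^sup>+x. liminf (\<lambda>n. ennreal (\<Phi> (?S n x / suminf c))) \<partial>lborel)"
    proof (rule nn_integral_cong_AE)
      show "AE x in lborel. ennreal (\<Phi> ((\<Sum>j. \<bar>u j x\<bar>) / suminf c)) = liminf (\<lambda>n. ennreal (\<Phi> (?S n x / suminf c)))"
        using ae
      proof eventually_elim
        case (elim x)
        have "(\<lambda>n. ?S n x / suminf c) \<longlonglongrightarrow> (\<Sum>j. \<bar>u j x\<bar>) / suminf c"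
          using spos by (intro tendsto_divide summable_LIMSEQ elim) auto
        then have "(\<lambda>n. \<Phi> (?S n x / suminf c)) \<longlonglongrightarrow> \<Phi> ((\<Sum>j. \<bar>u j x\<bar>) / suminf c)"
          by (rule continuous_on_tendsto_compose[OF continuous]) auto
        then have "(\<lambda>n. ennreal (\<Phi> (?S n x / suminf c))) \<longlonglongrightarrow> ennreal (\<Phi> ((\<Sum>j. \<bar>u j x\<bar>) / suminf c))"
          by (rule tendsto_ennrealI)
        then show ?case by (intro lim_imp_Liminf[symmetric]) auto
      qed
    qed
    also have "\<dots> \<le> liminf (\<lambda>n. \<integral>\<^sup>+x. ennreal (\<Phi> (?S n x / suminf c)) \<partial>lborel)"
      by (rule nn_integral_liminf) measurable
    also have "\<dots> \<le> liminf (\<lambda>n. 1)"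
      using S by (intro Liminf_mono always_eventually) (auto simp: lux_def)
    finally show "(\<integral>\<^sup>+x. ennreal (\<Phi> ((\<Sum>j. \<bar>u j x\<bar>) / suminf c)) \<partial>lborel) \<le> 1" by (simp add: Liminf_const)
  qed measurable
  show "lux (suminf c) (\<lambda>x. \<Sum>j. u j x)"
  proof (rule lux_dominated[OF V _ _ order_refl])
    show "AE x in lborel. \<bar>\<Sum>j. u j x\<bar> \<le> \<bar>\<Sum>j. \<bar>u j x\<bar>\<bar>"
      using ae
    proof eventually_elim
      case (elim x) then show ?case using summable_rabs[OF elim] by linarith
    qed
  qed measurable
qed

text \<open>Interpolation between \<open>L\<^sup>1\<close> and \<open>L\<^sup>\<infinity>\<close>, for \<open>f\<close> of \<open>L\<^sup>1\<close> norm \<open>a\<close> and height \<open>a s\<close>. By convexity \<open>\<Phi>(t/b) \<le> |t|/s \<cdot> \<Phi>(s/b) \<le> |t|\<close> for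
  \<open>|t| \<le> s\<close>, to be applied to \<open>t = f(x)/a\<close>. This is where
  the exponent \<open>d/p\<^sub>*\<close> and the logarithm in the rates come from.\<close>
lemma lux_interpolation:
  assumes [measurable]: "f \<in> borel_measurable borel"
    and L1: "(\<integral>\<^sup>+x. ennreal \<bar>f x\<bar> \<partial>lborel) \<le> ennreal a" and Linf: "\<And>x. \<bar>f x\<bar> \<le> a * s"
    and b: "\<Phi> (s / b) \<le> s" and pos: "0 < a" "0 < b" "0 < s"
  shows "lux (a * b) f"
proof -
  have "\<Phi> (f x / (a * b)) \<le> \<bar>f x\<bar> / a" for x
  proof -
    have "\<Phi> (f x / (a * b)) = \<Phi> (\<bar>f x\<bar> / (a * b))" using abs_arg[of "f x / (a * b)"] pos by (simp add: abs_mult)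
    also have "\<bar>f x\<bar> / (a * b) = (\<bar>f x\<bar> / (a * s)) * (s / b)" using pos by simp
    also have "\<Phi> \<dots> \<le> (\<bar>f x\<bar> / (a * s)) * \<Phi> (s / b)"
      by (rule scale) (use pos Linf[of x] in auto)
    also have "\<dots> \<le> (\<bar>f x\<bar> / (a * s)) * s" by (rule mult_left_mono) (use pos b in auto)
    finally show ?thesis using pos by simp
  qed
  then have "(\<integral>\<^sup>+x. ennreal (\<Phi> (f x / (a * b))) \<partial>lborel) \<le> (\<integral>\<^sup>+x. ennreal (1 / a) * ennreal \<bar>f x\<bar> \<partial>lborel)"
    using pos by (intro nn_integral_mono) (simp add: ennreal_leI flip: ennreal_mult)
  also have "\<dots> \<le> ennreal (1 / a) * ennreal a" by (simp add: nn_integral_cmult mult_left_mono L1)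
  also have "\<dots> = 1" using pos by (simp flip: ennreal_mult)
  finally show ?thesis using pos by (auto simp: lux_def)
qed

end

section \<open>Increments of weakly differentiable functions\<close>

text \<open>The difference of a bump and its translate is the derivative of a bump, with an explicit primitive.
  The primitive has compact support since the integral of the difference vanishes.\<close>
lemma bump_difference:
  assumes u: "u \<in> bumps"
  obtains w where "w \<in> bumps" "deriv w = (\<lambda>r. u (r - t) - u r)"
    "\<And>r. (\<integral>s. indicator {0..1} s * (t * u (r - s * t)) \<partial>lborel) = - w r"
proof -
  have "\<exists>A. \<forall>x::real. -\<infinity> < ereal x \<longrightarrow> ereal x < \<infinity> \<longrightarrow> (A has_vector_derivative u x) (at x)"
    by (rule einterval_antiderivative)
      (use bumps_continuous[OF u] in \<open>auto simp: continuous_on_eq_continuous_at\<close>)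
  then obtain A where "\<And>x. (A has_vector_derivative u x) (at x)" by auto
  then have A: "(A has_real_derivative u x) (at x)" for x
    by (simp add: has_real_derivative_iff_has_vector_derivative)
  define w where "w r = A (r - t) - A r" for r
  have dw: "(w has_real_derivative u (r - t) - u r) (at r)" for r
  proof -
    have "((\<lambda>r. A (r - t)) has_real_derivative u (r - t) * 1) (at r)"
      by (rule DERIV_chain2[OF A]) (auto intro!: derivative_eq_intros)
    then show ?thesis unfolding w_def[abs_def] using A[of r] by (auto intro!: derivative_eq_intros)
  qed
  obtain R where R: "\<And>t. R < \<bar>t\<bar> \<Longrightarrow> u t = 0" using u by (auto simp: bumps_def)
  have const: "A x = A y" if "\<forall>z\<in>{x..y}. R < \<bar>z\<bar>" "x \<le> y" for x y
  proof (cases "x = y")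
    case False
    then have "x < y" using that by simp
    then obtain z where z: "x < z" "z < y" "A y - A x = (y - x) * u z" using MVT2[of x y A u] A by blast
    then have "u z = 0" using that by (intro R) auto
    then show ?thesis using z by simp
  qed simp
  have "w r = 0" if r: "\<bar>R\<bar> + \<bar>t\<bar> < \<bar>r\<bar>" for r
  proof (cases "t \<ge> 0")
    case True
    have "A (r - t) = A r" by (rule const) (use r True in \<open>auto simp: abs_if split: if_splits\<close>)
    then show ?thesis by (simp add: w_def)
  next
    case False
    have "A r = A (r - t)" by (rule const) (use r False in \<open>auto simp: abs_if split: if_splits\<close>)
    then show ?thesis by (simp add: w_def)
  qed
  moreover have "diff_times n w" for n
  proof -
    have "diff_times n (\<lambda>r. u (1 * r + - t) + (- 1) * u r)"
      using u by (intro diff_times_add diff_times_mult diff_times_const diff_times_affine) (auto simp: bumps_def)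
    then have "diff_times (Suc n) w" by (intro diff_timesI[OF dw]) simp
    then show ?thesis by (rule diff_times_Suc)
  qed
  ultimately have "w \<in> bumps" unfolding bumps_def by blast
  moreover have "deriv w = (\<lambda>r. u (r - t) - u r)" by (rule bumps_deriv_eq[OF dw])
  moreover have "(\<integral>s. indicator {0..1} s * (t * u (r - s * t)) \<partial>lborel) = - w r" for r
  proof -
    have "(\<integral>s. (- t * u (r - s * t)) * indicator {0..1} s \<partial>lborel) = A (r - 1 * t) - A (r - 0 * t)"
    proof (rule integral_FTC_Icc_real)
      fix x :: real
      have "((\<lambda>s. A (r - s * t)) has_real_derivative u (r - x * t) * (- t)) (at x)"
        by (rule DERIV_chain2[OF A]) (auto intro!: derivative_eq_intros)
      then show "((\<lambda>s. A (r - s * t)) has_real_derivative - t * u (r - x * t)) (at x)" by (simp add: mult.commute)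
      have "isCont (\<lambda>s. u (r - s * t)) x"
        by (rule isCont_o2[where g=u])
          (use bumps_continuous[OF u] in \<open>auto simp: continuous_on_eq_continuous_at intro!: continuous_intros\<close>)
      then show "isCont (\<lambda>s. - t * u (r - s * t)) x" by (intro continuous_intros)
    qed simp
    then show ?thesis by (simp add: w_def mult_ac minus_equation_iff[of "A _"] algebra_simps)
  qed
  ultimately show thesis by (rule that)
qed

text \<open>The integrability on the product space that the two applications of Fubini's theorem below need.\<close>
lemma integrable_strip:
  fixes f :: "'a::euclidean_space \<Rightarrow> real \<Rightarrow> real"
  assumes [measurable]: "(\<lambda>(x, s). f x s) \<in> borel_measurable (borel \<Otimes>\<^sub>M borel)"
    and B: "\<And>s. s \<in> {0..1} \<Longrightarrow> (\<integral>\<^sup>+x. ennreal \<bar>f x s\<bar> \<partial>lborel) \<le> B" "B < \<infinity>"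
  shows "integrable (lborel \<Otimes>\<^sub>M lborel) (\<lambda>(x, s). indicator {0..1} s * f x s)"
proof (rule integrableI_bounded)
  have m: "(\<lambda>(x, s). f x s) \<in> borel_measurable (lborel \<Otimes>\<^sub>M lborel)"
    using assms(1) by (simp cong: measurable_cong_sets)
  note [measurable] = m
  show "(\<lambda>(x, s). indicator {0..1} s * f x s) \<in> borel_measurable (lborel \<Otimes>\<^sub>M lborel)" by measurable
  have "(\<integral>\<^sup>+z. ennreal (norm (case z of (x, s) \<Rightarrow> indicator {0..1} s * f x s)) \<partial>(lborel \<Otimes>\<^sub>M lborel))
    = (\<integral>\<^sup>+z. (case z of (x, s) \<Rightarrow> indicator {0..1} s * ennreal \<bar>f x s\<bar>) \<partial>(lborel \<Otimes>\<^sub>M lborel))"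
    by (intro nn_integral_cong) (auto simp: indicator_def)
  also have "\<dots> = (\<integral>\<^sup>+s. (\<integral>\<^sup>+x. indicator {0..1} s * ennreal \<bar>f x s\<bar> \<partial>lborel) \<partial>lborel)"
    by (subst lborel_pair.nn_integral_snd[symmetric]) auto
  also have "\<dots> \<le> (\<integral>\<^sup>+s. B * indicator {0..1::real} s \<partial>lborel)"
    by (intro nn_integral_mono) (use B(1) in \<open>auto simp: indicator_def\<close>)
  also have "\<dots> = B" by (simp add: nn_integral_cmult)
  finally show "(\<integral>\<^sup>+z. ennreal (norm (case z of (x, s) \<Rightarrow> indicator {0..1} s * f x s)) \<partial>(lborel \<Otimes>\<^sub>M lborel)) < \<infinity>"
    using B(2) by (rule le_less_trans)
qed

lemma tensor_translate:
  "tensor u (x - t *\<^sub>R axis i 1) = tensor (u(i := (\<lambda>r. u i (r - t)))) x"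
proof -
  have "tensor u (x - t *\<^sub>R axis i 1) = tensor (u(i := u i)) (x - t *\<^sub>R axis i 1)" by simp
  also have "\<dots> = u i (x $ i - t) * (\<Prod>j\<in>UNIV - {i}. u j (x $ j))"
    unfolding tensor_upd by (intro arg_cong2[where f="(*)"] prod.cong) (auto simp: axis_def)
  finally show ?thesis by (simp add: tensor_upd)
qed

lemma weak_partialD:
  assumes "weak_partial i g g'" "\<forall>j. u j \<in> bumps"
  shows "(\<integral>x. g x * tensor (u(i := deriv (u i))) x \<partial>lborel) = - (\<integral>x. g' x * tensor u x \<partial>lborel)"
  using assms unfolding weak_partial_def by blast

text \<open>The fundamental theorem of calculus for weak partial derivatives. Both sides are tested against a
  tensor product of bumps. On the left the difference falls on the \<open>i\<close>-th factor, is the derivative of a bump by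
  \<open>bump_difference\<close>, and the weak derivative applies; Fubini's theorem identifies the result with the right.\<close>
lemma weak_partial_increment:
  fixes g :: "real^'d::finite \<Rightarrow> real"
  assumes w: "weak_partial i g g'"
  shows "AE x in lborel. g (x + t *\<^sub>R axis i 1) - g x =
    (\<integral>s. indicator {0..1} s * (t * g' (x + (s * t) *\<^sub>R axis i 1)) \<partial>lborel)"
proof -
  define e :: "real^'d" where "e = axis i 1"
  have g: "locally_integrable g" and g': "locally_integrable g'" using w by (auto simp: weak_partial_def)
  note [measurable] = locally_integrable_measurable[OF g] locally_integrable_measurable[OF g']
  have ne: "norm e = 1" by (simp add: e_def)
  define H where "H x = (\<integral>s. indicator {0..1} s * (t * g' (x + (s * t) *\<^sub>R e)) \<partial>lborel)" for x
  have mH[measurable]: "H \<in> borel_measurable borel"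
    unfolding H_def[abs_def] by measurable
  have nst: "norm ((s * t) *\<^sub>R e) \<le> \<bar>t\<bar>" if "s \<in> {0..1}" for s
    using that ne mult_right_mono[of s 1 "\<bar>t\<bar>"] by (simp add: abs_mult)
  have bound: "(\<integral>\<^sup>+x. ennreal \<bar>g' (x + (s * t) *\<^sub>R e)\<bar> * indicator (cball 0 R) x \<partial>lborel)
      \<le> (\<integral>\<^sup>+x. ennreal \<bar>g' x\<bar> * indicator (cball 0 (R + \<bar>t\<bar>)) x \<partial>lborel)" if s: "s \<in> {0..1}" for s R
  proof -
    let ?h = "(s * t) *\<^sub>R e"
    have [measurable]: "cball (0::real^'d) (R + \<bar>t\<bar>) \<in> sets borel" by simp
    have "(\<integral>\<^sup>+x. ennreal \<bar>g' (x + ?h)\<bar> * indicator (cball 0 R) x \<partial>lborel)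
      \<le> (\<integral>\<^sup>+x. ennreal \<bar>g' (x + ?h)\<bar> * indicator (cball 0 (R + \<bar>t\<bar>)) (x + ?h) \<partial>lborel)"
    proof (intro nn_integral_mono mult_left_mono)
      fix x show "indicator (cball 0 R) x \<le> (indicator (cball 0 (R + \<bar>t\<bar>)) (x + ?h) :: ennreal)"
        using norm_triangle_le[of x ?h "R + \<bar>t\<bar>"] nst[OF s] by (auto simp: indicator_def)
    qed simp
    also have "\<dots> = (\<integral>\<^sup>+x. ennreal \<bar>g' x\<bar> * indicator (cball 0 (R + \<bar>t\<bar>)) x \<partial>lborel)"
      by (rule nn_integral_lborel_translate) measurable
    finally show ?thesis .
  qed
  have H_loc: "locally_integrable H"
  proof (rule locally_integrableI[OF mH])
    fix R
    have [measurable]: "cball (0::real^'d) R \<in> sets borel" by simp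
    let ?B = "(\<integral>\<^sup>+x. ennreal \<bar>g' x\<bar> * indicator (cball 0 (R + \<bar>t\<bar>)) x \<partial>lborel)"
    have *: "ennreal \<bar>H x\<bar> \<le> (\<integral>\<^sup>+s. ennreal \<bar>indicator {0..1} s * (t * g' (x + (s * t) *\<^sub>R e))\<bar> \<partial>lborel)" for x
      using integral_norm_bound_ennreal[of lborel "\<lambda>s. indicator {0..1} s * (t * g' (x + (s * t) *\<^sub>R e))"]
      by (cases "integrable lborel (\<lambda>s. indicator {0..1} s * (t * g' (x + (s * t) *\<^sub>R e)))")
        (auto simp: H_def not_integrable_integral_eq)
    have "(\<integral>\<^sup>+x. ennreal \<bar>H x\<bar> * indicator (cball 0 R) x \<partial>lborel) \<le>
      (\<integral>\<^sup>+x. (\<integral>\<^sup>+s. ennreal \<bar>indicator {0..1} s * (t * g' (x + (s * t) *\<^sub>R e))\<bar> \<partial>lborel) * indicator (cball 0 R) x \<partial>lborel)"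
      by (intro nn_integral_mono mult_right_mono *) simp
    also have "\<dots> = (\<integral>\<^sup>+x. (\<integral>\<^sup>+s. ennreal \<bar>indicator {0..1} s * (t * g' (x + (s * t) *\<^sub>R e))\<bar> * indicator (cball 0 R) x \<partial>lborel) \<partial>lborel)"
      by (intro nn_integral_cong nn_integral_multc[symmetric]) measurable
    also have "\<dots> = (\<integral>\<^sup>+s. (\<integral>\<^sup>+x. ennreal \<bar>indicator {0..1} s * (t * g' (x + (s * t) *\<^sub>R e))\<bar> * indicator (cball 0 R) x \<partial>lborel) \<partial>lborel)"
      by (rule lborel_pair.Fubini'[symmetric]) measurable
    also have "\<dots> \<le> (\<integral>\<^sup>+s. ennreal \<bar>t\<bar> * ?B * indicator {0..1::real} s \<partial>lborel)"
    proof (rule nn_integral_mono)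
      fix s :: real
      show "(\<integral>\<^sup>+x. ennreal \<bar>indicator {0..1} s * (t * g' (x + (s * t) *\<^sub>R e))\<bar> * indicator (cball 0 R) x \<partial>lborel)
         \<le> ennreal \<bar>t\<bar> * ?B * indicator {0..1} s"
      proof (cases "s \<in> {0..1}")
        case True
        have "(\<integral>\<^sup>+x. ennreal \<bar>indicator {0..1} s * (t * g' (x + (s * t) *\<^sub>R e))\<bar> * indicator (cball 0 R) x \<partial>lborel)
          = (\<integral>\<^sup>+x. ennreal \<bar>t\<bar> * (ennreal \<bar>g' (x + (s * t) *\<^sub>R e)\<bar> * indicator (cball 0 R) x) \<partial>lborel)"
          using True by (intro nn_integral_cong) (simp add: abs_mult ennreal_mult mult.assoc)
        also have "\<dots> = ennreal \<bar>t\<bar> * (\<integral>\<^sup>+x. ennreal \<bar>g' (x + (s * t) *\<^sub>R e)\<bar> * indicator (cball 0 R) x \<partial>lborel)"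
          by (rule nn_integral_cmult) measurable
        also have "\<dots> \<le> ennreal \<bar>t\<bar> * ?B" by (intro mult_left_mono bound True) simp
        finally show ?thesis using True by simp
      qed simp
    qed
    also have "\<dots> = ennreal \<bar>t\<bar> * ?B" by (simp add: nn_integral_cmult)
    also have "\<dots> < \<infinity>" using locally_integrableD[OF g', of "R + \<bar>t\<bar>"] by (simp add: ennreal_mult_less_top)
    finally show "(\<integral>\<^sup>+x. ennreal \<bar>H x\<bar> * indicator (cball 0 R) x \<partial>lborel) < \<infinity>" .
  qed
  have "AE x in lborel. g (x + t *\<^sub>R e) - g x = H x"
  proof (rule AE_eq_if_tensor_integrals_eq[OF locally_integrable_diff[OF locally_integrable_translate[OF g] g] H_loc])
    fix u :: "'d \<Rightarrow> real \<Rightarrow> real" assume u: "\<forall>i. u i \<in> bumps"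
    note [measurable] = tensor_measurable[OF u]
    obtain M where M: "0 < M" "\<And>x. \<bar>tensor u x\<bar> \<le> M" by (rule tensor_bounded[OF u]) blast
    obtain R where R: "\<And>x. R < norm x \<Longrightarrow> tensor u x = 0" by (rule tensor_support[OF u]) blast
    from u obtain v where v: "v \<in> bumps" "deriv v = (\<lambda>r. u i (r - t) - u i r)"
      "\<And>r. (\<integral>s. indicator {0..1} s * (t * u i (r - s * t)) \<partial>lborel) = - v r"
      by (metis bump_difference)
    have uv: "\<forall>j. (u(i := v)) j \<in> bumps" using u v by auto
    let ?L = "\<lambda>x s. t * (g' (x + (s * t) *\<^sub>R e) * tensor u x)"
    let ?K = "\<lambda>x s. t * (g' x * tensor u (x - (s * t) *\<^sub>R e))"
    let ?B = "ennreal (\<bar>t\<bar> * M) * (\<integral>\<^sup>+x. ennreal \<bar>g' x\<bar> * indicator (cball 0 (R + \<bar>t\<bar>)) x \<partial>lborel)"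
    have B: "?B < \<infinity>" using locally_integrableD[OF g', of "R + \<bar>t\<bar>"] by (simp add: ennreal_mult_less_top)
    have Lb: "(\<integral>\<^sup>+x. ennreal \<bar>?L x s\<bar> \<partial>lborel) \<le> ?B" if s: "s \<in> {0..1}" for s
    proof -
      have [measurable]: "cball (0::real^'d) R \<in> sets borel" by simp
      have "(\<integral>\<^sup>+x. ennreal \<bar>?L x s\<bar> \<partial>lborel) \<le>
        (\<integral>\<^sup>+x. ennreal (\<bar>t\<bar> * M) * (ennreal \<bar>g' (x + (s * t) *\<^sub>R e)\<bar> * indicator (cball 0 R) x) \<partial>lborel)"
      proof (rule nn_integral_mono)
        fix x
        show "ennreal \<bar>?L x s\<bar> \<le> ennreal (\<bar>t\<bar> * M) * (ennreal \<bar>g' (x + (s * t) *\<^sub>R e)\<bar> * indicator (cball 0 R) x)"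
        proof (cases "R < norm x")
          case False
          have "\<bar>?L x s\<bar> \<le> \<bar>t\<bar> * M * \<bar>g' (x + (s * t) *\<^sub>R e)\<bar>"
            using mult_left_mono[OF M(2)[of x], of "\<bar>t\<bar> * \<bar>g' (x + (s * t) *\<^sub>R e)\<bar>"] by (simp add: abs_mult mult_ac)
          then show ?thesis using False M(1) by (simp add: ennreal_leI flip: ennreal_mult)
        qed (simp add: R)
      qed
      also have "\<dots> = ennreal (\<bar>t\<bar> * M) * (\<integral>\<^sup>+x. ennreal \<bar>g' (x + (s * t) *\<^sub>R e)\<bar> * indicator (cball 0 R) x \<partial>lborel)"
        by (rule nn_integral_cmult) measurable
      also have "\<dots> \<le> ?B" by (intro mult_left_mono bound s) simp
      finally show ?thesis .
    qed
    have KL: "(\<integral>\<^sup>+x. ennreal \<bar>?K x s\<bar> \<partial>lborel) = (\<integral>\<^sup>+x. ennreal \<bar>?L x s\<bar> \<partial>lborel)" for s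
      using nn_integral_lborel_translate[of "\<lambda>x. ennreal \<bar>?K x s\<bar>" "(s * t) *\<^sub>R e"] by simp
    have iL: "integrable (lborel \<Otimes>\<^sub>M lborel) (\<lambda>(x, s). indicator {0..1} s * ?L x s)"
      by (rule integrable_strip[OF _ Lb B]) measurable
    have iK: "integrable (lborel \<Otimes>\<^sub>M lborel) (\<lambda>(x, s). indicator {0..1} s * ?K x s)"
      by (rule integrable_strip[OF _ _ B]) (use Lb KL in auto)
    have tu: "(\<integral>s. indicator {0..1} s * ?K x s \<partial>lborel) = - (g' x * tensor (u(i := v)) x)" for x
    proof -
      have "(\<integral>s. indicator {0..1} s * ?K x s \<partial>lborel) =
        (\<integral>s. (g' x * (\<Prod>j\<in>UNIV - {i}. u j (x $ j))) * (indicator {0..1} s * (t * u i (x $ i - s * t))) \<partial>lborel)"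
        unfolding e_def tensor_translate tensor_upd by (intro Bochner_Integration.integral_cong) (simp_all add: mult_ac)
      also have "\<dots> = (g' x * (\<Prod>j\<in>UNIV - {i}. u j (x $ j))) * - v (x $ i)"
        unfolding Bochner_Integration.integral_mult_right_zero v(3) ..
      finally show ?thesis by (simp add: tensor_upd mult_ac)
    qed
    have "(\<integral>x. H x * tensor u x \<partial>lborel) = (\<integral>x. (\<integral>s. indicator {0..1} s * ?L x s \<partial>lborel) \<partial>lborel)"
      unfolding H_def Bochner_Integration.integral_mult_left_zero[symmetric]
      by (intro Bochner_Integration.integral_cong) (simp_all add: mult_ac)
    also have "\<dots> = (\<integral>s. (\<integral>x. indicator {0..1} s * ?L x s \<partial>lborel) \<partial>lborel)"
      by (rule lborel_pair.Fubini_integral[OF iL, symmetric])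
    also have "\<dots> = (\<integral>s. (\<integral>x. indicator {0..1} s * ?K x s \<partial>lborel) \<partial>lborel)"
    proof (rule Bochner_Integration.integral_cong[OF refl])
      fix s show "(\<integral>x. indicator {0..1} s * ?L x s \<partial>lborel) = (\<integral>x. indicator {0..1} s * ?K x s \<partial>lborel)"
        using integral_lborel_translate[of "\<lambda>x. indicator {0..1} s * ?K x s" "(s * t) *\<^sub>R e"] by simp
    qed
    also have "\<dots> = (\<integral>x. (\<integral>s. indicator {0..1} s * ?K x s \<partial>lborel) \<partial>lborel)"
      by (rule lborel_pair.Fubini_integral[OF iK])
    also have "\<dots> = - (\<integral>x. g' x * tensor (u(i := v)) x \<partial>lborel)" unfolding tu by simp
    also have "\<dots> = (\<integral>x. g x * tensor ((u(i := v))(i := deriv v)) x \<partial>lborel)"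
      using weak_partialD[OF w uv] unfolding fun_upd_same by (rule sym)
    also have "\<dots> = (\<integral>x. g x * tensor u (x - t *\<^sub>R e) - g x * tensor u x \<partial>lborel)"
    proof (intro Bochner_Integration.integral_cong refl)
      fix x
      have "tensor u x = tensor (u(i := u i)) x" by simp
      then show "g x * tensor ((u(i := v))(i := deriv v)) x = g x * tensor u (x - t *\<^sub>R e) - g x * tensor u x"
        unfolding e_def tensor_translate fun_upd_upd tensor_upd v(2) by (simp add: algebra_simps)
    qed
    also have "\<dots> = (\<integral>x. g x * tensor u (x - t *\<^sub>R e) \<partial>lborel) - (\<integral>x. g x * tensor u x \<partial>lborel)"
    proof (rule Bochner_Integration.integral_diff)
      have "(\<lambda>r. u i (1 * r + - t)) \<in> bumps" using u by (intro bumps_affine) auto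
      then have "\<forall>j. (u(i := (\<lambda>r. u i (r - t)))) j \<in> bumps" using u by auto
      from integrable_locally_integrable_tensor[OF g this]
      show "integrable lborel (\<lambda>x. g x * tensor u (x - t *\<^sub>R e))" unfolding e_def tensor_translate .
    qed (rule integrable_locally_integrable_tensor[OF g u])
    also have "(\<integral>x. g x * tensor u (x - t *\<^sub>R e) \<partial>lborel) = (\<integral>x. g (x + t *\<^sub>R e) * tensor u x \<partial>lborel)"
      using integral_lborel_translate[of "\<lambda>x. g x * tensor u (x - t *\<^sub>R e)" "t *\<^sub>R e"] by simp
    also have "\<dots> - (\<integral>x. g x * tensor u x \<partial>lborel) = (\<integral>x. (g (x + t *\<^sub>R e) - g x) * tensor u x \<partial>lborel)"
      using integrable_locally_integrable_tensor[OF locally_integrable_translate[OF g] u] integrable_locally_integrable_tensor[OF g u]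
      by (simp add: left_diff_distrib)
    finally show "(\<integral>x. (g (x + t *\<^sub>R e) - g x) * tensor u x \<partial>lborel) = (\<integral>x. H x * tensor u x \<partial>lborel)" ..
  qed
  then show ?thesis by (simp add: H_def e_def)
qed

section \<open>Iterated differences\<close>

text \<open>The forward difference with the opposite sign, \<open>g(x) - g(x + h)\<close>. With this sign, the \<open>n\<close>-th
  iterate is \<open>g\<close> minus a combination of proper translates of \<open>g\<close>.\<close>
definition step_diff :: "'a::real_vector \<Rightarrow> ('a \<Rightarrow> real) \<Rightarrow> 'a \<Rightarrow> real" where
  "step_diff h g x = g x - g (x + h)"

lemma step_diff_funpow_expand:
  "\<exists>c. c 0 = 1 \<and> (\<forall>g (h :: 'a::real_vector) x. (step_diff h ^^ n) g x = (\<Sum>j\<le>n. c j * g (x + real j *\<^sub>R h)))"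
proof (induction n)
  case 0
  show ?case by (intro exI[of _ "\<lambda>_. 1"]) auto
next
  case (Suc n)
  then obtain c where c: "c 0 = (1::real)"
    "\<And>g (h :: 'a) x. (step_diff h ^^ n) g x = (\<Sum>j\<le>n. c j * g (x + real j *\<^sub>R h))" by blast
  let ?c = "\<lambda>j. (if j \<le> n then c j else 0) - (case j of 0 \<Rightarrow> 0 | Suc i \<Rightarrow> c i)"
  have "(step_diff h ^^ Suc n) g x = (\<Sum>j\<le>Suc n. ?c j * g (x + real j *\<^sub>R h))" for g and h x :: 'a
  proof -
    have "(\<Sum>j\<le>Suc n. ?c j * g (x + real j *\<^sub>R h)) =
      (\<Sum>j\<le>Suc n. (if j \<le> n then c j else 0) * g (x + real j *\<^sub>R h))
      - (\<Sum>j\<le>Suc n. (case j of 0 \<Rightarrow> 0 | Suc i \<Rightarrow> c i) * g (x + real j *\<^sub>R h))"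
      by (simp add: left_diff_distrib sum_subtractf)
    also have "(\<Sum>j\<le>Suc n. (if j \<le> n then c j else 0) * g (x + real j *\<^sub>R h)) = (\<Sum>j\<le>n. c j * g (x + real j *\<^sub>R h))"
      by (subst sum.atMost_Suc) (auto intro!: sum.cong)
    also have "(\<Sum>j\<le>Suc n. (case j of 0 \<Rightarrow> 0 | Suc i \<Rightarrow> c i) * g (x + real j *\<^sub>R h))
        = (\<Sum>j\<le>n. c j * g (x + h + real j *\<^sub>R h))"
      unfolding sum.atMost_Suc_shift by (simp add: algebra_simps)
    finally show ?thesis by (simp add: step_diff_def c(2))
  qed
  then show ?case using c(1) by (intro exI[of _ ?c]) auto
qed

text \<open>A family indexed by multi-indices in which, up to order \<open>n\<close>, raising the \<open>i\<close>-th entry by one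
  is weak differentiation in direction \<open>i\<close>.\<close>
definition deriv_family :: "nat \<Rightarrow> (('d::finite \<Rightarrow> nat) \<Rightarrow> real^'d \<Rightarrow> real) \<Rightarrow> bool" where
  "deriv_family n w \<longleftrightarrow> (\<forall>\<beta> i. mi_order \<beta> < n \<longrightarrow> weak_partial i (w \<beta>) (w (\<beta>(i := Suc (\<beta> i)))))"

lemma tensor_translate_family:
  fixes u :: "'d::finite \<Rightarrow> real \<Rightarrow> real"
  shows "tensor u (x - h) = tensor (\<lambda>j r. u j (r - h $ j)) x"
  by (simp add: tensor_def)

lemma weak_partial_step_diff:
  fixes g :: "real^'d::finite \<Rightarrow> real"
  assumes w: "weak_partial i g g'"
  shows "weak_partial i (step_diff h g) (step_diff h g')"
proof -
  have g: "locally_integrable g" and g': "locally_integrable g'" using w by (auto simp: weak_partial_def)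
  note [measurable] = locally_integrable_measurable[OF g] locally_integrable_measurable[OF g']
  show ?thesis
    unfolding weak_partial_def step_diff_def
  proof (intro conjI allI impI)
    show "locally_integrable (\<lambda>x. g x - g (x + h))" "locally_integrable (\<lambda>x. g' x - g' (x + h))"
      by (intro locally_integrable_diff locally_integrable_translate g g')+
    fix u :: "'d \<Rightarrow> real \<Rightarrow> real" assume u: "\<forall>j. u j \<in> bumps"
    let ?u = "\<lambda>j r. u j (r - h $ j)"
    have u': "\<forall>j. ?u j \<in> bumps" using bumps_affine[of _ 1] u by (metis (no_types, lifting) diff_conv_add_uminus ext mult_1 one_neq_zero)
    have du: "\<forall>j. (u(i := deriv (u i))) j \<in> bumps" by (rule tensor_upd_deriv_bumps[OF u])
    have T: "(\<integral>x. f (x + h) * tensor v x \<partial>lborel) = (\<integral>x. f x * tensor (\<lambda>j r. v j (r - h $ j)) x \<partial>lborel)"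
      if "\<forall>j. v j \<in> bumps" and [measurable]: "f \<in> borel_measurable borel" for v f
    proof -
      note [measurable] = tensor_measurable[OF that(1)]
      have "(\<lambda>x. f x * tensor v (x - h)) \<in> borel_measurable borel" by measurable
      from integral_lborel_translate[OF this, of h] show ?thesis by (simp add: tensor_translate_family)
    qed
    have eq: "(\<lambda>j r. (u(i := deriv (u i))) j (r - h $ j)) = ?u(i := deriv (?u i))"
      using deriv_affine[of "u i" 1 "- h $ i"] u by (auto simp: fun_eq_iff)
    have 1: "(\<integral>x. g (x + h) * tensor (u(i := deriv (u i))) x \<partial>lborel) = - (\<integral>x. g' (x + h) * tensor u x \<partial>lborel)"
      unfolding T[OF du locally_integrable_measurable[OF g]] T[OF u locally_integrable_measurable[OF g']] eq
      by (rule weak_partialD[OF w u'])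
    have 2: "(\<integral>x. g x * tensor (u(i := deriv (u i))) x \<partial>lborel) = - (\<integral>x. g' x * tensor u x \<partial>lborel)"
      by (rule weak_partialD[OF w u])
    note int = integrable_locally_integrable_tensor[OF g du] integrable_locally_integrable_tensor[OF g' u]
      integrable_locally_integrable_tensor[OF locally_integrable_translate[OF g] du]
      integrable_locally_integrable_tensor[OF locally_integrable_translate[OF g'] u]
    show "(\<integral>x. (g x - g (x + h)) * tensor (u(i := deriv (u i))) x \<partial>lborel) = - (\<integral>x. (g' x - g' (x + h)) * tensor u x \<partial>lborel)"
      unfolding left_diff_distrib using int 1 2 by (simp del: fun_upd_apply)
  qed
qed

lemma deriv_family_step_diff: "deriv_family n w \<Longrightarrow> deriv_family n (\<lambda>\<beta>. step_diff h (w \<beta>))"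
  by (auto simp: deriv_family_def intro: weak_partial_step_diff)

lemma deriv_family_mono: "deriv_family n w \<Longrightarrow> m \<le> n \<Longrightarrow> deriv_family m w"
  by (auto simp: deriv_family_def)

context young
begin

lemma lux_increment:
  fixes g :: "real^'d::finite \<Rightarrow> real"
  assumes w: "weak_partial i g g'" and l: "lux c g'" and t: "\<bar>t\<bar> \<le> r" "0 < r"
  shows "lux (r * c) (\<lambda>x. g (x + t *\<^sub>R axis i 1) - g x)"
proof -
  have g: "locally_integrable g" and g': "locally_integrable g'" using w by (auto simp: weak_partial_def)
  note [measurable] = locally_integrable_measurable[OF g] locally_integrable_measurable[OF g']
  let ?M = "density lborel (\<lambda>s. ennreal (indicator {0..1::real} s))"
  have M: "prob_space ?M" by (rule prob_spaceI) (simp add: emeasure_density ennreal_indicator)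
  let ?F = "\<lambda>x s. t * g' (x + (s * t) *\<^sub>R axis i 1)"
  have "lux (r * c) (\<lambda>x. \<integral>s. ?F x s \<partial>?M)"
  proof (rule lux_average[OF M])
    show "lux (r * c) (\<lambda>x. ?F x s)" for s by (intro lux_cmult lux_translate l t)
  qed measurable
  moreover have "(\<integral>s. ?F x s \<partial>?M) = (\<integral>s. indicator {0..1} s * ?F x s \<partial>lborel)" for x
    by (subst integral_real_density) auto
  ultimately have "lux (r * c) (\<lambda>x. \<integral>s. indicator {0..1} s * ?F x s \<partial>lborel)" by simp
  then show ?thesis
    by (rule lux_AE_cong) (use weak_partial_increment[OF w, of t] in auto)
qed

text \<open>The displacement \<open>h\<close> is traversed one coordinate at a time; each of the \<open>d\<close> increments costs \<open>r c\<close>.\<close>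
lemma lux_step_diff:
  fixes g :: "real^'d::finite \<Rightarrow> real"
  assumes w: "\<And>i. weak_partial i g (g' i)" and l: "\<And>i. lux c (g' i)" and h: "\<And>i. \<bar>h $ i\<bar> \<le> r" "0 < r"
  shows "lux (real CARD('d) * r * c) (step_diff h g)"
proof -
  have "lux (real (card I) * r * c) (\<lambda>x. g (x + (\<Sum>i\<in>I. h $ i *\<^sub>R axis i 1)) - g x)" if "finite I" "I \<noteq> {}" for I :: "'d set"
    using that
  proof (induction rule: finite_ne_induct)
    case (singleton i)
    then show ?case using lux_increment[OF w l h] by simp
  next
    case (insert i I)
    let ?s = "\<Sum>i\<in>I. h $ i *\<^sub>R axis i 1"
    have "lux (r * c) (\<lambda>x. g (x + ?s + h $ i *\<^sub>R axis i 1) - g (x + ?s))"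
      using lux_translate[OF lux_increment[OF w l h], of ?s] .
    from lux_add[OF this insert.IH] show ?case using insert by (simp add: algebra_simps)
  qed
  from this[of UNIV] have "lux (real CARD('d) * r * c) (\<lambda>x. g (x + (\<Sum>i\<in>UNIV. h $ i *\<^sub>R axis i 1)) - g x)" by simp
  moreover have "(\<Sum>i\<in>UNIV. h $ i *\<^sub>R axis i 1) = h"
    using basis_expansion[of h] by (simp add: scalar_mult_eq_scaleR)
  ultimately have "lux (real CARD('d) * r * c) (\<lambda>x. g (x + h) - g x)" by simp
  from lux_uminus[OF this] show ?thesis by (simp add: step_diff_def[abs_def])
qed

text \<open>An \<open>n\<close>-fold difference of step size \<open>r\<close> gains the factor \<open>r\<^sup>n\<close>. The induction replaces the family \<open>w\<close> by
  its family of first differences, which loses one order of differentiability.\<close>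
lemma lux_step_diff_funpow:
  fixes w :: "('d::finite \<Rightarrow> nat) \<Rightarrow> real^'d \<Rightarrow> real"
  assumes "deriv_family (q + n) w" "\<And>\<beta>. mi_order \<beta> \<le> q + n \<Longrightarrow> lux c (w \<beta>)"
    and h: "\<And>i. \<bar>h $ i\<bar> \<le> r" "0 < r" and "mi_order \<beta> \<le> q"
  shows "lux ((real CARD('d) * r) ^ n * c) ((step_diff h ^^ n) (w \<beta>))"
  using assms(1,2)
proof (induction n arbitrary: w c)
  case 0 then show ?case using assms(5) by simp
next
  case (Suc n)
  let ?w = "\<lambda>\<beta>. step_diff h (w \<beta>)"
  have "lux ((real CARD('d) * r) ^ n * (real CARD('d) * r * c)) ((step_diff h ^^ n) (?w \<beta>))"
  proof (rule Suc.IH)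
    show "deriv_family (q + n) ?w"
      using Suc.prems(1) by (intro deriv_family_step_diff) (auto intro: deriv_family_mono)
    show "lux (real CARD('d) * r * c) (?w \<beta>)" if "mi_order \<beta> \<le> q + n" for \<beta>
    proof (rule lux_step_diff[OF _ _ h])
      show "weak_partial i (w \<beta>) (w (\<beta>(i := Suc (\<beta> i))))" for i
        using Suc.prems(1) that by (auto simp: deriv_family_def)
      show "lux c (w (\<beta>(i := Suc (\<beta> i))))" for i
        by (rule Suc.prems(2)) (use that in \<open>simp add: mi_order_upd_Suc del: fun_upd_apply\<close>)
    qed
  qed
  then show ?case by (simp add: funpow_Suc_right mult_ac del: funpow.simps)
qed

end

section \<open>The Jordan decomposition of a finite signed measure\<close>

lemma finite_signed_measure_Un:
  assumes \<nu>: "finite_signed_measure \<nu>" and "A \<in> sets borel" "B \<in> sets borel" "A \<inter> B = {}"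
  shows "\<nu> (A \<union> B) = \<nu> A + \<nu> B"
proof -
  let ?F = "\<lambda>i::nat. if i = 0 then A else if i = 1 then B else {}"
  have "(\<Union>i. ?F i) = A \<union> B" by (auto split: if_splits)
  moreover have "range ?F \<subseteq> sets borel" using assms by auto
  moreover have "disjoint_family ?F" using assms by (auto simp: disjoint_family_on_def)
  ultimately have "(\<lambda>i. \<nu> (?F i)) sums \<nu> (A \<union> B)"
    using \<nu> unfolding finite_signed_measure_def by metis
  moreover have "(\<lambda>i. \<nu> (?F i)) sums (\<Sum>i\<in>{0,1}. \<nu> (?F i))"
    using \<nu> by (intro sums_finite) (auto simp: finite_signed_measure_def)
  ultimately show ?thesis using sums_unique2 by fastforce
qed

lemma finite_signed_measure_Diff:
  assumes "finite_signed_measure \<nu>" "A \<in> sets borel" "B \<in> sets borel" "B \<subseteq> A"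
  shows "\<nu> (A - B) = \<nu> A - \<nu> B"
proof -
  have "\<nu> ((A - B) \<union> B) = \<nu> (A - B) + \<nu> B"
    by (rule finite_signed_measure_Un[OF assms(1)]) (use assms in auto)
  moreover have "(A - B) \<union> B = A" using assms by auto
  ultimately show ?thesis by simp
qed

lemma finite_signed_measure_uminus: "finite_signed_measure \<nu> \<Longrightarrow> finite_signed_measure (\<lambda>A. - \<nu> A)"
  by (auto simp: finite_signed_measure_def intro: sums_minus)

text \<open>A set on which \<open>\<nu>\<close> is unbounded can be split into a part of mass at least \<open>1\<close> in absolute value
  and a part on which \<open>\<nu>\<close> is still unbounded. Repeating this produces disjoint sets whose masses do not
  tend to \<open>0\<close>, contrary to countable additivity.\<close>
lemma finite_signed_measure_bounded:
  assumes \<nu>: "finite_signed_measure \<nu>"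
  obtains M where "\<And>A. A \<in> sets borel \<Longrightarrow> \<bar>\<nu> A\<bar> \<le> M"
proof -
  define U where "U E \<longleftrightarrow> E \<in> sets borel \<and> (\<forall>M. \<exists>B\<in>sets borel. B \<subseteq> E \<and> M < \<bar>\<nu> B\<bar>)" for E
  have "\<not> U UNIV"
  proof
    assume UNIV: "U UNIV"
    have step: "\<exists>E'. U E' \<and> E' \<subseteq> E \<and> 1 \<le> \<bar>\<nu> (E - E')\<bar>" if E: "U E" for E
    proof -
      have mE: "E \<in> sets borel" using E by (simp add: U_def)
      obtain B where B: "B \<in> sets borel" "B \<subseteq> E" "1 + \<bar>\<nu> E\<bar> < \<bar>\<nu> B\<bar>" using E unfolding U_def by blast
      have d: "\<nu> (E - B) = \<nu> E - \<nu> B" by (rule finite_signed_measure_Diff[OF \<nu> mE B(1,2)])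
      have "U B \<or> U (E - B)"
      proof (rule ccontr)
        assume "\<not> (U B \<or> U (E - B))"
        then obtain M1 M2 where M: "\<And>C. C \<in> sets borel \<Longrightarrow> C \<subseteq> B \<Longrightarrow> \<bar>\<nu> C\<bar> \<le> M1"
          "\<And>C. C \<in> sets borel \<Longrightarrow> C \<subseteq> E - B \<Longrightarrow> \<bar>\<nu> C\<bar> \<le> M2"
          using mE B(1) unfolding U_def by (meson not_le sets.Diff)
        obtain C where C: "C \<in> sets borel" "C \<subseteq> E" "M1 + M2 < \<bar>\<nu> C\<bar>" using E unfolding U_def by blast
        have "\<nu> ((C \<inter> B) \<union> (C - B)) = \<nu> (C \<inter> B) + \<nu> (C - B)"
          by (rule finite_signed_measure_Un[OF \<nu>]) (use C B in auto)
        moreover have "(C \<inter> B) \<union> (C - B) = C" by auto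
        moreover have "\<bar>\<nu> (C \<inter> B)\<bar> \<le> M1" by (rule M(1)) (use C B in auto)
        moreover have "\<bar>\<nu> (C - B)\<bar> \<le> M2" by (rule M(2)) (use C B in auto)
        ultimately have "\<nu> C = \<nu> (C \<inter> B) + \<nu> (C - B)" "\<bar>\<nu> (C \<inter> B)\<bar> \<le> M1" "\<bar>\<nu> (C - B)\<bar> \<le> M2" by metis+
        then show False using C(3) abs_triangle_ineq[of "\<nu> (C \<inter> B)" "\<nu> (C - B)"] by linarith
      qed
      then show ?thesis
      proof
        assume "U B"
        then show ?thesis using B d by (intro exI[of _ B]) auto
      next
        assume "U (E - B)"
        moreover have "E - (E - B) = B" using B by auto
        ultimately show ?thesis using B by (intro exI[of _ "E - B"]) auto
      qed
    qed
    have "\<exists>F. \<forall>n::nat. U (F n) \<and> (F (Suc n) \<subseteq> F n \<and> 1 \<le> \<bar>\<nu> (F n - F (Suc n))\<bar>)"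
      by (rule dependent_nat_choice) (use UNIV step in auto)
    then obtain F :: "nat \<Rightarrow> 'a set" where F: "\<And>n. U (F n)" "\<And>n. F (Suc n) \<subseteq> F n"
      "\<And>n. 1 \<le> \<bar>\<nu> (F n - F (Suc n))\<bar>" by blast
    let ?D = "\<lambda>n. F n - F (Suc n)"
    have "decseq F" using F(2) by (rule decseq_SucI)
    then have sub: "F n \<subseteq> F (Suc m)" if "m < n" for m n using that decseqD[of F "Suc m" n] by simp
    have "?D m \<inter> ?D n = {}" if "m \<noteq> n" for m n
      using that sub[of m n] sub[of n m] by (cases "m < n") auto
    then have "disjoint_family ?D" by (simp add: disjoint_family_on_def)
    moreover have "range ?D \<subseteq> sets borel" using F(1) by (auto simp: U_def)
    ultimately have "(\<lambda>i. \<nu> (?D i)) sums \<nu> (\<Union>i. ?D i)" using \<nu> by (auto simp: finite_signed_measure_def)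
    then have "(\<lambda>i. \<nu> (?D i)) \<longlonglongrightarrow> 0" by (intro summable_LIMSEQ_zero sums_summable)
    then have "\<forall>\<^sub>F i in sequentially. \<bar>\<nu> (?D i)\<bar> < 1"
      by (drule_tac tendstoD[of _ _ _ 1]) (auto simp: dist_real_def)
    then show False using F(3) by (auto simp: eventually_sequentially not_less[symmetric])
  qed
  then obtain M where "\<And>A. A \<in> sets borel \<Longrightarrow> \<bar>\<nu> A\<bar> \<le> M" unfolding U_def by (force simp: not_less)
  then show thesis by (rule that)
qed

lemma ennreal_add_le: "ennreal (a + b) \<le> ennreal a + ennreal b"
proof -
  have "ennreal (a + b) \<le> ennreal (max 0 a + max 0 b)" by (intro ennreal_leI) auto
  then show ?thesis by (simp add: max_def split: if_splits) (auto simp: ennreal_neg)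
qed

lemma ennreal_sum_le: "ennreal (sum f A) \<le> (\<Sum>i\<in>A. ennreal (f i))"
  by (induction A rule: infinite_finite_induct) (auto intro: order_trans[OF ennreal_add_le] add_left_mono)

text \<open>The supremum in the definition of the positive variation is countably additive, so that the
  defining formula describes its values.\<close>
lemma
  fixes \<nu> :: "'a::topological_space set \<Rightarrow> real"
  assumes \<nu>: "finite_signed_measure \<nu>"
  shows sets_pos_variation: "sets (pos_variation \<nu>) = sets borel"
    and emeasure_pos_variation: "A \<in> sets borel \<Longrightarrow>
      emeasure (pos_variation \<nu>) A = (SUP B\<in>{B\<in>sets borel. B \<subseteq> A}. ennreal (\<nu> B))"
    and finite_measure_pos_variation: "finite_measure (pos_variation \<nu>)"
proof -
  let ?p = "\<lambda>A. SUP B\<in>{B\<in>sets borel. B \<subseteq> A}. ennreal (\<nu> B)"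
  have sa: "sigma_algebra UNIV (sets (borel :: 'a measure))"
    using sets.sigma_algebra_axioms[of borel] by simp
  show s: "sets (pos_variation \<nu>) = sets borel"
    unfolding pos_variation_def using sigma_algebra.sigma_sets_eq[OF sa] by simp
  have mono: "?p A \<le> ?p B" if "A \<subseteq> B" for A B by (rule SUP_subset_mono) (use that in auto)
  have upper: "ennreal (\<nu> B) \<le> ?p A" if "B \<in> sets borel" "B \<subseteq> A" for A B
    using that by (intro SUP_upper) auto
  have super: "?p A + ?p B \<le> ?p (A \<union> B)" if AB: "A \<inter> B = {}" for A B
  proof -
    have "ennreal (\<nu> C) + ennreal (\<nu> D) \<le> ?p (A \<union> B)" if C: "C \<in> sets borel" "C \<subseteq> A" and D: "D \<in> sets borel" "D \<subseteq> B" for C D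
    proof (cases "\<nu> C \<ge> 0 \<and> \<nu> D \<ge> 0")
      case True
      have "\<nu> (C \<union> D) = \<nu> C + \<nu> D" by (rule finite_signed_measure_Un[OF \<nu>]) (use C D AB in auto)
      then have "ennreal (\<nu> C) + ennreal (\<nu> D) = ennreal (\<nu> (C \<union> D))" using True by simp
      also have "\<dots> \<le> ?p (A \<union> B)" by (rule upper) (use C D in auto)
      finally show ?thesis .
    next
      case False
      have "ennreal (\<nu> C) \<le> ?p (A \<union> B)" "ennreal (\<nu> D) \<le> ?p (A \<union> B)" by (rule upper; use C D in auto)+
      then show ?thesis using False by (auto simp: ennreal_neg not_le)
    qed
    note le = this
    have ne: "{B \<in> sets borel. B \<subseteq> E} \<noteq> {}" for E :: "'a set" using sets.empty_sets by blast
    have "ennreal (\<nu> C) + ?p B \<le> ?p (A \<union> B)" if C: "C \<in> sets borel" "C \<subseteq> A" for C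
      unfolding ennreal_SUP_add_right[OF ne] by (rule SUP_least) (use le[OF C] in blast)
    then show ?thesis
      unfolding ennreal_SUP_add_left[OF ne, symmetric] by (intro SUP_least) blast
  qed
  have ca: "countably_additive (sets borel) ?p"
    unfolding countably_additive_def
  proof (intro allI impI antisym)
    fix F :: "nat \<Rightarrow> 'a set" assume F: "range F \<subseteq> sets borel" "disjoint_family F" "(\<Union>i. F i) \<in> sets borel"
    show "(\<Sum>i. ?p (F i)) \<le> ?p (\<Union>i. F i)"
    proof (rule suminf_le_const)
      fix n
      have "(\<Sum>i<n. ?p (F i)) \<le> ?p (\<Union>i<n. F i)"
      proof (induction n)
        case (Suc n)
        have "F i \<inter> F n = {}" if "i < n" for i using F(2) that by (intro disjoint_family_onD) auto
        then have d: "(\<Union>i<n. F i) \<inter> F n = {}" by blast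
        have "(\<Sum>i<Suc n. ?p (F i)) \<le> ?p (\<Union>i<n. F i) + ?p (F n)"
          unfolding sum.lessThan_Suc by (rule add_right_mono[OF Suc])
        also have "\<dots> \<le> ?p ((\<Union>i<n. F i) \<union> F n)" by (rule super[OF d])
        also have "(\<Union>i<n. F i) \<union> F n = (\<Union>i<Suc n. F i)" unfolding lessThan_Suc by blast
        finally show ?case .
      qed simp
      also have "\<dots> \<le> ?p (\<Union>i. F i)" by (rule mono) auto
      finally show "(\<Sum>i<n. ?p (F i)) \<le> ?p (\<Union>i. F i)" .
    qed simp
    show "?p (\<Union>i. F i) \<le> (\<Sum>i. ?p (F i))"
    proof (rule SUP_least)
      fix B assume "B \<in> {B \<in> sets borel. B \<subseteq> (\<Union>i. F i)}"
      then have B: "B \<in> sets borel" "B \<subseteq> (\<Union>i. F i)" by auto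
      have "(\<Union>i. B \<inter> F i) = B" using B by auto
      moreover have "range (\<lambda>i. B \<inter> F i) \<subseteq> sets borel" using B F by auto
      moreover have "disjoint_family (\<lambda>i. B \<inter> F i)" using F(2) by (auto simp: disjoint_family_on_def)
      ultimately have "(\<lambda>i. \<nu> (B \<inter> F i)) sums \<nu> B"
        using \<nu> unfolding finite_signed_measure_def by metis
      then have lim: "(\<lambda>n. ennreal (\<Sum>i<n. \<nu> (B \<inter> F i))) \<longlonglongrightarrow> ennreal (\<nu> B)"
        unfolding sums_def by (rule tendsto_ennrealI)
      have le: "ennreal (\<Sum>i<n. \<nu> (B \<inter> F i)) \<le> (\<Sum>i. ?p (F i))" for n
      proof -
        have "ennreal (\<Sum>i<n. \<nu> (B \<inter> F i)) \<le> (\<Sum>i<n. ennreal (\<nu> (B \<inter> F i)))" by (rule ennreal_sum_le)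
        also have "\<dots> \<le> (\<Sum>i<n. ?p (F i))" using B F by (intro sum_mono upper) auto
        also have "\<dots> \<le> (\<Sum>i. ?p (F i))" by (rule sum_le_suminf) auto
        finally show ?thesis .
      qed
      show "ennreal (\<nu> B) \<le> (\<Sum>i. ?p (F i))" by (rule LIMSEQ_le_const2[OF lim]) (intro exI allI impI le)
    qed
  qed
  have "?p {} = 0"
  proof -
    have "{B \<in> sets borel. B \<subseteq> {}} = {{} :: 'a set}" by auto
    then show ?thesis using \<nu> by (simp add: finite_signed_measure_def)
  qed
  then have pos: "positive (sets borel) ?p" by (simp add: positive_def)
  show e: "emeasure (pos_variation \<nu>) A = ?p A" if "A \<in> sets borel" for A
    unfolding pos_variation_def by (rule emeasure_measure_of_sigma[OF sa pos ca that])
  show "finite_measure (pos_variation \<nu>)"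
  proof (rule finite_measureI)
    obtain M where M: "\<And>A. A \<in> sets borel \<Longrightarrow> \<bar>\<nu> A\<bar> \<le> M" using finite_signed_measure_bounded[OF \<nu>] by blast
    have "?p UNIV \<le> ennreal M"
    proof (rule SUP_least)
      fix B :: "'a set" assume "B \<in> {B \<in> sets borel. B \<subseteq> UNIV}"
      then show "ennreal (\<nu> B) \<le> ennreal M" using M[of B] by (intro ennreal_leI) auto
    qed
    then have lt: "?p UNIV < \<infinity>" by (rule le_less_trans) simp
    have sp: "space (pos_variation \<nu>) = UNIV" using sets_eq_imp_space_eq[OF s] by simp
    have eU: "emeasure (pos_variation \<nu>) UNIV = ?p UNIV" by (rule e) simp
    show "emeasure (pos_variation \<nu>) (space (pos_variation \<nu>)) \<noteq> \<infinity>"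
      unfolding sp eU using lt by (rule less_imp_neq)
  qed
qed

lemma
  fixes \<nu> :: "'a::topological_space set \<Rightarrow> real"
  assumes \<nu>: "finite_signed_measure \<nu>"
  shows sets_neg_variation: "sets (neg_variation \<nu>) = sets borel"
    and finite_measure_neg_variation: "finite_measure (neg_variation \<nu>)"
  unfolding neg_variation_def
  using finite_signed_measure_uminus[OF \<nu>] by (rule sets_pos_variation finite_measure_pos_variation)+

lemma jordan_decomposition:
  fixes \<nu> :: "'a::topological_space set \<Rightarrow> real"
  assumes \<nu>: "finite_signed_measure \<nu>" and A: "A \<in> sets borel"
  shows "measure (pos_variation \<nu>) A - measure (neg_variation \<nu>) A = \<nu> A"
proof -
  have *: "measure (pos_variation \<nu>) A \<le> \<nu> A + measure (neg_variation \<nu>) A" if \<nu>: "finite_signed_measure \<nu>" for \<nu>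
  proof -
    interpret P: finite_measure "pos_variation \<nu>" by (rule finite_measure_pos_variation[OF \<nu>])
    interpret N: finite_measure "neg_variation \<nu>" by (rule finite_measure_neg_variation[OF \<nu>])
    have B: "\<nu> B \<le> \<nu> A + measure (neg_variation \<nu>) A" if "B \<in> sets borel" "B \<subseteq> A" for B
    proof -
      have "ennreal (- \<nu> (A - B)) \<le> emeasure (neg_variation \<nu>) A"
        unfolding neg_variation_def emeasure_pos_variation[OF finite_signed_measure_uminus[OF \<nu>] A]
        using A that by (intro SUP_upper) auto
      then have "- \<nu> (A - B) \<le> measure (neg_variation \<nu>) A"
        unfolding N.emeasure_eq_measure by (simp add: ennreal_le_iff)
      then show ?thesis using finite_signed_measure_Diff[OF \<nu> A that] by simp
    qed
    have "\<nu> {} = 0" using \<nu> by (simp add: finite_signed_measure_def)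
    then have nn: "0 \<le> \<nu> A + measure (neg_variation \<nu>) A" using B[of "{}"] by simp
    have "emeasure (pos_variation \<nu>) A \<le> ennreal (\<nu> A + measure (neg_variation \<nu>) A)"
      unfolding emeasure_pos_variation[OF \<nu> A] by (intro SUP_least ennreal_leI B) auto
    then show ?thesis unfolding P.emeasure_eq_measure using nn by (simp add: ennreal_le_iff)
  qed
  have "neg_variation (\<lambda>A. - \<nu> A) = pos_variation \<nu>" by (simp add: neg_variation_def)
  then have "measure (neg_variation \<nu>) A \<le> - \<nu> A + measure (pos_variation \<nu>) A"
    using *[OF finite_signed_measure_uminus[OF \<nu>]] by (simp add: neg_variation_def)
  then show ?thesis using *[OF \<nu>] by simp
qed

section \<open>Signed measures with densities\<close>

text \<open>The positive variation of \<open>f(x) dx\<close> is \<open>f\<^sup>+(x) dx\<close>: the supremum over the subsets of \<open>A\<close> is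
  attained at \<open>A \<inter> {f > 0}\<close>.\<close>
lemma pos_variation_density_sm:
  fixes f :: "real^'d::finite \<Rightarrow> real"
  assumes f: "integrable lborel f"
  shows "pos_variation (density_sm f) = density lborel (\<lambda>x. ennreal (f x))"
proof -
  let ?D = "density lborel (\<lambda>x. ennreal (f x))"
  have [measurable]: "f \<in> borel_measurable borel" using f by auto
  have sup: "(SUP B\<in>{B\<in>sets borel. B \<subseteq> A}. ennreal (density_sm f B)) = emeasure ?D A" if A: "A \<in> sets borel" for A
  proof (rule antisym)
    have int: "integrable lborel (\<lambda>x. indicator B x * f x)" if "B \<in> sets borel" for B
      using integrable_mult_indicator[of B lborel f] that f by simp
    show "(SUP B\<in>{B\<in>sets borel. B \<subseteq> A}. ennreal (density_sm f B)) \<le> emeasure ?D A"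
    proof (rule SUP_least)
      fix B assume "B \<in> {B\<in>sets borel. B \<subseteq> A}"
      then have B: "B \<in> sets borel" "B \<subseteq> A" by auto
      have "ennreal (density_sm f B) \<le> ennreal (\<integral>x. max 0 (indicator B x * f x) \<partial>lborel)"
        unfolding density_sm_def set_lebesgue_integral_def using int[OF B(1)]
        by (intro ennreal_leI Bochner_Integration.integral_mono) auto
      also have "\<dots> = (\<integral>\<^sup>+x. ennreal (max 0 (indicator B x * f x)) \<partial>lborel)"
        using int[OF B(1)] by (intro nn_integral_eq_integral[symmetric]) auto
      also have "\<dots> \<le> (\<integral>\<^sup>+x. ennreal (f x) * indicator A x \<partial>lborel)"
        using B by (intro nn_integral_mono) (auto simp: indicator_def ennreal_neg max_def)
      also have "\<dots> = emeasure ?D A" using A by (simp add: emeasure_density)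
      finally show "ennreal (density_sm f B) \<le> emeasure ?D A" .
    qed
    let ?B = "A \<inter> {x. f x > 0}"
    have mB: "?B \<in> sets borel" using A by simp
    have "emeasure ?D A = (\<integral>\<^sup>+x. ennreal (indicator ?B x * f x) \<partial>lborel)"
      using A by (subst emeasure_density) (auto intro!: nn_integral_cong simp: indicator_def ennreal_neg)
    also have "\<dots> = ennreal (density_sm f ?B)"
      unfolding density_sm_def set_lebesgue_integral_def using int[OF mB]
      by (subst nn_integral_eq_integral) (auto intro!: AE_I2 simp: indicator_def)
    also have "\<dots> \<le> (SUP B\<in>{B\<in>sets borel. B \<subseteq> A}. ennreal (density_sm f B))"
      using mB by (intro SUP_upper) auto
    finally show "emeasure ?D A \<le> (SUP B\<in>{B\<in>sets borel. B \<subseteq> A}. ennreal (density_sm f B))" .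
  qed
  have "measure_of UNIV (sets borel) (\<lambda>A. SUP B\<in>{B\<in>sets borel. B \<subseteq> A}. ennreal (density_sm f B))
    = measure_of UNIV (sets borel) (emeasure ?D)"
  proof (rule measure_of_eq)
    fix A :: "(real^'d) set" assume "A \<in> sigma_sets UNIV (sets borel)"
    then have "A \<in> sets borel" using sets.sigma_sets_eq[of "borel :: (real^'d) measure"] by simp
    then show "(SUP B\<in>{B\<in>sets borel. B \<subseteq> A}. ennreal (density_sm f B)) = emeasure ?D A" by (rule sup)
  qed auto
  also have "\<dots> = ?D" using measure_of_of_measure[of ?D] by simp
  finally show ?thesis unfolding pos_variation_def .
qed

lemma integral_density_pos_part:
  fixes f :: "real^'d::finite \<Rightarrow> real"
  assumes f: "integrable lborel f" and [measurable]: "\<phi> \<in> borel_measurable borel"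
  shows "(\<integral>x. \<phi> x \<partial>density lborel (\<lambda>x. ennreal (f x))) = (\<integral>x. max 0 (f x) * \<phi> x \<partial>lborel)"
proof -
  have [measurable]: "f \<in> borel_measurable borel" using f by auto
  have "density lborel (\<lambda>x. ennreal (f x)) = density lborel (\<lambda>x. ennreal (max 0 (f x)))"
    by (intro density_cong) (auto simp: max_def ennreal_neg)
  then show ?thesis by (simp only:) (subst integral_real_density, auto)
qed

lemma signed_integral_density_sm:
  fixes f :: "real^'d::finite \<Rightarrow> real"
  assumes f: "integrable lborel f" and [measurable]: "\<phi> \<in> borel_measurable borel" and "\<And>x. \<bar>\<phi> x\<bar> \<le> M"
  shows "signed_integral (density_sm f) \<phi> = (\<integral>x. f x * \<phi> x \<partial>lborel)"
proof -
  have [measurable]: "f \<in> borel_measurable borel" using f by auto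
  have m: "(\<lambda>A. - density_sm f A) = density_sm (\<lambda>x. - f x)"
    by (auto simp: density_sm_def set_lebesgue_integral_def fun_eq_iff)
  have int: "integrable lborel (\<lambda>x. max 0 (g x) * \<phi> x)" if g: "integrable lborel g" for g
  proof (rule Bochner_Integration.integrable_bound)
    show "integrable lborel (\<lambda>x. M * g x)" using g by simp
    have [measurable]: "g \<in> borel_measurable borel" using g by auto
    show "(\<lambda>x. max 0 (g x) * \<phi> x) \<in> borel_measurable lborel" by simp
    show "AE x in lborel. norm (max 0 (g x) * \<phi> x) \<le> norm (M * g x)"
    proof (rule AE_I2)
      fix x
      have "\<bar>max 0 (g x)\<bar> * \<bar>\<phi> x\<bar> \<le> \<bar>g x\<bar> * \<bar>M\<bar>" using assms(3)[of x] by (intro mult_mono) auto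
      then show "norm (max 0 (g x) * \<phi> x) \<le> norm (M * g x)" by (simp add: abs_mult mult.commute)
    qed
  qed
  have "signed_integral (density_sm f) \<phi> = (\<integral>x. max 0 (f x) * \<phi> x \<partial>lborel) - (\<integral>x. max 0 (- f x) * \<phi> x \<partial>lborel)"
    unfolding signed_integral_def neg_variation_def m using f
    by (simp add: pos_variation_density_sm integral_density_pos_part)
  also have "\<dots> = (\<integral>x. max 0 (f x) * \<phi> x - max 0 (- f x) * \<phi> x \<partial>lborel)"
    using int[OF f] int[of "\<lambda>x. - f x"] f by simp
  also have "\<dots> = (\<integral>x. f x * \<phi> x \<partial>lborel)"
    by (intro Bochner_Integration.integral_cong) (auto simp: max_def)
  finally show ?thesis .
qed

text \<open>Testing against tensor products of bumps determines a density of \<open>\<mu>\<close>. Local integrability of \<open>g\<close>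
  suffices: global integrability is a consequence, since \<open>\<mu>\<close> is finite.\<close>
lemma has_densityI:
  fixes g :: "real^'d::finite \<Rightarrow> real"
  assumes \<mu>: "finite_signed_measure \<mu>" and g: "locally_integrable g"
    and eq: "\<And>u. \<forall>i. u i \<in> bumps \<Longrightarrow> signed_integral \<mu> (tensor u) = (\<integral>x. g x * tensor u x \<partial>lborel)"
  shows "has_density \<mu> g"
proof -
  note [measurable] = locally_integrable_measurable[OF g]
  interpret P: finite_measure "pos_variation \<mu>" by (rule finite_measure_pos_variation[OF \<mu>])
  interpret N: finite_measure "neg_variation \<mu>" by (rule finite_measure_neg_variation[OF \<mu>])
  have id: "emeasure (pos_variation \<mu>) A + (\<integral>\<^sup>+x. ennreal (- g x) * indicator A x \<partial>lborel) =
    emeasure (neg_variation \<mu>) A + (\<integral>\<^sup>+x. ennreal (g x) * indicator A x \<partial>lborel)" if "A \<in> sets borel" for A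
    by (rule density_identification[OF P.finite_measure_axioms sets_pos_variation[OF \<mu>]
          N.finite_measure_axioms sets_neg_variation[OF \<mu>] g _ that])
      (use eq in \<open>simp add: signed_integral_def\<close>)
  have p: "(\<integral>\<^sup>+x. ennreal (g x) \<partial>lborel) < \<infinity>"
  proof -
    let ?A = "{x. g x > 0}"
    have "(\<integral>\<^sup>+x. ennreal (g x) \<partial>lborel) = (\<integral>\<^sup>+x. ennreal (g x) * indicator ?A x \<partial>lborel)"
      by (intro nn_integral_cong) (auto simp: indicator_def ennreal_neg)
    also have "\<dots> \<le> emeasure (pos_variation \<mu>) ?A + (\<integral>\<^sup>+x. ennreal (- g x) * indicator ?A x \<partial>lborel)"
      by (subst id) auto
    also have "(\<integral>\<^sup>+x. ennreal (- g x) * indicator ?A x \<partial>lborel) = (\<integral>\<^sup>+x. 0 \<partial>(lborel :: (real^'d) measure))"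
      by (intro nn_integral_cong) (auto simp: indicator_def ennreal_neg)
    also have "emeasure (pos_variation \<mu>) ?A + \<dots> < \<infinity>" by (simp add: P.emeasure_eq_measure)
    finally show ?thesis .
  qed
  have n: "(\<integral>\<^sup>+x. ennreal (- g x) \<partial>lborel) < \<infinity>"
  proof -
    let ?A = "{x. g x < 0}"
    have "(\<integral>\<^sup>+x. ennreal (- g x) \<partial>lborel) = (\<integral>\<^sup>+x. ennreal (- g x) * indicator ?A x \<partial>lborel)"
      by (intro nn_integral_cong) (auto simp: indicator_def ennreal_neg)
    also have "\<dots> \<le> emeasure (neg_variation \<mu>) ?A + (\<integral>\<^sup>+x. ennreal (g x) * indicator ?A x \<partial>lborel)"
      by (subst id[symmetric]) auto
    also have "(\<integral>\<^sup>+x. ennreal (g x) * indicator ?A x \<partial>lborel) = (\<integral>\<^sup>+x. 0 \<partial>(lborel :: (real^'d) measure))"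
      by (intro nn_integral_cong) (auto simp: indicator_def ennreal_neg)
    also have "emeasure (neg_variation \<mu>) ?A + \<dots> < \<infinity>" by (simp add: N.emeasure_eq_measure)
    finally show ?thesis .
  qed
  have int: "integrable lborel g" using p n unfolding real_integrable_def by (auto simp: less_top[symmetric])
  show ?thesis
    unfolding has_density_def
  proof (intro conjI ballI int)
    fix A :: "(real^'d) set" assume A: "A \<in> sets borel"
    have iA: "integrable lborel (\<lambda>x. g x * indicator A x)"
      using integrable_mult_indicator[of A lborel g] A int by (simp add: mult.commute)
    obtain r q where rq: "0 \<le> r" "0 \<le> q"
        "(\<integral>\<^sup>+x. ennreal (g x * indicator A x) \<partial>lborel) = ennreal r"
        "(\<integral>\<^sup>+x. ennreal (- (g x * indicator A x)) \<partial>lborel) = ennreal q"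
        "(\<integral>x. g x * indicator A x \<partial>lborel) = r - q"
      by (rule integrableE[OF iA]) blast
    have "(\<integral>\<^sup>+x. ennreal (g x) * indicator A x \<partial>lborel) = ennreal r"
      unfolding rq(3)[symmetric] by (intro nn_integral_cong) (auto simp: indicator_def)
    moreover have "(\<integral>\<^sup>+x. ennreal (- g x) * indicator A x \<partial>lborel) = ennreal q"
      unfolding rq(4)[symmetric] by (intro nn_integral_cong) (auto simp: indicator_def)
    ultimately have "ennreal (measure (pos_variation \<mu>) A + q) = ennreal (measure (neg_variation \<mu>) A + r)"
      using id[OF A] rq(1,2) by (simp add: P.emeasure_eq_measure N.emeasure_eq_measure ennreal_plus)
    then have "measure (pos_variation \<mu>) A + q = measure (neg_variation \<mu>) A + r"
      using rq(1,2) by (subst (asm) ennreal_inj) auto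
    then have "\<mu> A = r - q" using jordan_decomposition[OF \<mu> A] by linarith
    then show "\<mu> A = density_sm g A"
      using rq(5) by (simp add: density_sm_def set_lebesgue_integral_def mult.commute)
  qed
qed

section \<open>Testing the distance\<close>

lemma smooth_C_class: "smooth \<phi> \<Longrightarrow> C_class k \<phi>"
  by (simp add: smooth_def)

lemma smooth_differentiable: "smooth \<phi> \<Longrightarrow> \<phi> differentiable (at x)"
  using smooth_C_class[of \<phi> "Suc 0"] by simp

lemma smooth_measurable: "smooth \<phi> \<Longrightarrow> \<phi> \<in> borel_measurable borel"
  using smooth_C_class[of \<phi> 0] by (simp add: borel_measurable_continuous_onI)

lemma smooth_partial: "smooth \<phi> \<Longrightarrow> smooth (partial i \<phi>)"
  unfolding smooth_def by (metis C_class.simps(2))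

lemma partial_cmult:
  assumes "smooth \<phi>" shows "partial i (\<lambda>x. c * \<phi> x) = (\<lambda>x. c * partial i \<phi> x)"
proof
  fix x
  obtain D where D: "(\<phi> has_derivative D) (at x)"
    using smooth_differentiable[OF assms] by (auto simp: differentiable_def)
  have "((\<lambda>t. x + t *\<^sub>R axis i 1) has_derivative (\<lambda>t. t *\<^sub>R axis i 1)) (at 0)"
    by (auto intro!: derivative_eq_intros)
  from has_derivative_compose[OF this, of \<phi> D] D
  have "((\<lambda>t. \<phi> (x + t *\<^sub>R axis i 1)) has_derivative (\<lambda>t. D (t *\<^sub>R axis i 1))) (at 0)" by simp
  moreover have "D (t *\<^sub>R axis i 1) = D (axis i 1) * t" for t
    using linear_cmul[OF has_derivative_linear[OF D]] by (simp add: mult.commute)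
  ultimately have d: "((\<lambda>t. \<phi> (x + t *\<^sub>R axis i 1)) has_real_derivative D (axis i 1)) (at 0)"
    by (simp add: has_field_derivative_def)
  show "partial i (\<lambda>x. c * \<phi> x) x = c * partial i \<phi> x"
    unfolding partial_def DERIV_imp_deriv[OF d] by (rule DERIV_imp_deriv[OF DERIV_cmult[OF d]])
qed

lemma smooth_cmult: "smooth \<phi> \<Longrightarrow> smooth (\<lambda>x. c * \<phi> x)"
proof -
  have "C_class n (\<lambda>x. c * \<phi> x)" if "smooth \<phi>" for n and \<phi> :: "real^'d \<Rightarrow> real"
    using that
  proof (induction n arbitrary: \<phi>)
    case 0 then show ?case using smooth_C_class[of \<phi> 0] by (auto intro: continuous_intros)
  next
    case (Suc n)
    then show ?case using smooth_differentiable[OF Suc.prems]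
      by (auto simp: partial_cmult smooth_partial intro!: differentiable_mult)
  qed
  then show "smooth \<phi> \<Longrightarrow> smooth (\<lambda>x. c * \<phi> x)" by (auto simp: smooth_def)
qed

lemma mpartial_cmult:
  assumes "smooth \<phi>" shows "mpartial \<beta> (\<lambda>x. c * \<phi> x) = (\<lambda>x. c * mpartial \<beta> \<phi> x)"
proof -
  have p: "(partial i ^^ n) (\<lambda>x. c * \<phi> x) = (\<lambda>x. c * (partial i ^^ n) \<phi> x) \<and> smooth ((partial i ^^ n) \<phi>)"
    if "smooth \<phi>" for i n and \<phi> :: "real^'a \<Rightarrow> real"
    using that by (induction n) (auto simp: partial_cmult smooth_partial)
  have "foldr (\<lambda>i g. (partial i ^^ \<beta> i) g) xs (\<lambda>x. c * \<phi> x) = (\<lambda>x. c * foldr (\<lambda>i g. (partial i ^^ \<beta> i) g) xs \<phi> x)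
    \<and> smooth (foldr (\<lambda>i g. (partial i ^^ \<beta> i) g) xs \<phi>)" for xs
    by (induction xs) (auto simp: p assms)
  then show ?thesis unfolding mpartial_def by blast
qed

lemma finite_multi_indices [simp]: "finite (multi_indices k :: ('d::finite \<Rightarrow> nat) set)"
proof (rule finite_subset)
  show "multi_indices k \<subseteq> Pi\<^sub>E (UNIV :: 'd set) (\<lambda>_. {..k})"
  proof
    fix \<beta> :: "'d \<Rightarrow> nat" assume "\<beta> \<in> multi_indices k"
    then have "(\<Sum>i\<in>UNIV. \<beta> i) \<le> k" by (simp add: multi_indices_def mi_order_def)
    moreover have "\<beta> i \<le> (\<Sum>i\<in>UNIV. \<beta> i)" for i by (rule member_le_sum) auto
    ultimately show "\<beta> \<in> Pi\<^sub>E UNIV (\<lambda>_. {..k})" by (auto intro: order_trans)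
  qed
qed (auto intro: finite_PiE)

lemma zero_in_multi_indices [simp]: "(\<lambda>_. 0) \<in> multi_indices k"
  by (simp add: multi_indices_def mi_order_def)

lemma multi_indices_card_pos: "0 < card (multi_indices k :: ('d::finite \<Rightarrow> nat) set)"
  by (metis card_gt_0_iff empty_iff finite_multi_indices zero_in_multi_indices)

lemma mpartial_zero [simp]: "mpartial (\<lambda>_. 0) \<phi> = \<phi>"
proof -
  have "foldr (\<lambda>i g. (partial i ^^ 0) g) xs \<phi> = \<phi>" for xs by (induction xs) auto
  then show ?thesis by (simp add: mpartial_def)
qed

text \<open>\<open>\<phi>\<close> is smooth and all its derivatives up to order \<open>k\<close> are bounded by \<open>D\<close>.\<close>
definition test_bound :: "nat \<Rightarrow> (real^'d::finite \<Rightarrow> real) \<Rightarrow> real \<Rightarrow> bool" where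
  "test_bound k \<phi> D \<longleftrightarrow> smooth \<phi> \<and> 0 < D \<and> (\<forall>\<gamma>\<in>multi_indices k. \<forall>x. \<bar>mpartial \<gamma> \<phi> x\<bar> \<le> D)"

text \<open>The definition of \<open>d\<^sub>k\<close> bounds the sum of the suprema, \<open>test_bound\<close> the largest of them; hence the
  number of multi-indices as a factor.\<close>
lemma dist_k_test:
  fixes f :: "real^'d::finite \<Rightarrow> real"
  assumes d: "dist_k k \<mu> (density_sm f) \<le> ennreal \<epsilon>" and \<epsilon>: "0 \<le> \<epsilon>" and f: "integrable lborel f"
    and t: "test_bound k \<phi> D"
  shows "\<bar>signed_integral \<mu> \<phi> - (\<integral>x. f x * \<phi> x \<partial>lborel)\<bar> \<le> real (card (multi_indices k :: ('d \<Rightarrow> nat) set)) * D * \<epsilon>"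
proof -
  let ?c = "real (card (multi_indices k :: ('d \<Rightarrow> nat) set))"
  have c: "0 < ?c" using multi_indices_card_pos by simp
  have s: "smooth \<phi>" and D: "0 < D" and b: "\<And>\<gamma> x. \<gamma> \<in> multi_indices k \<Longrightarrow> \<bar>mpartial \<gamma> \<phi> x\<bar> \<le> D"
    using t by (auto simp: test_bound_def)
  let ?\<psi> = "\<lambda>x. 1 / (?c * D) * \<phi> x"
  have s': "smooth ?\<psi>" by (rule smooth_cmult[OF s])
  have b0: "\<bar>\<phi> x\<bar> \<le> D" for x using b[OF zero_in_multi_indices, of x] by simp
  have "sup_norm (mpartial \<gamma> ?\<psi>) \<le> ennreal (1 / ?c)" if "\<gamma> \<in> multi_indices k" for \<gamma>
    unfolding sup_norm_def mpartial_cmult[OF s]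
  proof (intro SUP_least ennreal_leI)
    fix x
    have "\<bar>1 / (?c * D) * mpartial \<gamma> \<phi> x\<bar> = \<bar>mpartial \<gamma> \<phi> x\<bar> / (?c * D)" using c D by (simp add: abs_mult)
    also have "\<dots> \<le> D / (?c * D)" using b[OF that, of x] c D by (intro divide_right_mono) auto
    finally show "\<bar>1 / (?c * D) * mpartial \<gamma> \<phi> x\<bar> \<le> 1 / ?c" using D by simp
  qed
  then have "(\<Sum>\<gamma>\<in>multi_indices k. sup_norm (mpartial \<gamma> ?\<psi>)) \<le> (\<Sum>\<gamma>\<in>(multi_indices k :: ('d \<Rightarrow> nat) set). ennreal (1 / ?c))"
    by (rule sum_mono)
  also have "\<dots> = ennreal ?c * ennreal (1 / ?c)" by (simp only: sum_constant ennreal_of_nat_eq_real_of_nat)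
  also have "\<dots> = ennreal (?c * (1 / ?c))" using c by (intro ennreal_mult[symmetric]) auto
  also have "?c * (1 / ?c) = 1" using c by (metis divide_self less_irrefl times_divide_eq_right mult_1_right)
  also have "ennreal 1 = 1" by simp
  finally have "ennreal \<bar>signed_integral \<mu> ?\<psi> - signed_integral (density_sm f) ?\<psi>\<bar> \<le> dist_k k \<mu> (density_sm f)"
    unfolding dist_k_def using s' by (intro SUP_upper) auto
  also note d
  finally have *: "\<bar>signed_integral \<mu> ?\<psi> - signed_integral (density_sm f) ?\<psi>\<bar> \<le> \<epsilon>" using \<epsilon> by (simp add: ennreal_le_iff)
  have sc: "signed_integral \<nu> ?\<psi> = 1 / (?c * D) * signed_integral \<nu> \<phi>" for \<nu>
    unfolding signed_integral_def Bochner_Integration.integral_mult_right_zero by (simp add: right_diff_distrib)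
  have "signed_integral (density_sm f) \<phi> = (\<integral>x. f x * \<phi> x \<partial>lborel)"
    by (rule signed_integral_density_sm[OF f smooth_measurable[OF s] b0])
  then have "\<bar>signed_integral \<mu> \<phi> - (\<integral>x. f x * \<phi> x \<partial>lborel)\<bar> / (?c * D) \<le> \<epsilon>"
  proof -
    have "\<bar>a / (?c * D) - b / (?c * D)\<bar> = \<bar>a - b\<bar> / (?c * D)" for a b
      using c D by (simp only: diff_divide_distrib[symmetric] abs_divide abs_mult abs_of_pos)
    then show ?thesis using * \<open>signed_integral (density_sm f) \<phi> = _\<close> unfolding sc by simp
  qed
  then show ?thesis using c D by (simp add: pos_divide_le_eq mult.commute)
qed

lemma tensor_test_bound:
  fixes u :: "'d::finite \<Rightarrow> real \<Rightarrow> real"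
  assumes "\<forall>i. u i \<in> bumps" obtains D where "test_bound k (tensor u) D"
proof -
  have "\<exists>D>0. \<forall>x. \<bar>mpartial \<gamma> (tensor u) x\<bar> \<le> D" for \<gamma>
  proof -
    have "\<forall>i. (deriv ^^ \<gamma> i) (u i) \<in> bumps" using assms deriv_funpow_in_bumps by blast
    from tensor_bounded[OF this] show ?thesis unfolding tensor.mpartial_F[OF assms] by metis
  qed
  then obtain D where D: "\<And>\<gamma>. 0 < D \<gamma>" "\<And>\<gamma> x. \<bar>mpartial \<gamma> (tensor u) x\<bar> \<le> D \<gamma>" by metis
  let ?D = "\<Sum>\<gamma>\<in>multi_indices k. D \<gamma>"
  have "D \<gamma> \<le> ?D" if "\<gamma> \<in> multi_indices k" for \<gamma>
    using that by (intro member_le_sum) (auto intro: less_imp_le D)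
  then have "\<forall>\<gamma>\<in>multi_indices k. \<forall>x. \<bar>mpartial \<gamma> (tensor u) x\<bar> \<le> ?D" using D(2) order_trans by blast
  moreover have "0 < ?D" by (intro sum_pos finite_multi_indices D) (use zero_in_multi_indices in blast)
  ultimately show thesis using tensor.smooth_F[OF assms] by (intro that[of ?D]) (auto simp: test_bound_def)
qed

section \<open>The mollifier\<close>

text \<open>A nonnegative bump with support \<open>[-1, 1]\<close>.\<close>
definition profile :: "real \<Rightarrow> real" where
  "profile t = flat 1 (t + 1) * flat 1 (1 - t)"

lemma profile_in_bumps: "profile \<in> bumps"
  using flat_product_in_bumps[of 1 "-1" 1] by (simp add: profile_def[abs_def])

lemma profile_nonneg: "0 \<le> profile t" and profile_pos: "\<bar>t\<bar> < 1 \<Longrightarrow> 0 < profile t"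
  and profile_support: "1 < \<bar>t\<bar> \<Longrightarrow> profile t = 0"
  by (auto simp: profile_def flat_def)

text \<open>The mollifier, not normalised: its integral is divided out where it is used.\<close>
definition kernel :: "real^'d::finite \<Rightarrow> real" where
  "kernel = tensor (\<lambda>_. profile)"

abbreviation kernel_mass :: "'d::finite itself \<Rightarrow> real" where
  "kernel_mass d \<equiv> (\<integral>z. kernel (z :: real^'d) \<partial>lborel)"

lemma kernel_measurable [measurable]: "kernel \<in> borel_measurable borel"
  unfolding kernel_def by (rule tensor_measurable) (simp add: profile_in_bumps)

lemma kernel_integrable: "integrable lborel kernel"
  unfolding kernel_def by (rule tensor_integrable) (simp add: profile_in_bumps)

lemma kernel_nonneg: "0 \<le> kernel z"
  by (auto simp: kernel_def tensor_def intro!: prod_nonneg profile_nonneg)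

lemma kernel_support: "1 < \<bar>z $ i\<bar> \<Longrightarrow> kernel z = 0"
  by (auto simp: kernel_def tensor_def intro!: prod_zero profile_support exI[of _ i])

lemma content_cube:
  fixes y :: "real^'d::finite"
  assumes "0 < r"
  shows "measure lborel (cbox (y - vec r) (y + vec r)) = (2 * r) ^ CARD('d)"
proof -
  have "cbox (y - vec r) (y + vec r) \<noteq> {}" using assms by (auto simp: interval_ne_empty_cart)
  then show ?thesis by (simp add: content_cbox_cart)
qed

lemma kernel_mass_pos: "0 < kernel_mass TYPE('d::finite)"
proof -
  let ?B = "cbox (0 - vec (1/2)) (0 + vec (1/2)) :: (real^'d) set"
  have pos: "0 < kernel z" if "z \<in> ?B" for z :: "real^'d"
  proof -
    have "\<bar>z $ i\<bar> < 1" for i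
      using that[unfolded mem_box_cart, rule_format, of i] by (simp add: abs_less_iff)
    then show ?thesis unfolding kernel_def tensor_def by (intro prod_pos profile_pos) auto
  qed
  have "kernel_mass TYPE('d) \<noteq> 0"
  proof
    assume "kernel_mass TYPE('d) = 0"
    then have "AE z in lborel. kernel (z :: real^'d) = 0"
      using integral_nonneg_eq_0_iff_AE[OF kernel_integrable] kernel_nonneg by auto
    then have "AE z in lborel. (z :: real^'d) \<notin> ?B"
      by eventually_elim (use pos in force)
    then have "emeasure lborel ?B = 0"
      by (subst (asm) AE_iff_measurable[OF _ refl]) auto
    then have "measure lborel ?B = 0" by (simp add: measure_def)
    then show False using content_cube[of "1/2" "0 :: real^'d"] by simp
  qed
  moreover have "0 \<le> kernel_mass TYPE('d)" by (intro Bochner_Integration.integral_nonneg kernel_nonneg)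
  ultimately show ?thesis by simp
qed

lemma profile_deriv_bounds:
  obtains M where "1 \<le> M" "\<And>j t. j \<le> J \<Longrightarrow> \<bar>(deriv ^^ j) profile t\<bar> \<le> M"
proof -
  have "\<exists>M>0. \<forall>t. \<bar>(deriv ^^ j) profile t\<bar> \<le> M" for j
    using bumps_bounded[OF deriv_funpow_in_bumps[OF profile_in_bumps]] by metis
  then obtain M where M: "\<And>j. 0 < M j" "\<And>j t. \<bar>(deriv ^^ j) profile t\<bar> \<le> M j" by metis
  have "\<bar>(deriv ^^ j) profile t\<bar> \<le> 1 + (\<Sum>j\<le>J. M j)" if "j \<le> J" for j t
  proof -
    have "M j \<le> (\<Sum>j\<le>J. M j)" using that by (intro member_le_sum) (auto intro: less_imp_le M)
    then show ?thesis using M(2)[of j t] by linarith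
  qed
  moreover have "0 \<le> (\<Sum>j\<le>J. M j)" by (intro sum_nonneg) (auto intro: less_imp_le M)
  ultimately show thesis by (intro that[of "1 + (\<Sum>j\<le>J. M j)"]) auto
qed

section \<open>Pairing with rescaled bumps\<close>

text \<open>A tuple of bumps supported in \<open>[-r, r]\<close> whose derivatives of order \<open>j \<le> k\<close> are at most \<open>M r\<^sup>-\<^sup>j\<close>. The
  number \<open>S\<close> then bounds all partial derivatives of order at most \<open>k\<close> of the tensor product.\<close>
locale rescaled_bumps =
  fixes v :: "'d::finite \<Rightarrow> real \<Rightarrow> real" and r M S :: real and k :: nat
  assumes v: "\<forall>i. v i \<in> bumps" and r: "0 < r" "r \<le> 1" and M: "1 \<le> M"
    and bound: "\<And>i j t. j \<le> k \<Longrightarrow> \<bar>(deriv ^^ j) (v i) t\<bar> \<le> M * (1 / r) ^ j"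
    and support: "\<And>i t. r < \<bar>t\<bar> \<Longrightarrow> v i t = 0"
    and S: "S = M ^ CARD('d) * (1 / r) ^ k"
begin

lemma S_pos: "0 < S"
  using M r by (simp add: S)

lemma v_deriv: "\<forall>i. (deriv ^^ \<gamma> i) (v i) \<in> bumps"
  using v deriv_funpow_in_bumps by blast

lemma tensor_deriv_bound:
  assumes "\<gamma> \<in> multi_indices k"
  shows "\<bar>tensor (\<lambda>i. (deriv ^^ \<gamma> i) (v i)) (y - x)\<bar> \<le> S * indicator (cbox (y - vec r) (y + vec r)) x"
proof (cases "x \<in> cbox (y - vec r) (y + vec r)")
  case True
  have sum: "(\<Sum>i\<in>UNIV. \<gamma> i) \<le> k" using assms by (simp add: multi_indices_def mi_order_def)
  have \<gamma>: "\<gamma> i \<le> k" for i using member_le_sum[of i UNIV \<gamma>] sum by auto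
  have "\<bar>tensor (\<lambda>i. (deriv ^^ \<gamma> i) (v i)) (y - x)\<bar> \<le> (\<Prod>i\<in>UNIV. M * (1 / r) ^ \<gamma> i)"
    unfolding tensor_def abs_prod by (intro prod_mono) (auto intro: bound \<gamma>)
  also have "\<dots> = M ^ CARD('d) * (1 / r) ^ (\<Sum>i\<in>UNIV. \<gamma> i)"
    by (simp add: prod.distrib power_sum)
  also have "\<dots> \<le> S"
    unfolding S using M r sum by (intro mult_left_mono power_increasing) auto
  finally show ?thesis using True by simp
next
  case False
  then obtain i where "\<not> ((y - vec r) $ i \<le> x $ i \<and> x $ i \<le> (y + vec r) $ i)"
    unfolding mem_box_cart by blast
  then have i: "r < \<bar>(y - x) $ i\<bar>" by auto
  have "(deriv ^^ \<gamma> i) (v i) ((y - x) $ i) = 0" by (rule deriv_funpow_support[OF support i])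
  then have "tensor (\<lambda>i. (deriv ^^ \<gamma> i) (v i)) (y - x) = 0" unfolding tensor_def by (intro prod_zero) auto
  then show ?thesis using False by simp
qed

lemma tensor_bound_0: "\<bar>tensor v (y - x)\<bar> \<le> S * indicator (cbox (y - vec r) (y + vec r)) x"
  using tensor_deriv_bound[OF zero_in_multi_indices] by simp

lemma test_bound_translate: "test_bound k (\<lambda>y. tensor v (y - x)) S"
proof -
  let ?u = "\<lambda>i t. v i (t - x $ i)"
  have aff: "?u i = (\<lambda>t. v i (1 * t + - (x $ i)))" for i by simp
  have u: "\<forall>i. ?u i \<in> bumps" unfolding aff using v by (intro allI bumps_affine) auto
  have eq: "(\<lambda>y. tensor v (y - x)) = tensor ?u" by (auto simp: tensor_translate_family)
  have "(deriv ^^ n) (?u i) = (\<lambda>t. (deriv ^^ n) (v i) (t - x $ i))" for n i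
    unfolding aff using deriv_funpow_affine[of "v i" n 1 "- (x $ i)"] v by simp
  then have mp: "mpartial \<gamma> (tensor ?u) y = tensor (\<lambda>i. (deriv ^^ \<gamma> i) (v i)) (y - x)" for \<gamma> y
    unfolding tensor.mpartial_F[OF u] tensor_translate_family by simp
  have "\<bar>mpartial \<gamma> (tensor ?u) y\<bar> \<le> S" if "\<gamma> \<in> multi_indices k" for \<gamma> y
  proof -
    have "S * indicator (cbox (y - vec r) (y + vec r)) x \<le> S" using S_pos by (simp add: indicator_def)
    with tensor_deriv_bound[OF that, of y x] show ?thesis
      unfolding mp by linarith
  qed
  then show ?thesis using S_pos tensor.smooth_F[OF u] unfolding test_bound_def eq by blast
qed

lemma integral_tensor_deriv_bound:
  assumes "\<gamma> \<in> multi_indices k" and [measurable]: "s \<in> borel_measurable borel" and s: "\<And>x. \<bar>s x\<bar> \<le> 1"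
  shows "\<bar>tensor_conv s (\<lambda>i. (deriv ^^ \<gamma> i) (v i)) y\<bar> \<le> S * (2 * r) ^ CARD('d)"
proof -
  let ?w = "\<lambda>i. (deriv ^^ \<gamma> i) (v i)"
  have int: "integrable lborel (\<lambda>x. tensor ?w (y - x) * s x)"
    by (rule tensor_conv_integrable[OF v_deriv]) (use s in auto)
  have "\<bar>tensor_conv s ?w y\<bar> \<le> (\<integral>x. \<bar>tensor ?w (y - x) * s x\<bar> \<partial>lborel)"
    unfolding tensor_conv_def by (rule integral_abs_bound)
  also have "\<dots> \<le> (\<integral>x. S * indicator (cbox (y - vec r) (y + vec r)) x \<partial>lborel)"
  proof (rule Bochner_Integration.integral_mono)
    show "integrable lborel (\<lambda>x. \<bar>tensor ?w (y - x) * s x\<bar>)" using int by simp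
    show "integrable lborel (\<lambda>x. S * indicator (cbox (y - vec r) (y + vec r)) x)"
      by (intro integrable_mult_right integrable_real_indicator) (use emeasure_lborel_cbox_finite[of "y - vec r" "y + vec r"] in auto)
    fix x
    have "\<bar>tensor ?w (y - x) * s x\<bar> \<le> \<bar>tensor ?w (y - x)\<bar> * 1"
      unfolding abs_mult by (intro mult_left_mono s) auto
    also have "\<dots> \<le> S * indicator (cbox (y - vec r) (y + vec r)) x"
      using tensor_deriv_bound[OF assms(1)] by simp
    finally show "\<bar>tensor ?w (y - x) * s x\<bar> \<le> S * indicator (cbox (y - vec r) (y + vec r)) x" .
  qed
  also have "\<dots> = S * (2 * r) ^ CARD('d)"
    using content_cube[OF r(1), of y] by simp
  finally show ?thesis .
qed

lemma test_bound_conv: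
  assumes "s \<in> borel_measurable borel" "\<And>x. \<bar>s x\<bar> \<le> 1"
  shows "test_bound k (tensor_conv s v) (S * (2 * r) ^ CARD('d))"
proof -
  interpret C: bump_family "tensor_conv s" by (rule bump_family_tensor_conv[OF assms])
  have "\<bar>mpartial \<gamma> (tensor_conv s v) y\<bar> \<le> S * (2 * r) ^ CARD('d)" if "\<gamma> \<in> multi_indices k" for \<gamma> y
    unfolding C.mpartial_F[OF v] by (rule integral_tensor_deriv_bound[OF that assms])
  moreover have "0 < S * (2 * r) ^ CARD('d)" using S_pos r by simp
  ultimately show ?thesis using C.smooth_F[OF v] unfolding test_bound_def by blast
qed

text \<open>If \<open>h\<close> is small as a functional on \<open>C\<^sup>k\<close>, then its pairing \<open>G\<close> with the translates of a rescaled
  tensor product is small both uniformly and in \<open>L\<^sup>1\<close>. For the \<open>L\<^sup>1\<close> bound, \<open>h\<close> is tested against the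
  convolution of the tensor product with the sign of \<open>G\<close>.\<close>
lemma pairing_bounds:
  fixes h :: "real^'d \<Rightarrow> real"
  assumes h: "integrable lborel h" and T: "\<And>\<phi> D. test_bound k \<phi> D \<Longrightarrow> \<bar>\<integral>y. h y * \<phi> y \<partial>lborel\<bar> \<le> D * \<epsilon>"
  defines "G \<equiv> \<lambda>x. \<integral>y. h y * tensor v (y - x) \<partial>lborel"
  shows "G \<in> borel_measurable borel" "\<bar>G x\<bar> \<le> S * \<epsilon>"
    "(\<integral>\<^sup>+x. ennreal \<bar>G x\<bar> \<partial>lborel) \<le> ennreal (S * (2 * r) ^ CARD('d) * \<epsilon>)"
proof -
  note [measurable] = tensor_measurable[OF v]
  have [measurable]: "h \<in> borel_measurable borel" using h by auto
  show G[measurable]: "G \<in> borel_measurable borel" unfolding G_def by measurable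
  show "\<bar>G x\<bar> \<le> S * \<epsilon>" unfolding G_def by (rule T[OF test_bound_translate])
  \<comment> \<open>the sign of \<open>G\<close> turns \<open>\<integral>|G|\<close> into a linear functional of \<open>h\<close>\<close>
  define s where "s x = sgn (G x)" for x
  have sm[measurable]: "s \<in> borel_measurable borel" unfolding s_def[abs_def] by measurable
  have s1: "\<bar>s x\<bar> \<le> 1" for x by (simp add: s_def sgn_if)
  let ?K = "\<lambda>y x. h y * (tensor v (y - x) * s x)"
  let ?C = "S * (2 * r) ^ CARD('d)"
  have int: "integrable (lborel \<Otimes>\<^sub>M lborel) (\<lambda>(y, x). ?K y x)"
  proof (rule integrableI_bounded)
    show "(\<lambda>(y, x). ?K y x) \<in> borel_measurable (lborel \<Otimes>\<^sub>M lborel)" by measurable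
    have "(\<integral>\<^sup>+z. ennreal (norm (case z of (y, x) \<Rightarrow> ?K y x)) \<partial>(lborel \<Otimes>\<^sub>M lborel))
      = (\<integral>\<^sup>+y. (\<integral>\<^sup>+x. ennreal \<bar>?K y x\<bar> \<partial>lborel) \<partial>lborel)"
      by (subst lborel.nn_integral_fst[symmetric]) auto
    also have "\<dots> \<le> (\<integral>\<^sup>+y. ennreal \<bar>h y\<bar> * ennreal ?C \<partial>lborel)"
    proof (rule nn_integral_mono)
      fix y
      have "(\<integral>\<^sup>+x. ennreal \<bar>?K y x\<bar> \<partial>lborel) \<le>
        (\<integral>\<^sup>+x. ennreal \<bar>h y\<bar> * (ennreal S * indicator (cbox (y - vec r) (y + vec r)) x) \<partial>lborel)"
      proof (rule nn_integral_mono)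
        fix x
        have "\<bar>tensor v (y - x) * s x\<bar> \<le> \<bar>tensor v (y - x)\<bar> * 1"
          unfolding abs_mult by (intro mult_left_mono s1) auto
        also have "\<dots> \<le> S * indicator (cbox (y - vec r) (y + vec r)) x" using tensor_bound_0 by simp
        finally have "\<bar>?K y x\<bar> \<le> \<bar>h y\<bar> * (S * indicator (cbox (y - vec r) (y + vec r)) x)"
          unfolding abs_mult by (intro mult_left_mono) auto
        then have "ennreal \<bar>?K y x\<bar> \<le> ennreal (\<bar>h y\<bar> * (S * indicator (cbox (y - vec r) (y + vec r)) x))"
          by (rule ennreal_leI)
        then show "ennreal \<bar>?K y x\<bar> \<le> ennreal \<bar>h y\<bar> * (ennreal S * indicator (cbox (y - vec r) (y + vec r)) x)"
          using S_pos by (auto simp: ennreal_mult indicator_def split: if_splits)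
      qed
      also have "\<dots> = ennreal \<bar>h y\<bar> * (ennreal S * emeasure lborel (cbox (y - vec r) (y + vec r)))"
        by (simp add: nn_integral_cmult)
      also have "emeasure lborel (cbox (y - vec r) (y + vec r)) = ennreal ((2 * r) ^ CARD('d))"
        using content_cube[OF r(1), of y] emeasure_eq_ennreal_measure[of lborel "cbox (y - vec r) (y + vec r)"]
          emeasure_lborel_cbox_finite[of "y - vec r" "y + vec r"] by simp
      also have "ennreal S * ennreal ((2 * r) ^ CARD('d)) = ennreal ?C"
        using S_pos r by (intro ennreal_mult[symmetric]) auto
      finally show "(\<integral>\<^sup>+x. ennreal \<bar>?K y x\<bar> \<partial>lborel) \<le> ennreal \<bar>h y\<bar> * ennreal ?C" .
    qed
    also have "\<dots> = (\<integral>\<^sup>+y. ennreal \<bar>h y\<bar> \<partial>lborel) * ennreal ?C" by (rule nn_integral_multc) simp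
    also have "\<dots> < \<infinity>"
      using h by (auto simp: integrable_iff_bounded intro!: ennreal_mult_less_top[THEN iffD2])
    finally show "(\<integral>\<^sup>+z. ennreal (norm (case z of (y, x) \<Rightarrow> ?K y x)) \<partial>(lborel \<Otimes>\<^sub>M lborel)) < \<infinity>" .
  qed
  have Gs: "(\<integral>y. ?K y x \<partial>lborel) = \<bar>G x\<bar>" for x
  proof -
    have "(\<integral>y. ?K y x \<partial>lborel) = (\<integral>y. (h y * tensor v (y - x)) * s x \<partial>lborel)" by (simp add: mult.assoc)
    also have "\<dots> = G x * s x" unfolding G_def by (rule Bochner_Integration.integral_mult_left_zero)
    also have "\<dots> = \<bar>G x\<bar>" by (simp add: s_def sgn_if)
    finally show ?thesis .
  qed
  have iG: "integrable lborel (\<lambda>x. \<bar>G x\<bar>)"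
    using lborel_pair.integrable_snd[OF int] unfolding Gs .
  have "(\<integral>x. \<bar>G x\<bar> \<partial>lborel) = (\<integral>x. (\<integral>y. ?K y x \<partial>lborel) \<partial>lborel)" by (simp only: Gs)
  also have "\<dots> = (\<integral>y. (\<integral>x. ?K y x \<partial>lborel) \<partial>lborel)" by (rule lborel_pair.Fubini_integral[OF int])
  also have "\<dots> = (\<integral>y. h y * tensor_conv s v y \<partial>lborel)"
    unfolding Bochner_Integration.integral_mult_right_zero tensor_conv_def ..
  also have "\<dots> \<le> ?C * \<epsilon>" using T[OF test_bound_conv[OF sm s1]] by linarith
  finally have "(\<integral>x. \<bar>G x\<bar> \<partial>lborel) \<le> ?C * \<epsilon>" .
  then show "(\<integral>\<^sup>+x. ennreal \<bar>G x\<bar> \<partial>lborel) \<le> ennreal (?C * \<epsilon>)"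
    by (subst nn_integral_eq_integral[OF iG]) (auto intro: ennreal_leI)
qed

end

section \<open>Smoothing\<close>

lemma lborel_integral_affine:
  fixes G :: "'a::euclidean_space \<Rightarrow> real"
  assumes r: "0 < r" and [measurable]: "G \<in> borel_measurable borel"
  shows "integrable lborel (\<lambda>z. G (x + r *\<^sub>R z)) \<longleftrightarrow> integrable lborel G"
    and "(\<integral>y. G y \<partial>lborel) = r ^ DIM('a) * (\<integral>z. G (x + r *\<^sub>R z) \<partial>lborel)"
proof -
  have eq: "lborel = density (distr lborel borel (\<lambda>z. x + r *\<^sub>R z)) (\<lambda>_. ennreal (r ^ DIM('a)))"
    using lborel_affine[of r x] r by (simp add: ennreal_power)
  have "integrable lborel G \<longleftrightarrow> integrable (distr lborel borel (\<lambda>z. x + r *\<^sub>R z)) (\<lambda>y. r ^ DIM('a) * G y)"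
    by (subst eq) (subst integrable_real_density, use r in auto)
  also have "\<dots> \<longleftrightarrow> integrable lborel (\<lambda>z. G (x + r *\<^sub>R z))"
    using r by (simp add: integrable_distr_eq)
  finally show "integrable lborel (\<lambda>z. G (x + r *\<^sub>R z)) \<longleftrightarrow> integrable lborel G" ..
  have "(\<integral>y. G y \<partial>lborel) = (\<integral>y. r ^ DIM('a) * G y \<partial>distr lborel borel (\<lambda>z. x + r *\<^sub>R z))"
    by (subst eq) (subst integral_real_density, use r in auto)
  also have "\<dots> = r ^ DIM('a) * (\<integral>z. G (x + r *\<^sub>R z) \<partial>lborel)"
    by (simp add: integral_distr)
  finally show "(\<integral>y. G y \<partial>lborel) = r ^ DIM('a) * (\<integral>z. G (x + r *\<^sub>R z) \<partial>lborel)" .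
qed

text \<open>Averaging over the translates by \<open>r z\<close>, where \<open>z\<close> has the normalised kernel as its density.\<close>
definition smoothing :: "real \<Rightarrow> (real^'d::finite \<Rightarrow> real) \<Rightarrow> real^'d \<Rightarrow> real" where
  "smoothing r w x = (\<integral>z. kernel z * w (x + r *\<^sub>R z) \<partial>lborel) / kernel_mass TYPE('d)"

lemma smoothing_zero: "smoothing 0 w x = w x"
  using kernel_mass_pos[where 'd='a] by (simp add: smoothing_def)

text \<open>The average of \<open>w\<close> is its integral against a rescaled kernel centred at \<open>x\<close>, which is a test function.\<close>
lemma scaled_profile:
  fixes x :: "real^'d::finite"
  assumes r: "0 < r" and w: "locally_integrable w"
  shows "\<forall>i. (\<lambda>t. profile (1 / r * t + - (x $ i) / r)) \<in> bumps"
    and "integrable lborel (\<lambda>z. kernel z * w (x + r *\<^sub>R z))"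
    and "(\<integral>z. kernel z * w (x + r *\<^sub>R z) \<partial>lborel) = (1 / r) ^ CARD('d) *
      (\<integral>y. w y * tensor (\<lambda>i t. profile (1 / r * t + - (x $ i) / r)) y \<partial>lborel)"
proof -
  let ?u = "\<lambda>i t. profile (1 / r * t + - (x $ i) / r)"
  note [measurable] = locally_integrable_measurable[OF w]
  show u: "\<forall>i. ?u i \<in> bumps"
    by (intro allI bumps_affine profile_in_bumps) (use r in auto)
  note [measurable] = tensor_measurable[OF u]
  have m: "(\<lambda>y. w y * tensor ?u y) \<in> borel_measurable borel" by measurable
  have eq: "w (x + r *\<^sub>R z) * tensor ?u (x + r *\<^sub>R z) = kernel z * w (x + r *\<^sub>R z)" for z
  proof -
    have "1 / r * (x + r *\<^sub>R z) $ i + - (x $ i) / r = z $ i" for i using r by (simp add: field_simps)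
    then show ?thesis by (simp add: tensor_def kernel_def mult.commute)
  qed
  show "integrable lborel (\<lambda>z. kernel z * w (x + r *\<^sub>R z))"
    using lborel_integral_affine(1)[OF r m, of x] integrable_locally_integrable_tensor[OF w u]
    unfolding eq by simp
  have "(\<integral>y. w y * tensor ?u y \<partial>lborel) = r ^ CARD('d) * (\<integral>z. kernel z * w (x + r *\<^sub>R z) \<partial>lborel)"
    using lborel_integral_affine(2)[OF r m, of x] unfolding eq by simp
  then show "(\<integral>z. kernel z * w (x + r *\<^sub>R z) \<partial>lborel) = (1 / r) ^ CARD('d) * (\<integral>y. w y * tensor ?u y \<partial>lborel)"
    using r by (simp add: field_simps)
qed

text \<open>Smoothing the weak derivative \<open>w = \<partial>\<^sub>\<beta>h\<close>. The derivative is moved to the kernel, where it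
  costs \<open>r\<^sup>-\<^sup>q\<close>; the \<open>C\<^sup>k\<close> norm of the result costs \<open>r\<^sup>-\<^sup>k\<close>; and the kernel itself has height of order \<open>r\<^sup>-\<^sup>d\<close>
  and \<open>L\<^sup>1\<close> norm of order \<open>1\<close>.\<close>
lemma smoothing_bounds:
  fixes q k :: nat
  shows "\<exists>A>0. \<forall>(h :: real^'d::finite \<Rightarrow> real) w \<epsilon> r \<beta>. integrable lborel h \<longrightarrow>
      (\<forall>\<phi> D. test_bound k \<phi> D \<longrightarrow> \<bar>\<integral>y. h y * \<phi> y \<partial>lborel\<bar> \<le> D * \<epsilon>) \<longrightarrow> 0 \<le> \<epsilon> \<longrightarrow>
      mi_order \<beta> \<le> q \<longrightarrow> has_weak_deriv \<beta> h w \<longrightarrow> 0 < r \<longrightarrow> r \<le> 1 \<longrightarrow>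
      smoothing r w \<in> borel_measurable borel \<and>
      (\<forall>x. \<bar>smoothing r w x\<bar> \<le> A * (1 / r) ^ (q + k) * (1 / r) ^ CARD('d) * \<epsilon>) \<and>
      (\<integral>\<^sup>+x. ennreal \<bar>smoothing r w x\<bar> \<partial>lborel) \<le> ennreal (A * (1 / r) ^ (q + k) * \<epsilon>)"
proof -
  obtain M where M: "1 \<le> M" "\<And>j t. j \<le> q + k \<Longrightarrow> \<bar>(deriv ^^ j) profile t\<bar> \<le> M"
    by (rule profile_deriv_bounds[of "q + k"]) blast
  let ?Z = "kernel_mass TYPE('d)" and ?d = "CARD('d)"
  have Z: "0 < ?Z" by (rule kernel_mass_pos)
  let ?A = "2 ^ ?d * M ^ ?d / ?Z"
  have A: "0 < ?A" using Z M(1) by simp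
  have main: "smoothing r w \<in> borel_measurable borel \<and>
      \<bar>smoothing r w x\<bar> \<le> ?A * (1 / r) ^ (q + k) * (1 / r) ^ ?d * \<epsilon> \<and>
      (\<integral>\<^sup>+x. ennreal \<bar>smoothing r w x\<bar> \<partial>lborel) \<le> ennreal (?A * (1 / r) ^ (q + k) * \<epsilon>)"
    if h: "integrable lborel h" and T: "\<And>\<phi> D. test_bound k \<phi> D \<Longrightarrow> \<bar>\<integral>y. h y * \<phi> y \<partial>lborel\<bar> \<le> D * \<epsilon>"
      and \<epsilon>: "0 \<le> \<epsilon>" and \<beta>: "mi_order \<beta> \<le> q" and w: "has_weak_deriv \<beta> h w" and r: "0 < r" "r \<le> 1"
    for h :: "real^'d \<Rightarrow> real" and w \<epsilon> r \<beta> x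
  proof -
    have wl: "locally_integrable w" using w by (simp add: has_weak_deriv_def)
    define v where "v i t = (deriv ^^ \<beta> i) profile (1 / r * t + 0)" for i t
    have \<beta>i: "\<beta> i \<le> q" for i using member_le_sum[of i UNIV \<beta>] \<beta> by (auto simp: mi_order_def)
    interpret V: rescaled_bumps v r M "M ^ ?d * (1 / r) ^ k" k
    proof
      show "\<forall>i. v i \<in> bumps" unfolding v_def[abs_def] using r
        by (intro allI bumps_affine deriv_funpow_in_bumps profile_in_bumps) auto
      show "\<bar>(deriv ^^ j) (v i) t\<bar> \<le> M * (1 / r) ^ j" if "j \<le> k" for i j t
      proof -
        have "(deriv ^^ j) (v i) t = (1 / r) ^ j * (deriv ^^ j) ((deriv ^^ \<beta> i) profile) (1 / r * t + 0)"
          unfolding v_def[abs_def] by (subst deriv_funpow_affine) (auto intro: deriv_funpow_in_bumps profile_in_bumps)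
        also have "(deriv ^^ j) ((deriv ^^ \<beta> i) profile) = (deriv ^^ (j + \<beta> i)) profile" by (simp add: funpow_add)
        finally have "\<bar>(deriv ^^ j) (v i) t\<bar> = (1 / r) ^ j * \<bar>(deriv ^^ (j + \<beta> i)) profile (1 / r * t + 0)\<bar>"
          using r by (simp add: abs_mult)
        also have "\<dots> \<le> (1 / r) ^ j * M"
          using r that \<beta>i[of i] by (intro mult_left_mono M(2)) auto
        finally show ?thesis by (simp add: mult.commute)
      qed
      show "v i t = 0" if "r < \<bar>t\<bar>" for i t
        unfolding v_def by (rule deriv_funpow_support[OF profile_support]) (use that r in \<open>auto simp: abs_mult field_simps\<close>)
    qed (use r M in auto)
    let ?G = "\<lambda>x. \<integral>y. h y * tensor v (y - x) \<partial>lborel"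
    note G = V.pairing_bounds[OF h T]
    have sm: "smoothing r w x = (-1) ^ mi_order \<beta> * ((1 / r) ^ (?d + mi_order \<beta>) / ?Z) * ?G x" for x
    proof -
      let ?u = "\<lambda>i t. profile (1 / r * t + - (x $ i) / r)"
      note u = scaled_profile[OF r(1) wl, of x]
      have du: "(deriv ^^ \<beta> i) (?u i) t = (1 / r) ^ \<beta> i * v i (t - x $ i)" for i t
        by (subst deriv_funpow_affine[OF profile_in_bumps]) (simp add: v_def diff_divide_distrib)
      have "tensor (\<lambda>i. (deriv ^^ \<beta> i) (?u i)) y = (1 / r) ^ mi_order \<beta> * tensor v (y - x)" for y
        unfolding tensor_def du by (simp add: prod.distrib power_sum mi_order_def)
      then have "(\<integral>y. h y * tensor (\<lambda>i. (deriv ^^ \<beta> i) (?u i)) y \<partial>lborel)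
          = (\<integral>y. (1 / r) ^ mi_order \<beta> * (h y * tensor v (y - x)) \<partial>lborel)"
        by (simp add: mult_ac)
      also have "\<dots> = (1 / r) ^ mi_order \<beta> * ?G x" by (rule Bochner_Integration.integral_mult_right_zero)
      finally have "(-1) ^ mi_order \<beta> * (\<integral>y. w y * tensor ?u y \<partial>lborel) = (1 / r) ^ mi_order \<beta> * ?G x"
        using has_weak_deriv_tensor[OF w u(1)] by simp
      then have "(\<integral>y. w y * tensor ?u y \<partial>lborel) = (-1) ^ mi_order \<beta> * ((1 / r) ^ mi_order \<beta> * ?G x)"
        by (auto simp: minus_one_power_iff split: if_splits)
      then show ?thesis unfolding smoothing_def u(3) by (simp add: power_add)
    qed
    let ?c = "(1 / r) ^ (?d + mi_order \<beta>) / ?Z"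
    have c: "0 < ?c" using r Z by simp
    have asm: "\<bar>smoothing r w x\<bar> = ?c * \<bar>?G x\<bar>" for x
      unfolding sm abs_mult abs_of_pos[OF c] by (simp add: power_abs)
    have rq: "(1 / r) ^ mi_order \<beta> \<le> (1 / r) ^ q" using r \<beta> by (intro power_increasing) auto
    have cq: "?c \<le> (1 / r) ^ ?d * (1 / r) ^ q / ?Z"
      unfolding power_add using rq r Z by (intro divide_right_mono mult_left_mono) auto
    have "smoothing r w = (\<lambda>x. (-1) ^ mi_order \<beta> * ?c * ?G x)" using sm by blast
    then have 1: "smoothing r w \<in> borel_measurable borel" using G(1) by simp
    have p: "(0::real) \<le> M ^ ?d * (1 / r) ^ k * \<epsilon>" using M(1) r \<epsilon> by simp
    have "?c * \<bar>?G x\<bar> \<le> ((1 / r) ^ ?d * (1 / r) ^ q / ?Z) * (M ^ ?d * (1 / r) ^ k * \<epsilon>)"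
      using cq G(2)[of x] c by (intro mult_mono) (auto simp: p r Z less_imp_le)
    also have "\<dots> = 1 * ((M ^ ?d / ?Z) * (1 / r) ^ (q + k) * (1 / r) ^ ?d * \<epsilon>)"
      by (simp add: power_add mult_ac)
    also have "\<dots> \<le> 2 ^ ?d * ((M ^ ?d / ?Z) * (1 / r) ^ (q + k) * (1 / r) ^ ?d * \<epsilon>)"
      using M(1) r \<epsilon> Z by (intro mult_right_mono) auto
    finally have 2: "\<bar>smoothing r w x\<bar> \<le> ?A * (1 / r) ^ (q + k) * (1 / r) ^ ?d * \<epsilon>"
      unfolding asm by (simp add: mult_ac)
    have "(\<integral>\<^sup>+x. ennreal \<bar>smoothing r w x\<bar> \<partial>lborel) = (\<integral>\<^sup>+x. ennreal ?c * ennreal \<bar>?G x\<bar> \<partial>lborel)"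
      unfolding asm by (intro nn_integral_cong ennreal_mult) (use c in auto)
    also have "\<dots> = ennreal ?c * (\<integral>\<^sup>+x. ennreal \<bar>?G x\<bar> \<partial>lborel)"
      by (rule nn_integral_cmult) (use G(1) in simp)
    also have "\<dots> \<le> ennreal ?c * ennreal (M ^ ?d * (1 / r) ^ k * (2 * r) ^ ?d * \<epsilon>)"
      by (intro mult_left_mono G(3) zero_le)
    also have "\<dots> = ennreal (?c * (M ^ ?d * (1 / r) ^ k * (2 * r) ^ ?d * \<epsilon>))"
      using c p r M \<epsilon> by (intro ennreal_mult[symmetric]) auto
    also have "\<dots> \<le> ennreal (((1 / r) ^ ?d * (1 / r) ^ q / ?Z) * (M ^ ?d * (1 / r) ^ k * (2 * r) ^ ?d * \<epsilon>))"
      using cq M(1) r \<epsilon> by (intro ennreal_leI mult_right_mono) auto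
    also have "((1 / r) ^ ?d * (1 / r) ^ q / ?Z) * (M ^ ?d * (1 / r) ^ k * (2 * r) ^ ?d * \<epsilon>)
      = ((1 / r) * r) ^ ?d * (?A * (1 / r) ^ (q + k) * \<epsilon>)"
      unfolding power_mult_distrib power_add by (simp only: mult_ac times_divide_eq_left times_divide_eq_right)
    also have "(1 / r) * r = 1" using r by simp
    finally have 3: "(\<integral>\<^sup>+x. ennreal \<bar>smoothing r w x\<bar> \<partial>lborel) \<le> ennreal (?A * (1 / r) ^ (q + k) * \<epsilon>)" by simp
    show ?thesis using 1 2 3 by blast
  qed
  show ?thesis by (intro exI[of _ ?A] conjI A allI impI) (use main in blast)+
qed

section \<open>The interpolation step\<close>

lemma deriv_familyI:
  assumes "\<And>\<beta>. mi_order \<beta> \<le> n \<Longrightarrow> has_weak_deriv \<beta> h (w \<beta>)"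
  shows "deriv_family n w"
  unfolding deriv_family_def
  using has_weak_deriv_weak_partial assms by (metis Suc_leI less_imp_le_nat mi_order_upd_Suc)

context young
begin

text \<open>The average over \<open>z\<close> of the \<open>n\<close>-th differences with step \<open>\<rho> z\<close> is a combination of smoothings at the
  scales \<open>0, \<rho>, \<dots>, n \<rho>\<close>. Smoothing at scale \<open>0\<close> is the identity and \<open>cf 0 = 1\<close>, so this bounds the error of approximating
  \<open>w\<close> by its smoothings.\<close>
lemma smoothing_error:
  fixes w :: "('d::finite \<Rightarrow> nat) \<Rightarrow> real^'d \<Rightarrow> real"
  assumes w: "deriv_family (q + n) w" "\<And>\<beta>. mi_order \<beta> \<le> q + n \<Longrightarrow> lux c (w \<beta>)"
    and \<rho>: "0 < \<rho>" and \<beta>: "mi_order \<beta> \<le> q"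
    and cf: "\<And>g (h :: real^'d) x. (step_diff h ^^ n) g x = (\<Sum>j\<le>n. cf j * g (x + real j *\<^sub>R h))"
  shows "lux ((real CARD('d) * \<rho>) ^ n * c) (\<lambda>x. \<Sum>j\<le>n. cf j * smoothing (real j * \<rho>) (w \<beta>) x)"
proof -
  let ?Z = "kernel_mass TYPE('d)"
  have Z: "0 < ?Z" by (rule kernel_mass_pos)
  have wl: "locally_integrable (w \<beta>)" by (rule lux_locally_integrable[OF w(2)]) (use \<beta> in simp)
  note [measurable] = locally_integrable_measurable[OF wl]
  let ?M = "density lborel (\<lambda>z :: real^'d. ennreal (kernel z / ?Z))"
  have M: "prob_space ?M"
  proof (rule prob_spaceI)
    have "emeasure ?M (space ?M) = (\<integral>\<^sup>+z. ennreal (kernel z / ?Z) \<partial>(lborel :: (real^'d) measure))"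
      by (simp add: emeasure_density)
    also have "\<dots> = ennreal (\<integral>z. kernel z / ?Z \<partial>(lborel :: (real^'d) measure))"
      by (rule nn_integral_eq_integral) (use Z in \<open>auto intro!: AE_I2 divide_nonneg_pos kernel_nonneg kernel_integrable\<close>)
    also have "(\<integral>z. kernel z / ?Z \<partial>(lborel :: (real^'d) measure)) = 1" using Z by simp
    finally show "emeasure ?M (space ?M) = 1" by simp
  qed
  let ?B = "cbox (- vec 1) (vec 1) :: (real^'d) set"
  let ?F = "\<lambda>x z. indicator ?B z * (step_diff (\<rho> *\<^sub>R z) ^^ n) (w \<beta>) x"
  have Feq: "?F x z = indicator ?B z * (\<Sum>j\<le>n. cf j * w \<beta> (x + (real j * \<rho>) *\<^sub>R z))" for x z
    unfolding cf by simp
  have c: "0 < c" using w(2)[of \<beta>] \<beta> by (auto simp: lux_def)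
  have C: "0 < (real CARD('d) * \<rho>) ^ n * c" using c \<rho> by simp
  have av: "lux ((real CARD('d) * \<rho>) ^ n * c) (\<lambda>x. \<integral>z. ?F x z \<partial>?M)"
  proof (rule lux_average[OF M])
    show "(\<lambda>(x, z). ?F x z) \<in> borel_measurable (borel \<Otimes>\<^sub>M ?M)" unfolding Feq by measurable
    fix z :: "real^'d"
    show "lux ((real CARD('d) * \<rho>) ^ n * c) (\<lambda>x. ?F x z)"
    proof (cases "z \<in> ?B")
      case True
      have "\<bar>(\<rho> *\<^sub>R z) $ i\<bar> \<le> \<rho>" for i
        using True[unfolded mem_box_cart, rule_format, of i] \<rho> by (simp add: abs_mult abs_le_iff)
      from lux_step_diff_funpow[OF w this \<rho> \<beta>] show ?thesis using True by simp
    next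
      case False then show ?thesis using C by (simp add: lux_def)
    qed
  qed
  have "(\<integral>z. ?F x z \<partial>?M) = (\<Sum>j\<le>n. cf j * smoothing (real j * \<rho>) (w \<beta>) x)" for x
  proof -
    have int: "integrable lborel (\<lambda>z. kernel z * w \<beta> (x + (real j * \<rho>) *\<^sub>R z))" for j
    proof (cases "j = 0")
      case True then show ?thesis by (simp add: kernel_integrable)
    next
      case False then show ?thesis using \<rho> by (intro scaled_profile(2)[OF _ wl]) auto
    qed
    have k0: "kernel z = 0" if z: "z \<notin> ?B" for z :: "real^'d"
    proof -
      obtain i where "\<not> ((- vec 1) $ i \<le> z $ i \<and> z $ i \<le> (vec 1) $ i)"
        using z unfolding mem_box_cart by blast
      then have "1 < \<bar>z $ i\<bar>" by auto
      then show ?thesis by (rule kernel_support)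
    qed
    have "(\<integral>z. ?F x z \<partial>?M) = (\<integral>z. kernel z / ?Z * ?F x z \<partial>lborel)"
      unfolding Feq by (subst integral_real_density) (use Z in \<open>auto intro!: AE_I2 divide_nonneg_pos kernel_nonneg\<close>)
    also have "\<dots> = (\<integral>z. (\<Sum>j\<le>n. cf j / ?Z * (kernel z * w \<beta> (x + (real j * \<rho>) *\<^sub>R z))) \<partial>lborel)"
    proof (intro Bochner_Integration.integral_cong refl)
      fix z
      show "kernel z / ?Z * ?F x z = (\<Sum>j\<le>n. cf j / ?Z * (kernel z * w \<beta> (x + (real j * \<rho>) *\<^sub>R z)))"
        unfolding Feq using k0[of z] by (cases "z \<in> ?B") (simp_all add: sum_distrib_left mult_ac)
    qed
    also have "\<dots> = (\<Sum>j\<le>n. (\<integral>z. cf j / ?Z * (kernel z * w \<beta> (x + (real j * \<rho>) *\<^sub>R z)) \<partial>lborel))"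
      by (rule Bochner_Integration.integral_sum) (intro integrable_mult_right int)
    also have "\<dots> = (\<Sum>j\<le>n. cf j * smoothing (real j * \<rho>) (w \<beta>) x)"
      unfolding Bochner_Integration.integral_mult_right_zero smoothing_def by simp
    finally show ?thesis .
  qed
  then show ?thesis using av by simp
qed

text \<open>The balance between regularity and closeness: a function with \<open>q + n\<close> derivatives of size \<open>c\<close> that is
  \<open>\<epsilon>\<close>-small on \<open>C\<^sup>k\<close> has derivatives up to order \<open>q\<close> of size \<open>\<delta>\<^sup>n c + \<delta>\<^sup>-\<^sup>(\<^sup>q\<^sup>+\<^sup>k\<^sup>) b \<epsilon>\<close>, for every scale
  \<open>\<delta> \<le> 1\<close>. The number \<open>b\<close> is the size of a function of \<open>L\<^sup>1\<close> norm \<open>1\<close> and height \<open>\<delta>\<^sup>-\<^sup>d\<close>.\<close>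
lemma interpolation_step:
  fixes q n k :: nat
  assumes n: "1 \<le> n"
  shows "\<exists>A>0. \<forall>(h :: real^'d::finite \<Rightarrow> real) w c \<epsilon> \<delta> b. integrable lborel h \<longrightarrow>
      (\<forall>\<phi> D. test_bound k \<phi> D \<longrightarrow> \<bar>\<integral>y. h y * \<phi> y \<partial>lborel\<bar> \<le> D * \<epsilon>) \<longrightarrow> 0 < \<epsilon> \<longrightarrow>
      (\<forall>\<beta>. mi_order \<beta> \<le> q + n \<longrightarrow> has_weak_deriv \<beta> h (w \<beta>) \<and> lux c (w \<beta>)) \<longrightarrow>
      0 < \<delta> \<longrightarrow> \<delta> \<le> 1 \<longrightarrow> 0 < b \<longrightarrow> \<Phi> ((1 / \<delta>) ^ CARD('d) / b) \<le> (1 / \<delta>) ^ CARD('d) \<longrightarrow>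
      (\<forall>\<beta>. mi_order \<beta> \<le> q \<longrightarrow> lux (A * (\<delta> ^ n * c + (1 / \<delta>) ^ (q + k) * b * \<epsilon>)) (w \<beta>))"
proof -
  let ?d = "CARD('d)"
  obtain A where A: "0 < A" and Ab: "\<And>(h :: real^'d \<Rightarrow> real) w \<epsilon> r \<beta>. integrable lborel h \<Longrightarrow>
      \<forall>\<phi> D. test_bound k \<phi> D \<longrightarrow> \<bar>\<integral>y. h y * \<phi> y \<partial>lborel\<bar> \<le> D * \<epsilon> \<Longrightarrow> 0 \<le> \<epsilon> \<Longrightarrow>
      mi_order \<beta> \<le> q \<Longrightarrow> has_weak_deriv \<beta> h w \<Longrightarrow> 0 < r \<Longrightarrow> r \<le> 1 \<Longrightarrow>
      smoothing r w \<in> borel_measurable borel \<and>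
      (\<forall>x. \<bar>smoothing r w x\<bar> \<le> A * (1 / r) ^ (q + k) * (1 / r) ^ ?d * \<epsilon>) \<and>
      (\<integral>\<^sup>+x. ennreal \<bar>smoothing r w x\<bar> \<partial>lborel) \<le> ennreal (A * (1 / r) ^ (q + k) * \<epsilon>)"
    using smoothing_bounds[where 'd='d, of k q] by blast
  obtain cf where cf: "cf 0 = 1"
    "\<And>g (h :: real^'d) x. (step_diff h ^^ n) g x = (\<Sum>j\<le>n. cf j * g (x + real j *\<^sub>R h))"
    using step_diff_funpow_expand[where 'a="real^'d", of n] by blast
  define K where "K = 1 + (\<Sum>j\<le>n. \<bar>cf j\<bar>)"
  have K: "0 < K" by (simp add: K_def add_pos_nonneg sum_nonneg)
  have cfK: "\<bar>cf j\<bar> \<le> K" if "j \<le> n" for j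
    using member_le_sum[of j "{..n}" "\<lambda>j. \<bar>cf j\<bar>"] that by (simp add: K_def)
  define A' where "A' = real ?d ^ n + real n * K * A * real n ^ (q + k + ?d)"
  have A': "0 < A'" using A K n by (simp add: A'_def add_pos_nonneg)
  have "lux (A' * (\<delta> ^ n * c + (1 / \<delta>) ^ (q + k) * b * \<epsilon>)) (w \<beta>)"
    if h: "integrable lborel h" and T: "\<forall>\<phi> D. test_bound k \<phi> D \<longrightarrow> \<bar>\<integral>y. h y * \<phi> y \<partial>lborel\<bar> \<le> D * \<epsilon>"
      and \<epsilon>: "0 < \<epsilon>"
      and w: "\<forall>\<beta>. mi_order \<beta> \<le> q + n \<longrightarrow> has_weak_deriv \<beta> h (w \<beta>) \<and> lux c (w \<beta>)"
      and \<delta>: "0 < \<delta>" "\<delta> \<le> 1" and b: "0 < b" "\<Phi> ((1 / \<delta>) ^ ?d / b) \<le> (1 / \<delta>) ^ ?d"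
      and \<beta>: "mi_order \<beta> \<le> q"
    for h :: "real^'d \<Rightarrow> real" and w c \<epsilon> \<delta> b \<beta>
  proof -
    \<comment> \<open>all the scales \<open>\<rho>, \<dots>, n \<rho>\<close> then lie between \<open>\<delta>/n\<close> and \<open>\<delta>\<close>\<close>
    define \<rho> where "\<rho> = \<delta> / real n"
    have \<rho>: "0 < \<rho>" using \<delta> n by (simp add: \<rho>_def)
    define a where "a = A * real n ^ (q + k + ?d) * (1 / \<delta>) ^ (q + k) * \<epsilon>"
    have a: "0 < a" using A n \<delta> \<epsilon> by (simp add: a_def)
    have c: "0 < c" using w \<beta> lux_pos by (meson trans_le_add1)
    let ?sm = "\<lambda>j. smoothing (real j * \<rho>) (w \<beta>)"
    have sm: "lux (K * (a * b)) (\<lambda>x. cf j * ?sm j x)" if j: "j \<in> {1..n}" for j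
    proof -
      have r: "0 < real j * \<rho>" "real j * \<rho> \<le> 1" "1 / (real j * \<rho>) \<le> real n * (1 / \<delta>)"
      proof -
        show "0 < real j * \<rho>" using j \<rho> by simp
        have "real j * \<rho> \<le> real n * \<rho>" using j \<rho> by (intro mult_right_mono) auto
        also have "\<dots> = \<delta>" using n by (simp add: \<rho>_def)
        finally show "real j * \<rho> \<le> 1" using \<delta> by simp
        have "1 * \<rho> \<le> real j * \<rho>" using j \<rho> by (intro mult_right_mono) auto
        then have "1 / (real j * \<rho>) \<le> 1 / \<rho>" using \<rho> by (intro divide_left_mono) auto
        also have "\<dots> = real n * (1 / \<delta>)" by (simp add: \<rho>_def)
        finally show "1 / (real j * \<rho>) \<le> real n * (1 / \<delta>)" .
      qed
      have pw: "(1 / (real j * \<rho>)) ^ e \<le> real n ^ e * (1 / \<delta>) ^ e" for e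
        unfolding power_mult_distrib[symmetric] by (rule power_mono[OF r(3)]) (use r(1) in simp)
      have ne: "real n ^ (q + k) \<le> real n ^ (q + k + ?d)" using n by (intro power_increasing) auto
      have 1: "A * (1 / (real j * \<rho>)) ^ (q + k) * \<epsilon> \<le> a"
      proof -
        have "(1 / (real j * \<rho>)) ^ (q + k) \<le> real n ^ (q + k + ?d) * (1 / \<delta>) ^ (q + k)"
          by (rule order_trans[OF pw mult_right_mono[OF ne]]) (use \<delta> in simp)
        then have "A * (1 / (real j * \<rho>)) ^ (q + k) * \<epsilon> \<le> A * (real n ^ (q + k + ?d) * (1 / \<delta>) ^ (q + k)) * \<epsilon>"
          using A \<epsilon> by (intro mult_right_mono mult_left_mono) auto
        then show ?thesis by (simp add: a_def mult.assoc)
      qed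
      have 2: "A * (1 / (real j * \<rho>)) ^ (q + k) * (1 / (real j * \<rho>)) ^ ?d * \<epsilon> \<le> a * (1 / \<delta>) ^ ?d"
      proof -
        have "A * (1 / (real j * \<rho>)) ^ (q + k + ?d) * \<epsilon> \<le> A * (real n ^ (q + k + ?d) * (1 / \<delta>) ^ (q + k + ?d)) * \<epsilon>"
          using A \<epsilon> by (intro mult_right_mono mult_left_mono pw) auto
        then show ?thesis by (simp only: a_def power_add mult_ac)
      qed
      have "mi_order \<beta> \<le> q + n" using \<beta> by simp
      then have hw: "has_weak_deriv \<beta> h (w \<beta>)" using w by blast
      note S = Ab[OF h T less_imp_le[OF \<epsilon>] \<beta> hw r(1,2)]
      have "lux (a * b) (?sm j)"
      proof (rule lux_interpolation[of _ a "(1 / \<delta>) ^ ?d" b])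
        show "?sm j \<in> borel_measurable borel" using S by blast
        show "(\<integral>\<^sup>+x. ennreal \<bar>?sm j x\<bar> \<partial>lborel) \<le> ennreal a"
          using S ennreal_leI[OF 1] by (blast intro: order_trans)
        show "\<bar>?sm j x\<bar> \<le> a * (1 / \<delta>) ^ ?d" for x
          using S 2 by (blast intro: order_trans)
      qed (use b a \<delta> in auto)
      then show ?thesis by (rule lux_cmult) (use cfK j K in auto)
    qed
    have "lux (\<Sum>j\<in>{1..n}. K * (a * b)) (\<lambda>x. \<Sum>j\<in>{1..n}. cf j * ?sm j x)"
      by (rule lux_sum[OF _ _ sm]) (use n in auto)
    then have S: "lux (real n * (K * (a * b))) (\<lambda>x. \<Sum>j\<in>{1..n}. cf j * ?sm j x)" by simp
    have E: "lux ((real ?d * \<rho>) ^ n * c) (\<lambda>x. \<Sum>j\<le>n. cf j * ?sm j x)"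
      by (rule smoothing_error[OF deriv_familyI _ \<rho> \<beta> cf(2)]) (use w in auto)
    have "{..n} = insert 0 {1..n}" by auto
    then have "(\<Sum>j\<le>n. cf j * ?sm j x) - (\<Sum>j\<in>{1..n}. cf j * ?sm j x) = w \<beta> x" for x
      using cf(1) by (simp add: smoothing_zero)
    then have L: "lux ((real ?d * \<rho>) ^ n * c + real n * (K * (a * b))) (w \<beta>)"
      using lux_diff[OF E S] by simp
    show ?thesis
    proof (rule lux_mono[OF L])
      have "(real ?d * \<rho>) ^ n \<le> (real ?d * \<delta>) ^ n"
        using \<delta> n by (intro power_mono mult_left_mono) (auto simp: \<rho>_def field_simps)
      then have "(real ?d * \<rho>) ^ n * c \<le> real ?d ^ n * \<delta> ^ n * c"
        using c by (intro mult_right_mono) (auto simp: power_mult_distrib)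
      moreover have "0 \<le> real n * K * A * real n ^ (q + k + ?d) * (\<delta> ^ n * c)"
        "0 \<le> real ?d ^ n * ((1 / \<delta>) ^ (q + k) * b * \<epsilon>)"
        using K A \<delta> c b \<epsilon> by auto
      moreover have "real n * (K * (a * b)) = real n * K * A * real n ^ (q + k + ?d) * ((1 / \<delta>) ^ (q + k) * b * \<epsilon>)"
        by (simp only: a_def mult_ac)
      ultimately show "(real ?d * \<rho>) ^ n * c + real n * (K * (a * b))
          \<le> A' * (\<delta> ^ n * c + (1 / \<delta>) ^ (q + k) * b * \<epsilon>)"
        unfolding A'_def by (simp only: distrib_left distrib_right mult_ac)
    qed
  qed
  then show ?thesis using A' by (intro exI[of _ A'] conjI allI impI) blast+
qed

text \<open>A sequence whose derivatives up to order \<open>q\<close> have summable increments converges together with its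
  weak derivatives.\<close>
lemma limit_of_chain:
  fixes F :: "nat \<Rightarrow> real^'d::finite \<Rightarrow> real"
  assumes D: "\<And>j \<beta>. mi_order \<beta> \<le> q \<Longrightarrow> has_weak_deriv \<beta> (F j) (V j \<beta>)"
    and e: "\<And>j \<beta>. mi_order \<beta> \<le> q \<Longrightarrow> lux (e j) (\<lambda>x. V (Suc j) \<beta> x - V j \<beta> x)" "summable e"
  obtains G where "\<And>\<beta>. mi_order \<beta> \<le> q \<Longrightarrow> has_weak_deriv \<beta> (G (\<lambda>_. 0)) (G \<beta>)"
    "\<And>\<beta>. mi_order \<beta> \<le> q \<Longrightarrow> lux (suminf e) (\<lambda>x. G \<beta> x - V 0 \<beta> x)"
    "\<And>\<phi>. test_function \<phi> \<Longrightarrow> (\<lambda>j. \<integral>x. F j x * \<phi> x \<partial>lborel) \<longlonglongrightarrow> (\<integral>x. G (\<lambda>_. 0) x * \<phi> x \<partial>lborel)"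
proof -
  define u where "u \<beta> j x = V (Suc j) \<beta> x - V j \<beta> x" for \<beta> j x
  define G where "G \<beta> x = V 0 \<beta> x + (\<Sum>j. u \<beta> j x)" for \<beta> x
  have z: "mi_order (\<lambda>_::'d. 0) \<le> q" by (simp add: mi_order_def)
  have Vl: "locally_integrable (V j \<beta>)" if "mi_order \<beta> \<le> q" for j \<beta>
    using D[OF that] by (simp add: has_weak_deriv_def)
  have lu: "lux (e j) (u \<beta> j)" if "mi_order \<beta> \<le> q" for j \<beta>
    using e(1)[OF that, of j] unfolding u_def[abs_def] .
  note ser = lux_series[OF lu e(2)]
  have Gl: "locally_integrable (G \<beta>)" if "mi_order \<beta> \<le> q" for \<beta>
    unfolding G_def[abs_def]
    by (intro locally_integrable_add Vl lux_locally_integrable[OF ser(3)] that)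
  have conv: "(\<lambda>j. \<integral>x. V j \<beta> x * \<phi> x \<partial>lborel) \<longlonglongrightarrow> (\<integral>x. G \<beta> x * \<phi> x \<partial>lborel)"
    if \<beta>: "mi_order \<beta> \<le> q" and \<phi>: "test_function \<phi>" for \<beta> \<phi>
  proof -
    obtain M R where MR: "\<And>x. \<bar>\<phi> x\<bar> \<le> M" "\<And>x. R < norm x \<Longrightarrow> \<phi> x = 0"
      by (rule test_function_bounded_support[OF \<phi>]) blast
    have m\<phi>[measurable]: "\<phi> \<in> borel_measurable borel" using \<phi> smooth_measurable by (auto simp: test_function_def)
    note [measurable] = locally_integrable_measurable[OF Vl[OF \<beta>]] locally_integrable_measurable[OF Gl[OF \<beta>]]
    let ?W = "\<lambda>x. \<bar>V 0 \<beta> x\<bar> + (\<Sum>j. \<bar>u \<beta> j x\<bar>)"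
    have "locally_integrable (\<lambda>x. \<bar>V 0 \<beta> x\<bar>)"
      using Vl[OF \<beta>, of 0] unfolding locally_integrable_def by (auto intro: set_integrable_abs)
    then have Wl: "locally_integrable ?W"
      by (intro locally_integrable_add lux_locally_integrable[OF ser(2)[OF \<beta>]])
    have tel: "V n \<beta> x = V 0 \<beta> x + (\<Sum>j<n. u \<beta> j x)" for n x
      by (induction n) (auto simp: u_def)
    show ?thesis
    proof (rule integral_dominated_convergence[where w="\<lambda>x. ?W x * \<bar>\<phi> x\<bar>"])
      show "integrable lborel (\<lambda>x. ?W x * \<bar>\<phi> x\<bar>)"
        by (rule integrable_locally_integrable_mult[OF Wl, of _ M R]) (use MR in auto)
      show "AE x in lborel. (\<lambda>j. V j \<beta> x * \<phi> x) \<longlonglongrightarrow> G \<beta> x * \<phi> x"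
        using ser(1)[OF \<beta>]
      proof eventually_elim
        case (elim x)
        have "(\<lambda>n. \<Sum>j<n. u \<beta> j x) \<longlonglongrightarrow> (\<Sum>j. u \<beta> j x)"
          by (rule summable_LIMSEQ[OF summable_rabs_cancel[OF elim]])
        then have "(\<lambda>n. V 0 \<beta> x + (\<Sum>j<n. u \<beta> j x)) \<longlonglongrightarrow> G \<beta> x"
          unfolding G_def by (intro tendsto_add tendsto_const)
        then have "(\<lambda>n. V n \<beta> x) \<longlonglongrightarrow> G \<beta> x" by (simp only: tel[symmetric])
        then show ?case by (intro tendsto_mult tendsto_const)
      qed
      show "AE x in lborel. norm (V n \<beta> x * \<phi> x) \<le> ?W x * \<bar>\<phi> x\<bar>" for n
        using ser(1)[OF \<beta>]
      proof eventually_elim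
        case (elim x)
        have "\<bar>V n \<beta> x\<bar> \<le> \<bar>V 0 \<beta> x\<bar> + (\<Sum>j<n. \<bar>u \<beta> j x\<bar>)"
          unfolding tel[of n] using sum_abs[of "\<lambda>j. u \<beta> j x" "{..<n}"] by linarith
        also have "\<dots> \<le> ?W x" by (intro add_left_mono sum_le_suminf elim) auto
        finally show ?case by (simp add: abs_mult mult_right_mono)
      qed
    qed measurable
  qed
  have V0: "(\<integral>x. V j (\<lambda>_. 0) x * \<phi> x \<partial>lborel) = (\<integral>x. F j x * \<phi> x \<partial>lborel)" if "test_function \<phi>" for j \<phi>
    using D[OF z, of j] that unfolding has_weak_deriv_def by (simp add: mi_order_def)
  show thesis
  proof (rule that[of G])
    show "lux (suminf e) (\<lambda>x. G \<beta> x - V 0 \<beta> x)" if "mi_order \<beta> \<le> q" for \<beta>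
      unfolding G_def using ser(3)[OF that] by simp
    show lim: "(\<lambda>j. \<integral>x. F j x * \<phi> x \<partial>lborel) \<longlonglongrightarrow> (\<integral>x. G (\<lambda>_. 0) x * \<phi> x \<partial>lborel)" if "test_function \<phi>" for \<phi>
      using conv[OF z that] unfolding V0[OF that] .
    show "has_weak_deriv \<beta> (G (\<lambda>_. 0)) (G \<beta>)" if \<beta>: "mi_order \<beta> \<le> q" for \<beta>
      unfolding has_weak_deriv_def
    proof (intro conjI allI impI Gl \<beta> z)
      fix \<phi> :: "real^'d \<Rightarrow> real" assume \<phi>: "test_function \<phi>"
      have "(\<integral>x. F j x * mpartial \<beta> \<phi> x \<partial>lborel) = (-1) ^ mi_order \<beta> * (\<integral>x. V j \<beta> x * \<phi> x \<partial>lborel)" for j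
        using D[OF \<beta>, of j] \<phi> unfolding has_weak_deriv_def by blast
      then have "(\<lambda>j. (-1) ^ mi_order \<beta> * (\<integral>x. V j \<beta> x * \<phi> x \<partial>lborel))
          \<longlonglongrightarrow> (\<integral>x. G (\<lambda>_. 0) x * mpartial \<beta> \<phi> x \<partial>lborel)"
        using lim[OF test_function_mpartial[OF \<phi>], of \<beta>] by simp
      moreover have "(\<lambda>j. (-1) ^ mi_order \<beta> * (\<integral>x. V j \<beta> x * \<phi> x \<partial>lborel))
          \<longlonglongrightarrow> (-1) ^ mi_order \<beta> * (\<integral>x. G \<beta> x * \<phi> x \<partial>lborel)"
        by (intro tendsto_mult tendsto_const conv[OF \<beta> \<phi>])
      ultimately show "(\<integral>x. G (\<lambda>_. 0) x * mpartial \<beta> \<phi> x \<partial>lborel) = (-1) ^ mi_order \<beta> * (\<integral>x. G \<beta> x * \<phi> x \<partial>lborel)"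
        by (rule LIMSEQ_unique)
    qed
  qed
qed

end

section \<open>Growth functions\<close>

lemma growth_function_pos:
  assumes g: "growth_function a \<eta>" shows "0 < \<eta> (real n)"
proof (rule ccontr)
  assume "\<not> 0 < \<eta> (real n)"
  moreover have "0 \<le> \<eta> (real n)" using g by (simp add: growth_function_def)
  ultimately have 0: "\<eta> (real n) = 0" by simp
  have step: "\<eta> (real (i + 1)) \<le> a * \<eta> (real i)" "0 \<le> \<eta> (real i)" for i
    using g by (auto simp: growth_function_def)
  have z: "\<eta> (real (n + j)) = 0" for j
  proof (induction j)
    case (Suc j) then show ?case using step(1)[of "n + j"] step(2)[of "n + Suc j"] by simp
  qed (use 0 in simp)
  have "filterlim (\<lambda>n::nat. \<eta> (real n)) at_top sequentially" using g by (simp add: growth_function_def)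
  then have "\<forall>\<^sub>F i in sequentially. 1 \<le> \<eta> (real i)" by (simp add: filterlim_at_top)
  then obtain N where "\<And>i. N \<le> i \<Longrightarrow> 1 \<le> \<eta> (real i)" by (auto simp: eventually_sequentially)
  from this[of "n + N"] z[of N] show False by simp
qed

text \<open>If some value of \<open>\<eta>\<close> is below a threshold \<open>t\<close>, the first value not below it is at most \<open>a t\<close>.\<close>
lemma growth_function_next:
  assumes g: "growth_function a \<eta>" and a: "1 \<le> a" and t: "\<eta> (real n) < t"
  obtains n' where "t \<le> \<eta> (real n')" "\<eta> (real n') \<le> a * t"
proof -
  have "filterlim (\<lambda>n::nat. \<eta> (real n)) at_top sequentially" using g by (simp add: growth_function_def)
  then have "\<forall>\<^sub>F i in sequentially. t \<le> \<eta> (real i)" by (simp add: filterlim_at_top)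
  then have ex: "\<exists>i. t \<le> \<eta> (real i)" by (auto simp: eventually_sequentially)
  define n' where "n' = (LEAST i. t \<le> \<eta> (real i))"
  have n': "t \<le> \<eta> (real n')" unfolding n'_def by (rule LeastI_ex[OF ex])
  have "n' \<noteq> 0"
  proof
    assume "n' = 0"
    moreover have "\<eta> 0 \<le> \<eta> (real n)"
      using g by (intro mono_onD[of "{0..}" \<eta>]) (auto simp: growth_function_def)
    ultimately show False using n' t by simp
  qed
  then obtain l where l: "n' = l + 1" by (metis Suc_eq_plus1 not0_implies_Suc)
  have "\<not> t \<le> \<eta> (real l)" using not_less_Least[of l "\<lambda>i. t \<le> \<eta> (real i)"] l by (simp add: n'_def)
  moreover have "\<eta> (real n') \<le> a * \<eta> (real l)" using g l by (auto simp: growth_function_def)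
  ultimately have "\<eta> (real n') \<le> a * t" using mult_left_mono[of "\<eta> (real l)" t a] a by linarith
  with n' show thesis by (rule that)
qed

lemma has_weak_deriv_cong_AE:
  assumes w: "has_weak_deriv \<beta> f g" and l: "locally_integrable f'" and eq: "AE x in lborel. f' x = f x"
  shows "has_weak_deriv \<beta> f' g"
  unfolding has_weak_deriv_def
proof (intro conjI allI impI l)
  show "locally_integrable g" using w by (simp add: has_weak_deriv_def)
  fix \<phi> :: "real^'a \<Rightarrow> real" assume \<phi>: "test_function \<phi>"
  have fl: "locally_integrable f" using w by (simp add: has_weak_deriv_def)
  note [measurable] = locally_integrable_measurable[OF l] locally_integrable_measurable[OF fl]
  have [measurable]: "mpartial \<beta> \<phi> \<in> borel_measurable borel"
    using test_function_mpartial[OF \<phi>] smooth_measurable by (auto simp: test_function_def)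
  have "(\<integral>x. f' x * mpartial \<beta> \<phi> x \<partial>lborel) = (\<integral>x. f x * mpartial \<beta> \<phi> x \<partial>lborel)"
    by (intro integral_cong_AE) (use eq in auto)
  then show "(\<integral>x. f' x * mpartial \<beta> \<phi> x \<partial>lborel) = (-1) ^ mi_order \<beta> * (\<integral>x. g x * \<phi> x \<partial>lborel)"
    using w \<phi> by (simp add: has_weak_deriv_def)
qed

lemma integrable_mult_test_bound:
  assumes f: "integrable lborel f" and t: "test_bound k \<phi> D"
  shows "integrable lborel (\<lambda>x. f x * \<phi> x)"
proof (rule Bochner_Integration.integrable_bound)
  show "integrable lborel (\<lambda>x. D * f x)" using f by simp
  have "smooth \<phi>" using t by (simp add: test_bound_def)
  then have [measurable]: "\<phi> \<in> borel_measurable borel" by (rule smooth_measurable)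
  have [measurable]: "f \<in> borel_measurable borel" using f by auto
  show "(\<lambda>x. f x * \<phi> x) \<in> borel_measurable lborel" by simp
  have "\<bar>\<phi> x\<bar> \<le> D" "0 < D" for x
    using t zero_in_multi_indices[of k] unfolding test_bound_def by (metis mpartial_zero)+
  then have "\<bar>\<phi> x\<bar> * \<bar>f x\<bar> \<le> \<bar>D\<bar> * \<bar>f x\<bar>" for x by (intro mult_right_mono) (auto intro: order_trans)
  then show "AE x in lborel. norm (f x * \<phi> x) \<le> norm (D * f x)"
    by (intro AE_I2) (simp add: abs_mult mult.commute)
qed

context young
begin

text \<open>The abstract form of both parts of the theorem. The quantity \<open>err s\<close> is, up to a constant, what
  \<open>interpolation_step\<close> yields for the difference of two members of the sequence at the levels \<open>s\<close>
  and \<open>s' \<in> [2 s, 2 a s]\<close> of \<open>\<eta>\<close>, at the scale \<open>\<delta> = s\<^sup>-\<^sup>1\<^sup>/\<^sup>(\<^sup>\<alpha>\<^sup>m\<^sup>)\<close>. The assumption \<open>series\<close> asks for the sum of these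
  errors along a chain of levels that at least double. The remaining two assumptions on the rate deal
  with the indices for which \<open>\<eta>\<close> is still below \<open>1\<close>: these are compared with the first index beyond.\<close>
theorem approximation_rate:
  fixes k q m :: nat and a \<alpha> c0 K :: real and b rate :: "real \<Rightarrow> real"
  defines "err \<equiv> \<lambda>s. s powr (- (1 / \<alpha>)) + (s powr (1 / (\<alpha> * real m))) ^ (q + k) * b s / s"
  assumes m: "1 \<le> m" and a: "1 \<le> a" and \<alpha>: "0 < \<alpha>" and c0: "0 < c0" and K: "0 < K"
    and b: "\<And>s. 1 \<le> s \<Longrightarrow> 0 < b s \<and>
      \<Phi> ((s powr (1 / (\<alpha> * real m))) ^ CARD('d::finite) / b s) \<le> (s powr (1 / (\<alpha> * real m))) ^ CARD('d)"
    and series: "\<And>\<sigma> :: nat \<Rightarrow> real. 1 \<le> \<sigma> 0 \<Longrightarrow> (\<And>j. 2 * \<sigma> j \<le> \<sigma> (Suc j) \<and> \<sigma> (Suc j) \<le> 2 * a * \<sigma> j) \<Longrightarrow>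
      summable (\<lambda>j. err (\<sigma> j)) \<and> (\<Sum>j. err (\<sigma> j)) \<le> K * rate (\<sigma> 0)"
    and small: "\<And>s. 0 < s \<Longrightarrow> s < 1 \<Longrightarrow> 1 \<le> rate s"
    and mid: "\<And>s. 1 \<le> s \<Longrightarrow> s \<le> a \<Longrightarrow> rate s \<le> K"
  shows "\<exists>C>0. \<forall>\<eta> (f :: nat \<Rightarrow> real^'d \<Rightarrow> real) \<mu> W.
    growth_function a \<eta> \<longrightarrow> finite_signed_measure \<mu> \<longrightarrow> (\<forall>n. integrable lborel (f n)) \<longrightarrow>
    (\<forall>n \<beta>. mi_order \<beta> \<le> q + 2 * m \<longrightarrow> has_weak_deriv \<beta> (f n) (W n \<beta>) \<and>
      lux (c0 * max 1 (\<eta> (real n) powr (1 / \<alpha>))) (W n \<beta>)) \<longrightarrow>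
    (\<forall>n. dist_k k \<mu> (density_sm (f n)) \<le> ennreal (1 / \<eta> (real n))) \<longrightarrow>
    (\<exists>g G. has_density \<mu> g \<and> (\<forall>\<beta>. mi_order \<beta> \<le> q \<longrightarrow> has_weak_deriv \<beta> g (G \<beta>) \<and>
      (\<forall>n. lux (C * rate (\<eta> (real n))) (\<lambda>x. G \<beta> x - W n \<beta> x))))"
proof -
  let ?card = "real (card (multi_indices k :: ('d \<Rightarrow> nat) set))"
  have card: "0 < ?card" using multi_indices_card_pos by simp
  obtain A where A: "0 < A" and step: "\<And>(h :: real^'d \<Rightarrow> real) w c \<epsilon> \<delta> b \<beta>. integrable lborel h \<Longrightarrow>
      \<forall>\<phi> D. test_bound k \<phi> D \<longrightarrow> \<bar>\<integral>y. h y * \<phi> y \<partial>lborel\<bar> \<le> D * \<epsilon> \<Longrightarrow> 0 < \<epsilon> \<Longrightarrow>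
      \<forall>\<beta>. mi_order \<beta> \<le> q + 2 * m \<longrightarrow> has_weak_deriv \<beta> h (w \<beta>) \<and> lux c (w \<beta>) \<Longrightarrow>
      0 < \<delta> \<Longrightarrow> \<delta> \<le> 1 \<Longrightarrow> 0 < b \<Longrightarrow> \<Phi> ((1 / \<delta>) ^ CARD('d) / b) \<le> (1 / \<delta>) ^ CARD('d) \<Longrightarrow>
      mi_order \<beta> \<le> q \<Longrightarrow> lux (A * (\<delta> ^ (2 * m) * c + (1 / \<delta>) ^ (q + k) * b * \<epsilon>)) (w \<beta>)"
    using interpolation_step[where 'd='d, of "2 * m" k q] m by auto
  \<comment> \<open>\<open>B\<close> collects the constants of a single step: the bounds of the derivatives at the levels \<open>s\<close>
    and \<open>s' \<le> 2 a s\<close>, and the distances at the two levels\<close>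
  define B where "B = c0 * (1 + (2 * a) powr (1 / \<alpha>)) + 2 * ?card"
  have B: "0 < B" using c0 card by (simp add: B_def add_pos_pos add_pos_nonneg)
  define C where "C = A * B * K + A * B * K * K + c0 * a powr (1 / \<alpha>) + c0"
  have C: "0 < C" using A B K c0 by (simp add: C_def add_pos_pos add_pos_nonneg)
  have "\<exists>g G. has_density \<mu> g \<and> (\<forall>\<beta>. mi_order \<beta> \<le> q \<longrightarrow> has_weak_deriv \<beta> g (G \<beta>) \<and>
      (\<forall>n. lux (C * rate (\<eta> (real n))) (\<lambda>x. G \<beta> x - W n \<beta> x)))"
    if g: "growth_function a \<eta>" and \<mu>: "finite_signed_measure \<mu>" and f: "\<forall>n. integrable lborel (f n)"
      and W: "\<forall>n \<beta>. mi_order \<beta> \<le> q + 2 * m \<longrightarrow> has_weak_deriv \<beta> (f n) (W n \<beta>) \<and>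
        lux (c0 * max 1 (\<eta> (real n) powr (1 / \<alpha>))) (W n \<beta>)"
      and d: "\<forall>n. dist_k k \<mu> (density_sm (f n)) \<le> ennreal (1 / \<eta> (real n))"
    for \<eta> and f :: "nat \<Rightarrow> real^'d \<Rightarrow> real" and \<mu> W
  proof -
    let ?e = "\<lambda>n. \<eta> (real n)"
    have pos: "0 < ?e n" for n by (rule growth_function_pos[OF g])
    have test: "\<bar>signed_integral \<mu> \<phi> - (\<integral>x. f n x * \<phi> x \<partial>lborel)\<bar> \<le> ?card * D * (1 / ?e n)"
      if "test_bound k \<phi> D" for n \<phi> D
      by (rule dist_k_test[OF _ _ _ that]) (use d f pos in \<open>auto intro: less_imp_le\<close>)
    have Wd: "has_weak_deriv \<beta> (f n) (W n \<beta>)" if "mi_order \<beta> \<le> q" for n \<beta> using W that by (meson trans_le_add1)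
    have pair: "lux (A * B * err (?e n)) (\<lambda>x. W n' \<beta> x - W n \<beta> x)"
      if s: "1 \<le> ?e n" "2 * ?e n \<le> ?e n'" "?e n' \<le> 2 * a * ?e n" and \<beta>: "mi_order \<beta> \<le> q" for n n' \<beta>
    proof -
      let ?s = "?e n"
      let ?\<delta> = "?s powr (- (1 / (\<alpha> * real m)))"
      let ?h = "\<lambda>x. f n' x - f n x" and ?w = "\<lambda>\<beta> x. W n' \<beta> x - W n \<beta> x"
      let ?c = "c0 * (1 + (2 * a) powr (1 / \<alpha>)) * ?s powr (1 / \<alpha>)"
      let ?\<epsilon> = "2 * ?card / ?s"
      have inv: "1 / ?\<delta> = ?s powr (1 / (\<alpha> * real m))" using pos[of n] by (simp add: powr_minus_divide)
      have L: "lux (A * (?\<delta> ^ (2 * m) * ?c + (1 / ?\<delta>) ^ (q + k) * b ?s * ?\<epsilon>)) (?w \<beta>)"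
      proof (rule step[of ?h])
        show "integrable lborel ?h" using f by simp
        show "\<forall>\<phi> D. test_bound k \<phi> D \<longrightarrow> \<bar>\<integral>y. ?h y * \<phi> y \<partial>lborel\<bar> \<le> D * ?\<epsilon>"
        proof (intro allI impI)
          fix \<phi> :: "real^'d \<Rightarrow> real" and D assume t: "test_bound k \<phi> D"
          have D: "0 < D" using t by (simp add: test_bound_def)
          have "(\<integral>y. ?h y * \<phi> y \<partial>lborel) = (\<integral>y. f n' y * \<phi> y \<partial>lborel) - (\<integral>y. f n y * \<phi> y \<partial>lborel)"
            using integrable_mult_test_bound[OF _ t] f by (simp add: left_diff_distrib)
          then have "\<bar>\<integral>y. ?h y * \<phi> y \<partial>lborel\<bar> \<le> ?card * D * (1 / ?e n) + ?card * D * (1 / ?e n')"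
            using test[OF t, of n] test[OF t, of n'] by linarith
          moreover have "?card * D * (1 / ?e n') \<le> ?card * D * (1 / ?e n)"
            using s pos[of n] pos[of n'] card D by (intro mult_left_mono frac_le) auto
          moreover have "D * ?\<epsilon> = ?card * D * (1 / ?e n) + ?card * D * (1 / ?e n)" by simp
          ultimately show "\<bar>\<integral>y. ?h y * \<phi> y \<partial>lborel\<bar> \<le> D * ?\<epsilon>" by linarith
        qed
        show "0 < ?\<epsilon>" using card pos by simp
        show "\<forall>\<beta>. mi_order \<beta> \<le> q + 2 * m \<longrightarrow> has_weak_deriv \<beta> ?h (?w \<beta>) \<and> lux ?c (?w \<beta>)"
        proof (intro allI impI conjI)
          fix \<beta> :: "'d \<Rightarrow> nat" assume \<beta>: "mi_order \<beta> \<le> q + 2 * m"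
          show "has_weak_deriv \<beta> ?h (?w \<beta>)" using W \<beta> by (intro has_weak_deriv_diff) auto
          have "?s powr (1 / \<alpha>) \<ge> 1" using s(1) \<alpha> by (intro ge_one_powr_ge_zero) auto
          then have 1: "max 1 (?s powr (1 / \<alpha>)) = ?s powr (1 / \<alpha>)" by simp
          have "?e n' powr (1 / \<alpha>) \<ge> 1" using s \<alpha> by (intro ge_one_powr_ge_zero) auto
          moreover have "?e n' powr (1 / \<alpha>) \<le> (2 * a * ?s) powr (1 / \<alpha>)"
            using s pos[of n'] \<alpha> by (intro powr_mono2) auto
          moreover have "(2 * a * ?s) powr (1 / \<alpha>) = (2 * a) powr (1 / \<alpha>) * ?s powr (1 / \<alpha>)"
            using a pos[of n] by (simp add: powr_mult)
          ultimately have 2: "max 1 (?e n' powr (1 / \<alpha>)) \<le> (2 * a) powr (1 / \<alpha>) * ?s powr (1 / \<alpha>)" by simp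
          have "lux (c0 * max 1 (?e n' powr (1 / \<alpha>)) + c0 * max 1 (?s powr (1 / \<alpha>))) (?w \<beta>)"
            by (rule lux_diff) (use W \<beta> in auto)
          then show "lux ?c (?w \<beta>)"
          proof (rule lux_mono)
            have "c0 * max 1 (?e n' powr (1 / \<alpha>)) \<le> c0 * ((2 * a) powr (1 / \<alpha>) * ?s powr (1 / \<alpha>))"
              by (rule mult_left_mono[OF 2]) (use c0 in simp)
            then show "c0 * max 1 (?e n' powr (1 / \<alpha>)) + c0 * max 1 (?s powr (1 / \<alpha>)) \<le> ?c"
              unfolding 1 by (simp add: algebra_simps)
          qed
        qed
        show "0 < ?\<delta>" using pos[of n] by simp
        show "?\<delta> \<le> 1" using powr_mono[of "- (1 / (\<alpha> * real m))" 0 ?s] s(1) \<alpha> by simp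
        show "0 < b ?s" "\<Phi> ((1 / ?\<delta>) ^ CARD('d) / b ?s) \<le> (1 / ?\<delta>) ^ CARD('d)"
          unfolding inv using b[OF s(1)] by auto
      qed (rule \<beta>)
      show ?thesis
      proof (rule lux_mono[OF L])
        have "?\<delta> ^ (2 * m) * ?s powr (1 / \<alpha>) = ?s powr (- (1 / \<alpha>))"
        proof -
          have "?\<delta> ^ (2 * m) = ?s powr (- (2 / \<alpha>))"
            using pos[of n] m \<alpha> by (simp add: powr_powr flip: powr_realpow)
          then show ?thesis by (simp flip: powr_add add: field_simps)
        qed
        then have 1: "?\<delta> ^ (2 * m) * ?c = (c0 * (1 + (2 * a) powr (1 / \<alpha>))) * ?s powr (- (1 / \<alpha>))"
          by (simp add: mult_ac)
        have 2: "(1 / ?\<delta>) ^ (q + k) * b ?s * ?\<epsilon> = 2 * ?card * ((1 / ?\<delta>) ^ (q + k) * b ?s / ?s)" by simp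
        let ?x = "?s powr (- (1 / \<alpha>))" and ?y = "(1 / ?\<delta>) ^ (q + k) * b ?s / ?s"
        have xy: "0 \<le> ?x" "0 \<le> ?y" using b[OF s(1)] pos[of n] by auto
        have c1: "0 \<le> c0 * (1 + (2 * a) powr (1 / \<alpha>))" using c0 by simp
        have "(c0 * (1 + (2 * a) powr (1 / \<alpha>))) * ?x + 2 * ?card * ?y \<le> B * ?x + B * ?y"
          by (intro add_mono mult_right_mono xy) (use c1 card in \<open>auto simp: B_def\<close>)
        then have "?\<delta> ^ (2 * m) * ?c + (1 / ?\<delta>) ^ (q + k) * b ?s * ?\<epsilon> \<le> B * (?x + ?y)"
          unfolding 1 2 distrib_left[of B ?x ?y] .
        then have "A * (?\<delta> ^ (2 * m) * ?c + (1 / ?\<delta>) ^ (q + k) * b ?s * ?\<epsilon>) \<le> A * (B * (?x + ?y))"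
          using A by (intro mult_left_mono) auto
        then show "A * (?\<delta> ^ (2 * m) * ?c + (1 / ?\<delta>) ^ (q + k) * b ?s * ?\<epsilon>) \<le> A * B * err ?s"
          unfolding err_def inv by (simp add: mult.assoc)
      qed
    qed
    have limit: "\<exists>G. (\<forall>\<beta>. mi_order \<beta> \<le> q \<longrightarrow> has_weak_deriv \<beta> (G (\<lambda>_. 0)) (G \<beta>) \<and>
        lux (A * B * K * rate (?e n)) (\<lambda>x. G \<beta> x - W n \<beta> x)) \<and>
        (\<forall>u. (\<forall>i. u i \<in> bumps) \<longrightarrow> signed_integral \<mu> (tensor u) = (\<integral>x. G (\<lambda>_. 0) x * tensor u x \<partial>lborel))"
      if n: "1 \<le> ?e n" for n
    proof -
      \<comment> \<open>a chain of indices along which \<open>\<eta>\<close> at least doubles and grows at most by the factor \<open>2 a\<close>\<close>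
      have "\<exists>N. \<forall>j. (1 \<le> ?e (N j) \<and> (j = 0 \<longrightarrow> N j = n)) \<and> (2 * ?e (N j) \<le> ?e (N (Suc j)) \<and> ?e (N (Suc j)) \<le> 2 * a * ?e (N j))"
      proof (rule dependent_nat_choice)
        show "\<exists>x. 1 \<le> ?e x \<and> (0 = (0::nat) \<longrightarrow> x = n)" using n by blast
        fix x and j :: nat assume x: "1 \<le> ?e x \<and> (j = 0 \<longrightarrow> x = n)"
        then have "?e x < 2 * ?e x" by simp
        from growth_function_next[OF g a this] obtain y where "2 * ?e x \<le> ?e y" "?e y \<le> a * (2 * ?e x)" .
        then show "\<exists>y. (1 \<le> ?e y \<and> (Suc j = 0 \<longrightarrow> y = n)) \<and> 2 * ?e x \<le> ?e y \<and> ?e y \<le> 2 * a * ?e x"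
          using x by (intro exI[of _ y]) (auto simp: mult_ac)
      qed
      then obtain N where N: "\<And>j. 1 \<le> ?e (N j)" "N 0 = n"
        "\<And>j. 2 * ?e (N j) \<le> ?e (N (Suc j))" "\<And>j. ?e (N (Suc j)) \<le> 2 * a * ?e (N j)" by blast
      have ser: "summable (\<lambda>j. err (?e (N j)))" "(\<Sum>j. err (?e (N j))) \<le> K * rate (?e n)"
        using series[of "\<lambda>j. ?e (N j)"] N by auto
      let ?E = "\<lambda>j. A * B * err (?e (N j))"
      have sE: "summable ?E" by (rule summable_mult[OF ser(1)])
      have Em: "suminf ?E \<le> A * B * K * rate (?e n)"
        using mult_left_mono[OF ser(2), of "A * B"] A B ser(1) by (simp add: suminf_mult mult.assoc)
      obtain G where G: "\<And>\<beta>. mi_order \<beta> \<le> q \<Longrightarrow> has_weak_deriv \<beta> (G (\<lambda>_. 0)) (G \<beta>)"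
        "\<And>\<beta>. mi_order \<beta> \<le> q \<Longrightarrow> lux (suminf ?E) (\<lambda>x. G \<beta> x - W (N 0) \<beta> x)"
        "\<And>\<phi>. test_function \<phi> \<Longrightarrow> (\<lambda>j. \<integral>x. f (N j) x * \<phi> x \<partial>lborel) \<longlonglongrightarrow> (\<integral>x. G (\<lambda>_. 0) x * \<phi> x \<partial>lborel)"
      proof (rule limit_of_chain[of q "\<lambda>j. f (N j)" "\<lambda>j. W (N j)" ?E])
        show "has_weak_deriv \<beta> (f (N j)) (W (N j) \<beta>)" if "mi_order \<beta> \<le> q" for j \<beta>
          by (rule Wd[OF that])
        show "lux (?E j) (\<lambda>x. W (N (Suc j)) \<beta> x - W (N j) \<beta> x)" if "mi_order \<beta> \<le> q" for j \<beta>
          by (rule pair[OF N(1,3,4) that])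
      qed (rule sE, rule that)
      have "2 ^ j \<le> ?e (N j)" for j
      proof (induction j)
        case (Suc j) then show ?case using N(3)[of j] by simp
      qed (use N(1)[of 0] in simp)
      then have inv: "1 / ?e (N j) \<le> (1 / 2) ^ j" for j
        using frac_le[of 1 1 "2 ^ j" "?e (N j)"] by (simp add: power_one_over)
      have "signed_integral \<mu> (tensor u) = (\<integral>x. G (\<lambda>_. 0) x * tensor u x \<partial>lborel)" if u: "\<forall>i. u i \<in> bumps" for u
      proof -
        obtain D where D: "test_bound k (tensor u) D" by (rule tensor_test_bound[OF u]) blast
        have D0: "0 < D" using D by (simp add: test_bound_def)
        have "(\<lambda>j. signed_integral \<mu> (tensor u) - (\<integral>x. f (N j) x * tensor u x \<partial>lborel)) \<longlonglongrightarrow> 0"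
        proof (rule tendsto_rabs_zero_cancel, rule tendsto_sandwich[OF _ _ tendsto_const])
          show "(\<lambda>j. ?card * D * (1 / 2) ^ j) \<longlonglongrightarrow> 0"
            by (intro tendsto_mult_right_zero LIMSEQ_power_zero) simp
          have "\<bar>signed_integral \<mu> (tensor u) - (\<integral>x. f (N j) x * tensor u x \<partial>lborel)\<bar> \<le> ?card * D * (1 / 2) ^ j" for j
            by (rule order_trans[OF test[OF D] mult_left_mono[OF inv]]) (use card D0 in auto)
          then show "\<forall>\<^sub>F j in sequentially. \<bar>signed_integral \<mu> (tensor u) - (\<integral>x. f (N j) x * tensor u x \<partial>lborel)\<bar>
              \<le> ?card * D * (1 / 2) ^ j" by simp
        qed simp
        moreover have "(\<lambda>j. signed_integral \<mu> (tensor u) - (\<integral>x. f (N j) x * tensor u x \<partial>lborel))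
            \<longlonglongrightarrow> signed_integral \<mu> (tensor u) - (\<integral>x. G (\<lambda>_. 0) x * tensor u x \<partial>lborel)"
          by (intro tendsto_diff tendsto_const G(3) test_function_tensor u)
        ultimately show ?thesis using LIMSEQ_unique by fastforce
      qed
      then show ?thesis using G(1) lux_mono[OF G(2) Em] unfolding N(2) by blast
    qed
    have z: "mi_order (\<lambda>_::'d. 0) \<le> q" by (simp add: mi_order_def)
    \<comment> \<open>the limit is taken along the chain that starts at \<open>n0\<close>; chains that start elsewhere have the same
      limit, because \<open>\<mu>\<close> determines it\<close>
    obtain n0 where n0: "1 \<le> ?e n0" "(\<exists>n. ?e n < 1) \<longrightarrow> ?e n0 \<le> a"
    proof (cases "\<exists>n. ?e n < 1")
      case True
      then obtain n where "?e n < 1" by blast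
      from growth_function_next[OF g a this] that show ?thesis by auto
    next
      case False
      show ?thesis
      proof (rule that[of 0])
        show "1 \<le> ?e 0" using False not_less by blast
      qed (use False in blast)
    qed
    obtain G where G: "\<And>\<beta>. mi_order \<beta> \<le> q \<Longrightarrow> has_weak_deriv \<beta> (G (\<lambda>_. 0)) (G \<beta>)"
        "\<And>\<beta>. mi_order \<beta> \<le> q \<Longrightarrow> lux (A * B * K * rate (?e n0)) (\<lambda>x. G \<beta> x - W n0 \<beta> x)"
        "\<And>u. \<forall>i. u i \<in> bumps \<Longrightarrow> signed_integral \<mu> (tensor u) = (\<integral>x. G (\<lambda>_. 0) x * tensor u x \<partial>lborel)"
      using limit[OF n0(1)] by blast
    have G0l: "locally_integrable (G (\<lambda>_. 0))" using G(1)[OF z] by (simp add: has_weak_deriv_def)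
    have "lux (C * rate (?e n)) (\<lambda>x. G \<beta> x - W n \<beta> x)" if \<beta>: "mi_order \<beta> \<le> q" for n \<beta>
    proof (cases "1 \<le> ?e n")
      case True
      obtain G' where G': "\<And>\<beta>. mi_order \<beta> \<le> q \<Longrightarrow> has_weak_deriv \<beta> (G' (\<lambda>_. 0)) (G' \<beta>)"
        "\<And>\<beta>. mi_order \<beta> \<le> q \<Longrightarrow> lux (A * B * K * rate (?e n)) (\<lambda>x. G' \<beta> x - W n \<beta> x)"
        "\<And>u. \<forall>i. u i \<in> bumps \<Longrightarrow> signed_integral \<mu> (tensor u) = (\<integral>x. G' (\<lambda>_. 0) x * tensor u x \<partial>lborel)"
        using limit[OF True] by blast
      have "locally_integrable (G' (\<lambda>_. 0))" using G'(1)[OF z] by (simp add: has_weak_deriv_def)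
      then have "AE x in lborel. G (\<lambda>_. 0) x = G' (\<lambda>_. 0) x"
        by (rule AE_eq_if_tensor_integrals_eq[OF G0l]) (use G(3) G'(3) in auto)
      then have "has_weak_deriv \<beta> (G (\<lambda>_. 0)) (G' \<beta>)" by (rule has_weak_deriv_cong_AE[OF G'(1)[OF \<beta>] G0l])
      from has_weak_deriv_unique[OF G(1)[OF \<beta>] this]
      have eq: "AE x in lborel. G \<beta> x - W n \<beta> x = G' \<beta> x - W n \<beta> x" by eventually_elim simp
      have lG: "locally_integrable (G \<beta>)" "locally_integrable (W n \<beta>)"
        using G(1)[OF \<beta>] Wd[OF \<beta>] by (auto simp: has_weak_deriv_def)
      note [measurable] = lG[THEN locally_integrable_measurable]
      have L: "lux (A * B * K * rate (?e n)) (\<lambda>x. G \<beta> x - W n \<beta> x)"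
        by (rule lux_AE_cong[OF G'(2)[OF \<beta>] _ eq]) measurable
      have "0 < A * B * K * rate (?e n)" by (rule lux_pos[OF L])
      then have "0 < rate (?e n)" by (rule zero_less_mult_pos) (use A B K in simp)
      then have "A * B * K * rate (?e n) \<le> C * rate (?e n)"
        using A B K c0 by (intro mult_right_mono) (auto simp: C_def)
      then show ?thesis by (rule lux_mono[OF L])
    next
      case False
      then have n1: "?e n < 1" by simp
      then have ea: "?e n0 \<le> a" using n0(2) by blast
      have \<beta>': "mi_order \<beta> \<le> q + 2 * m" using \<beta> by simp
      have L: "lux (A * B * K * rate (?e n0) + c0 * max 1 (?e n0 powr (1 / \<alpha>)) + c0 * max 1 (?e n powr (1 / \<alpha>)))
          (\<lambda>x. (G \<beta> x - W n0 \<beta> x) + W n0 \<beta> x - W n \<beta> x)"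
        by (rule lux_diff[OF lux_add[OF G(2)[OF \<beta>]]]) (use W \<beta>' in auto)
      have 1: "A * B * K * rate (?e n0) \<le> A * B * K * K"
        using mid[OF n0(1) ea] A B K by (intro mult_left_mono) auto
      have "max 1 (?e n0 powr (1 / \<alpha>)) = ?e n0 powr (1 / \<alpha>)"
        using n0(1) \<alpha> ge_one_powr_ge_zero[of "?e n0" "1 / \<alpha>"] by simp
      also have "\<dots> \<le> a powr (1 / \<alpha>)" using ea pos[of n0] \<alpha> by (intro powr_mono2) auto
      finally have 2: "c0 * max 1 (?e n0 powr (1 / \<alpha>)) \<le> c0 * a powr (1 / \<alpha>)"
        using c0 by (intro mult_left_mono) auto
      have "?e n powr (1 / \<alpha>) \<le> 1 powr (1 / \<alpha>)" using n1 pos[of n] \<alpha> by (intro powr_mono2) auto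
      then have 3: "c0 * max 1 (?e n powr (1 / \<alpha>)) \<le> c0" using c0 by simp
      have "C \<le> C * rate (?e n)" using small[OF pos n1] C by simp
      moreover have "0 \<le> A * B * K" using A B K by simp
      ultimately have "A * B * K * rate (?e n0) + c0 * max 1 (?e n0 powr (1 / \<alpha>)) + c0 * max 1 (?e n powr (1 / \<alpha>))
          \<le> C * rate (?e n)"
        using 1 2 3 unfolding C_def by linarith
      from lux_mono[OF L this] show ?thesis by simp
    qed
    moreover have "has_density \<mu> (G (\<lambda>_. 0))" by (rule has_densityI[OF \<mu> G0l G(3)])
    ultimately show ?thesis using G(1) by blast
  qed
  then show ?thesis using C by (intro exI[of _ C] conjI allI impI) blast+
qed

end

section \<open>The two Young functions\<close>

lemma convex_on_abs:
  fixes \<phi> :: "real \<Rightarrow> real"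
  assumes c: "convex_on {0..} \<phi>" and m: "mono_on {0..} \<phi>"
  shows "convex_on UNIV (\<lambda>t. \<phi> \<bar>t\<bar>)"
proof (rule convex_onI)
  fix l x y :: real assume l: "0 < l" "l < 1"
  have "\<bar>(1 - l) *\<^sub>R x + l *\<^sub>R y\<bar> \<le> (1 - l) * \<bar>x\<bar> + l * \<bar>y\<bar>"
    using abs_triangle_ineq[of "(1 - l) * x" "l * y"] l by (simp add: abs_mult)
  then have "\<phi> \<bar>(1 - l) *\<^sub>R x + l *\<^sub>R y\<bar> \<le> \<phi> ((1 - l) * \<bar>x\<bar> + l * \<bar>y\<bar>)"
    using l by (intro mono_onD[OF m]) auto
  also have "\<dots> \<le> (1 - l) * \<phi> \<bar>x\<bar> + l * \<phi> \<bar>y\<bar>"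
    using convex_onD[OF c, of l "\<bar>x\<bar>" "\<bar>y\<bar>"] l by simp
  finally show "\<phi> \<bar>(1 - l) *\<^sub>R x + l *\<^sub>R y\<bar> \<le> (1 - l) * \<phi> \<bar>x\<bar> + l * \<phi> \<bar>y\<bar>" .
qed simp

lemma young_powr:
  assumes p: "1 \<le> p" shows "young (\<lambda>t. \<bar>t\<bar> powr p)"
proof
  have le: "l powr p \<le> l" if "0 \<le> l" "l \<le> 1" for l
    using that powr_mono'[of 1 p l] p by (cases "l = 0") auto
  have "convex_on {0..} (\<lambda>t::real. t powr p)"
  proof (rule convex_onI)
    fix l x y :: real assume l: "0 < l" "l < 1" and xy: "x \<in> {0..}" "y \<in> {0..}"
    consider "x = 0" | "y = 0" | "0 < x" "0 < y" using xy by fastforce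
    then show "((1 - l) *\<^sub>R x + l *\<^sub>R y) powr p \<le> (1 - l) * x powr p + l * y powr p"
    proof cases
      case 1 then show ?thesis using l xy p le[of l] by (simp add: powr_mult mult_right_mono)
    next
      case 2 then show ?thesis using l xy p le[of "1 - l"] by (simp add: powr_mult mult_right_mono)
    next
      case 3 then show ?thesis using convex_onD[OF powr_convex[OF p], of l x y] l by simp
    qed
  qed simp
  moreover have "mono_on {0..} (\<lambda>t::real. t powr p)"
    using p by (intro mono_onI powr_mono2) auto
  ultimately show "convex_on UNIV (\<lambda>t. \<bar>t\<bar> powr p)" by (rule convex_on_abs)
  show "\<bar>t\<bar> \<le> 1 + \<bar>t\<bar> powr p" for t
  proof (cases "\<bar>t\<bar> \<le> 1")
    case True then show ?thesis using powr_ge_zero[of "\<bar>t\<bar>" p] by linarith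
  next
    case False
    then have "\<bar>t\<bar> powr 1 \<le> \<bar>t\<bar> powr p" using p by (intro powr_mono) auto
    then show ?thesis by simp
  qed
qed (use p in auto)

lemma ln_add_one_ge: "0 \<le> t \<Longrightarrow> t \<le> (1 + t) * ln (1 + t)" for t :: real
  using ln_le_minus_one[of "1 / (1 + t)"] by (simp add: ln_div field_simps)

lemma young_e_log: "young e_log"
proof
  have "convex_on {0..} (\<lambda>t::real. (1 + t) * ln (1 + t))"
  proof (rule f''_ge0_imp_convex)
    fix t :: real assume t: "t \<in> {0..}"
    show "((\<lambda>t. (1 + t) * ln (1 + t)) has_real_derivative ln (1 + t) + 1) (at t)"
      using t by (auto intro!: derivative_eq_intros)
    show "((\<lambda>t. ln (1 + t) + 1) has_real_derivative 1 / (1 + t)) (at t)"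
      using t by (auto intro!: derivative_eq_intros)
    show "0 \<le> 1 / (1 + t)" using t by simp
  qed simp
  moreover have "mono_on {0..} (\<lambda>t::real. (1 + t) * ln (1 + t))"
    by (intro mono_onI mult_mono) auto
  ultimately have "convex_on UNIV (\<lambda>t. (1 + \<bar>t\<bar>) * ln (1 + \<bar>t\<bar>))" by (rule convex_on_abs)
  then show "convex_on UNIV e_log" by (simp add: e_log_def[abs_def])
  show "\<bar>t\<bar> \<le> 1 + e_log t" for t using ln_add_one_ge[of "\<bar>t\<bar>"] by (simp add: e_log_def)
qed (auto simp: e_log_def)

lemma e_log_le: "e_log t \<le> \<bar>t\<bar> * (1 + ln (1 + \<bar>t\<bar>))"
  using ln_add_one_self_le_self[of "\<bar>t\<bar>"] by (simp add: e_log_def algebra_simps)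

lemma lnp_nonneg: "0 \<le> lnp t"
  by (simp add: lnp_def)

lemma ln_add_one_le_lnp: "ln (1 + \<bar>t\<bar>) \<le> 1 + lnp t"
proof (cases "\<bar>t\<bar> \<le> 1")
  case True
  have "ln (1 + \<bar>t\<bar>) \<le> \<bar>t\<bar>" by (rule ln_add_one_self_le_self) simp
  then show ?thesis using True lnp_nonneg[of t] by linarith
next
  case False
  have "ln (1 + \<bar>t\<bar>) \<le> ln (2 * \<bar>t\<bar>)" using False by simp
  also have "\<dots> = ln 2 + ln \<bar>t\<bar>" using False by (simp add: ln_mult)
  also have "\<dots> \<le> 1 + lnp t" using ln_2_less_1 by (simp add: lnp_def)
  finally show ?thesis .
qed

lemma lnp_le_ln_add_one: "lnp t \<le> ln (1 + \<bar>t\<bar>)"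
  by (cases "t = 0") (auto simp: lnp_def)

text \<open>Up to \<open>\<epsilon>\<close> the term \<open>|t|\<close> is controlled by the choice of \<open>\<epsilon>\<close>, beyond \<open>\<epsilon>\<close> by the logarithm.\<close>
lemma C_star_bound:
  assumes e: "admissible_eps \<epsilon>"
  shows "\<bar>t\<bar> * (1 + lnp t) \<le> 2 * C_star \<epsilon> * e_log t" and "0 \<le> C_star \<epsilon>"
proof -
  let ?u = "\<bar>t\<bar>" and ?L = "ln (1 + \<bar>t\<bar>)"
  have \<epsilon>: "0 < \<epsilon>" using e by (simp add: admissible_eps_def)
  have L\<epsilon>: "0 < ln (1 + \<epsilon>)" using \<epsilon> by simp
  have L: "0 \<le> ?L" by simp
  have C: "C_star \<epsilon> = 2 + 1 / ln (1 + \<epsilon>)" "0 < 1 / ln (1 + \<epsilon>)" using L\<epsilon> by (auto simp: C_star_def)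
  then show "0 \<le> C_star \<epsilon>" by simp
  have E: "e_log t = ?L + ?u * ?L" by (simp add: e_log_def algebra_simps)
  have uL: "0 \<le> ?u * ?L" by simp
  have 1: "?u * lnp t \<le> ?u * ?L" by (intro mult_left_mono lnp_le_ln_add_one) simp
  show "?u * (1 + lnp t) \<le> 2 * C_star \<epsilon> * e_log t"
  proof (cases "?u \<le> \<epsilon>")
    case True
    have "?u \<le> 2 * ?L"
    proof (cases "t = 0")
      case False then show ?thesis using e True by (simp add: admissible_eps_def)
    qed simp
    then have "?u * (1 + lnp t) \<le> 2 * ?L + ?u * ?L" using 1 by (simp add: distrib_left)
    also have "\<dots> \<le> 4 * e_log t" unfolding E distrib_left using uL L by linarith
    also have "\<dots> \<le> 2 * C_star \<epsilon> * e_log t" using C uL L by (intro mult_right_mono) (auto simp: E)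
    finally show ?thesis .
  next
    case False
    have "?u * ln (1 + \<epsilon>) \<le> ?u * ?L" using False \<epsilon> by (intro mult_left_mono) auto
    then have "?u \<le> 1 / ln (1 + \<epsilon>) * (?u * ?L)" using L\<epsilon> by (simp add: field_simps)
    then have "?u * (1 + lnp t) \<le> (1 / ln (1 + \<epsilon>) + 1) * (?u * ?L)" using 1 by (simp add: distrib_left distrib_right)
    also have "\<dots> \<le> (2 * C_star \<epsilon>) * e_log t"
    proof (rule mult_mono)
      show "1 / ln (1 + \<epsilon>) + 1 \<le> 2 * C_star \<epsilon>" unfolding C(1) distrib_left using C(2) by linarith
      show "0 \<le> 2 * C_star \<epsilon>" using C by simp
    qed (use uL L in \<open>auto simp: E\<close>)
    finally show ?thesis .
  qed
qed

section \<open>Norms and Luxemburg bounds\<close>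

lemma deriv_normD:
  fixes f :: "real^'d::finite \<Rightarrow> real"
  assumes "deriv_norm k N f \<le> ennreal c" and \<beta>: "mi_order \<beta> \<le> k"
  shows "has_weak_deriv \<beta> f (weak_deriv \<beta> f)" "N (weak_deriv \<beta> f) \<le> ennreal c"
proof -
  have \<beta>': "\<beta> \<in> multi_indices k" using \<beta> by (simp add: multi_indices_def)
  have ex: "\<forall>\<beta>\<in>multi_indices k. \<exists>g. has_weak_deriv \<beta> f g"
    using assms(1) unfolding deriv_norm_def by (auto split: if_splits simp: top_unique)
  then show "has_weak_deriv \<beta> f (weak_deriv \<beta> f)" using weak_deriv_AE_eq(1) \<beta>' by blast
  have "N (weak_deriv \<beta> f) \<le> (\<Sum>\<beta>\<in>multi_indices k. N (weak_deriv \<beta> f))"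
    by (rule member_le_sum[OF \<beta>']) auto
  also have "\<dots> \<le> ennreal c" using assms(1) ex unfolding deriv_norm_def by simp
  finally show "N (weak_deriv \<beta> f) \<le> ennreal c" .
qed

lemma deriv_normI:
  fixes f :: "real^'d::finite \<Rightarrow> real"
  assumes w: "\<And>\<beta>. mi_order \<beta> \<le> k \<Longrightarrow> has_weak_deriv \<beta> f (weak_deriv \<beta> f)"
    and N: "\<And>\<beta>. mi_order \<beta> \<le> k \<Longrightarrow> N (weak_deriv \<beta> f) \<le> ennreal c" and c: "0 \<le> c"
  shows "deriv_norm k N f \<le> ennreal (real (card (multi_indices k :: ('d \<Rightarrow> nat) set)) * c)"
proof -
  have "deriv_norm k N f = (\<Sum>\<beta>\<in>multi_indices k. N (weak_deriv \<beta> f))"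
    unfolding deriv_norm_def using w by (auto simp: multi_indices_def)
  also have "\<dots> \<le> (\<Sum>\<beta>\<in>(multi_indices k :: ('d \<Rightarrow> nat) set). ennreal c)"
    using N by (intro sum_mono) (auto simp: multi_indices_def)
  also have "\<dots> = ennreal (real (card (multi_indices k :: ('d \<Rightarrow> nat) set)) * c)"
    using c by (simp add: ennreal_of_nat_eq_real_of_nat ennreal_mult)
  finally show ?thesis .
qed

lemma (in young) lux_weak_deriv:
  assumes "has_weak_deriv \<beta> f g" "lux c g"
  shows "lux c (weak_deriv \<beta> f)"
proof (rule lux_AE_cong[OF assms(2) _ weak_deriv_AE_eq(2)[OF assms(1)]])
  have "locally_integrable (weak_deriv \<beta> f)"
    using weak_deriv_AE_eq(1)[OF assms(1)] by (simp add: has_weak_deriv_def)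
  then show "weak_deriv \<beta> f \<in> borel_measurable borel" by (rule locally_integrable_measurable)
qed

lemma nn_integral_powr_scale:
  fixes f :: "real^'d::finite \<Rightarrow> real"
  assumes [measurable]: "f \<in> borel_measurable borel" and c: "0 < c"
  shows "(\<integral>\<^sup>+x. ennreal (\<bar>f x\<bar> powr p) \<partial>lborel) = ennreal (c powr p) * (\<integral>\<^sup>+x. ennreal (\<bar>f x / c\<bar> powr p) \<partial>lborel)"
proof -
  have "\<bar>f x\<bar> powr p = c powr p * \<bar>f x / c\<bar> powr p" for x
    using c by (simp add: powr_mult[symmetric])
  then have "(\<integral>\<^sup>+x. ennreal (\<bar>f x\<bar> powr p) \<partial>lborel) = (\<integral>\<^sup>+x. ennreal (c powr p) * ennreal (\<bar>f x / c\<bar> powr p) \<partial>lborel)"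
    by (intro nn_integral_cong) (simp add: ennreal_mult)
  then show ?thesis by (simp add: nn_integral_cmult)
qed

lemma Lp_norm_le_iff_lux:
  fixes f :: "real^'d::finite \<Rightarrow> real"
  assumes p: "1 \<le> p" and f[measurable]: "f \<in> borel_measurable borel" and c: "0 < c"
  shows "Lp_norm p f \<le> ennreal c \<longleftrightarrow> young.lux (\<lambda>t. \<bar>t\<bar> powr p) c f"
proof -
  interpret young "\<lambda>t. \<bar>t\<bar> powr p" by (rule young_powr[OF p])
  let ?I = "\<integral>\<^sup>+x. ennreal (\<bar>f x\<bar> powr p) \<partial>lborel" and ?J = "\<integral>\<^sup>+x. ennreal (\<bar>f x / c\<bar> powr p) \<partial>lborel"
  have I: "?I = ennreal (c powr p) * ?J" by (rule nn_integral_powr_scale[OF f c])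
  have cp: "0 < c powr p" using c by simp
  show ?thesis
  proof (cases "?J = \<infinity>")
    case True
    then have "?I = \<infinity>" unfolding I using cp by (simp add: ennreal_mult_eq_top_iff)
    then show ?thesis using True by (simp add: Lp_norm_def lux_def top_unique)
  next
    case False
    then obtain J where J: "?J = ennreal J" "0 \<le> J" by (cases ?J) auto
    have IJ: "?I = ennreal (c powr p * J)" unfolding I J(1) using J(2) by (simp add: ennreal_mult)
    have "Lp_norm p f = ennreal ((c powr p * J) powr (1 / p))"
      unfolding Lp_norm_def Let_def IJ using J(2) by simp
    also have "(c powr p * J) powr (1 / p) = c * J powr (1 / p)"
      using c J(2) p by (simp add: powr_mult powr_powr)
    finally have "Lp_norm p f \<le> ennreal c \<longleftrightarrow> c * J powr (1 / p) \<le> c" using c by (simp add: ennreal_le_iff)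
    also have "\<dots> \<longleftrightarrow> J powr (1 / p) \<le> 1" using c by (simp add: mult_le_cancel_left2)
    also have "\<dots> \<longleftrightarrow> J \<le> 1"
    proof
      assume *: "J powr (1 / p) \<le> 1"
      show "J \<le> 1"
      proof (rule ccontr)
        assume "\<not> J \<le> 1"
        then have "1 powr (1 / p) < J powr (1 / p)" using p by (intro powr_less_mono2) auto
        then show False using * by simp
      qed
    next
      assume "J \<le> 1"
      then have "J powr (1 / p) \<le> 1 powr (1 / p)" using p J(2) by (intro powr_mono2) auto
      then show "J powr (1 / p) \<le> 1" by simp
    qed
    also have "\<dots> \<longleftrightarrow> lux c f" unfolding lux_def J(1) using c J(2) f by simp
    finally show ?thesis .
  qed
qed

lemma e_log_norm_le:
  fixes f :: "real^'d::finite \<Rightarrow> real"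
  shows "young.lux e_log c f \<Longrightarrow> e_log_norm f \<le> ennreal c"
  unfolding e_log_norm_def young.lux_def[OF young_e_log] by (intro INF_lower) auto

text \<open>The modular on the left is not homogeneous, but for \<open>S \<ge> 1\<close> dividing \<open>f\<close> by \<open>2 S\<close> makes the logarithm
  only smaller.\<close>
lemma log_weight_norm_lux:
  fixes f :: "real^'d::finite \<Rightarrow> real"
  assumes f[measurable]: "f \<in> borel_measurable borel" and S: "1 \<le> S" and N: "log_weight_norm l f \<le> ennreal S"
  shows "young.lux e_log (2 * S) f"
proof -
  interpret young e_log by (rule young_e_log)
  have [measurable]: "lnp \<in> borel_measurable borel" unfolding lnp_def[abs_def] by measurable
  have pt: "e_log (f x / (2 * S)) \<le> 1 / S * ((1 + norm x) ^ l * \<bar>f x\<bar> * (1 + lnp (norm x) + lnp (f x)))" for x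
  proof -
    let ?t = "f x / (2 * S)"
    have t: "\<bar>?t\<bar> = \<bar>f x\<bar> / (2 * S)" using S by (simp add: abs_mult)
    also have "\<dots> \<le> \<bar>f x\<bar> / 1" using S by (intro divide_left_mono) auto
    finally have t2: "\<bar>?t\<bar> \<le> \<bar>f x\<bar>" by simp
    have "ln (1 + \<bar>?t\<bar>) \<le> ln (1 + \<bar>f x\<bar>)" using t2 by (subst ln_le_cancel_iff) (auto intro: add_pos_nonneg)
    also have "\<dots> \<le> 1 + lnp (f x)" by (rule ln_add_one_le_lnp)
    finally have "\<bar>?t\<bar> * (1 + ln (1 + \<bar>?t\<bar>)) \<le> \<bar>?t\<bar> * (2 * (1 + lnp (f x)))"
      using lnp_nonneg[of "f x"] by (intro mult_left_mono) auto
    then have "e_log ?t \<le> \<bar>?t\<bar> * (2 * (1 + lnp (f x)))" using e_log_le[of ?t] by linarith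
    also have "\<dots> = 1 / S * (1 * \<bar>f x\<bar> * (1 + lnp (f x)))" unfolding t using S by (simp add: field_simps)
    also have "\<dots> \<le> 1 / S * ((1 + norm x) ^ l * \<bar>f x\<bar> * (1 + lnp (norm x) + lnp (f x)))"
      using S lnp_nonneg[of "norm x"] lnp_nonneg[of "f x"]
      by (intro mult_left_mono mult_mono one_le_power) auto
    finally show ?thesis .
  qed
  have "(\<integral>\<^sup>+x. ennreal (e_log (f x / (2 * S))) \<partial>lborel) \<le>
      (\<integral>\<^sup>+x. ennreal (1 / S) * ennreal ((1 + norm x) ^ l * \<bar>f x\<bar> * (1 + lnp (norm x) + lnp (f x))) \<partial>lborel)"
  proof (rule nn_integral_mono)
    fix x
    have "ennreal (e_log (f x / (2 * S))) \<le> ennreal (1 / S * ((1 + norm x) ^ l * \<bar>f x\<bar> * (1 + lnp (norm x) + lnp (f x))))"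
      by (rule ennreal_leI[OF pt])
    also have "\<dots> = ennreal (1 / S) * ennreal ((1 + norm x) ^ l * \<bar>f x\<bar> * (1 + lnp (norm x) + lnp (f x)))"
      using S lnp_nonneg[of "norm x"] lnp_nonneg[of "f x"] by (intro ennreal_mult) auto
    finally show "ennreal (e_log (f x / (2 * S))) \<le> \<dots>" .
  qed
  also have "\<dots> = ennreal (1 / S) * log_weight_norm l f"
    unfolding log_weight_norm_def by (rule nn_integral_cmult) measurable
  also have "\<dots> \<le> ennreal (1 / S) * ennreal S" by (intro mult_left_mono N zero_le)
  also have "\<dots> = ennreal (1 / S * S)" using S by (intro ennreal_mult[symmetric]) auto
  also have "1 / S * S = 1" using S by simp
  finally show ?thesis unfolding lux_def using S f by simp
qed

text \<open>For \<open>c \<le> 1\<close> convexity gives \<open>e\<^sub>l\<^sub>o\<^sub>g(c t) \<le> c e\<^sub>l\<^sub>o\<^sub>g(t)\<close>.\<close>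
lemma modular_bound:
  fixes w :: "real^'d::finite \<Rightarrow> real"
  assumes l: "young.lux e_log c w" and c: "c \<le> 1" and e: "admissible_eps \<epsilon>"
  shows "(\<integral>\<^sup>+x. ennreal (\<bar>w x\<bar> * (1 + lnp (w x))) \<partial>lborel) \<le> ennreal (2 * C_star \<epsilon> * c)"
proof -
  interpret young e_log by (rule young_e_log)
  note [measurable] = lux_measurable[OF l]
  have c0: "0 < c" by (rule lux_pos[OF l])
  have C: "0 \<le> 2 * C_star \<epsilon> * c" using C_star_bound(2)[OF e] c0 by simp
  have "\<bar>w x\<bar> * (1 + lnp (w x)) \<le> 2 * C_star \<epsilon> * c * e_log (w x / c)" for x
  proof -
    have "e_log (w x) = e_log (c * (w x / c))" using c0 by simp
    also have "\<dots> \<le> c * e_log (w x / c)" by (rule scale) (use c c0 in auto)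
    finally have "2 * C_star \<epsilon> * e_log (w x) \<le> 2 * C_star \<epsilon> * (c * e_log (w x / c))"
      using C_star_bound(2)[OF e] by (intro mult_left_mono) auto
    then show ?thesis using C_star_bound(1)[OF e, of "w x"] by (simp add: mult.assoc)
  qed
  then have "(\<integral>\<^sup>+x. ennreal (\<bar>w x\<bar> * (1 + lnp (w x))) \<partial>lborel)
      \<le> (\<integral>\<^sup>+x. ennreal (2 * C_star \<epsilon> * c) * ennreal (e_log (w x / c)) \<partial>lborel)"
    using C by (intro nn_integral_mono) (simp add: ennreal_leI flip: ennreal_mult)
  also have "\<dots> = ennreal (2 * C_star \<epsilon> * c) * (\<integral>\<^sup>+x. ennreal (e_log (w x / c)) \<partial>lborel)"
    by (rule nn_integral_cmult) measurable
  also have "\<dots> \<le> ennreal (2 * C_star \<epsilon> * c) * 1" using l by (intro mult_left_mono) (auto simp: lux_def)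
  finally show ?thesis by simp
qed

section \<open>Summing the errors\<close>

lemma geometric_growth:
  fixes \<sigma> :: "nat \<Rightarrow> real"
  assumes 1: "1 \<le> \<sigma> 0" and s: "\<And>j. 2 * \<sigma> j \<le> \<sigma> (Suc j) \<and> \<sigma> (Suc j) \<le> 2 * a * \<sigma> j" and a: "1 \<le> a"
  shows "2 ^ j * \<sigma> 0 \<le> \<sigma> j" "\<sigma> j \<le> (2 * a) ^ j * \<sigma> 0" "1 \<le> \<sigma> j"
proof -
  show L: "2 ^ j * \<sigma> 0 \<le> \<sigma> j" for j
  proof (induction j)
    case (Suc j) then show ?case using s[of j] by simp
  qed simp
  show "\<sigma> j \<le> (2 * a) ^ j * \<sigma> 0"
  proof (induction j)
    case (Suc j)
    have "\<sigma> (Suc j) \<le> 2 * a * \<sigma> j" using s by blast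
    also have "\<dots> \<le> 2 * a * ((2 * a) ^ j * \<sigma> 0)" using a Suc by (intro mult_left_mono) auto
    finally show ?case by (simp add: mult.assoc)
  qed simp
  have "1 * 1 \<le> 2 ^ j * \<sigma> 0" using 1 by (intro mult_mono) auto
  then show "1 \<le> \<sigma> j" using L[of j] by linarith
qed

lemma powr_decay:
  fixes \<sigma> :: "nat \<Rightarrow> real"
  assumes "2 ^ j * \<sigma> 0 \<le> \<sigma> j" "1 \<le> \<sigma> 0" "0 \<le> \<theta>"
  shows "\<sigma> j powr (- \<theta>) \<le> \<sigma> 0 powr (- \<theta>) * (2 powr (- \<theta>)) ^ j"
proof -
  have "\<sigma> j powr (- \<theta>) \<le> (2 ^ j * \<sigma> 0) powr (- \<theta>)"
    using assms by (intro powr_mono2') auto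
  also have "\<dots> = (2 ^ j) powr (- \<theta>) * \<sigma> 0 powr (- \<theta>)" using assms by (simp add: powr_mult)
  also have "(2 ^ j) powr (- \<theta>) = (2 powr (- \<theta>)) ^ j"
    by (simp add: powr_powr mult.commute flip: powr_realpow)
  finally show ?thesis by (simp add: mult.commute)
qed

lemma summable_bound:
  fixes e g :: "nat \<Rightarrow> real"
  assumes "\<And>j. 0 \<le> e j" "\<And>j. e j \<le> g j" "g sums S" "S \<le> T"
  shows "summable e \<and> suminf e \<le> T"
proof -
  have s: "summable e" by (rule summable_comparison_test'[OF sums_summable[OF assms(3)], of 0]) (use assms in auto)
  moreover have "suminf e \<le> suminf g" by (rule suminf_le[OF assms(2) s sums_summable[OF assms(3)]])
  ultimately show ?thesis using sums_unique[OF assms(3)] assms(4) by simp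
qed

section \<open>The rates of convergence\<close>

lemma (in young) deriv_norm_le:
  fixes f :: "real^'d::finite \<Rightarrow> real"
  assumes N: "\<And>c (g :: real^'d \<Rightarrow> real). lux c g \<Longrightarrow> N g \<le> ennreal c"
    and G: "\<And>\<beta>. mi_order \<beta> \<le> q \<Longrightarrow> has_weak_deriv \<beta> f (G \<beta>)" "\<And>\<beta>. mi_order \<beta> \<le> q \<Longrightarrow> lux c (G \<beta>)"
  shows "deriv_norm q N f \<le> ennreal (real (card (multi_indices q :: ('d \<Rightarrow> nat) set)) * c)"
proof (rule deriv_normI)
  have "mi_order (\<lambda>_::'d. 0) \<le> q" by (simp add: mi_order_def)
  from lux_pos[OF G(2)[OF this]] show "0 \<le> c" by simp
  fix \<beta> :: "'d \<Rightarrow> nat" assume \<beta>: "mi_order \<beta> \<le> q"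
  show "has_weak_deriv \<beta> f (weak_deriv \<beta> f)" by (rule weak_deriv_AE_eq(1)[OF G(1)[OF \<beta>]])
  show "N (weak_deriv \<beta> f) \<le> ennreal c" by (rule N[OF lux_weak_deriv[OF G(1)[OF \<beta>] G(2)[OF \<beta>]]])
qed

lemma (in young) deriv_norm_finite:
  fixes g :: "real^'d::finite \<Rightarrow> real"
  assumes N: "\<And>c (g :: real^'d \<Rightarrow> real). lux c g \<Longrightarrow> N g \<le> ennreal c"
    and G: "\<And>\<beta>. mi_order \<beta> \<le> q \<Longrightarrow> has_weak_deriv \<beta> g (G \<beta>)"
      "\<And>\<beta>. mi_order \<beta> \<le> q \<Longrightarrow> lux c (\<lambda>x. G \<beta> x - W \<beta> x)" "\<And>\<beta>. mi_order \<beta> \<le> q \<Longrightarrow> lux c' (W \<beta>)"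
  shows "deriv_norm q N g < \<infinity>"
proof -
  have "lux (c + c') (G \<beta>)" if "mi_order \<beta> \<le> q" for \<beta>
    using lux_add[OF G(2)[OF that] G(3)[OF that]] by simp
  from deriv_norm_le[OF N G(1) this]
  have "deriv_norm q N g \<le> ennreal (real (card (multi_indices q :: ('d \<Rightarrow> nat) set)) * (c + c'))" .
  then show ?thesis by (rule le_less_trans) simp
qed

lemma dim_over_conj_eq: "1 \<le> p \<Longrightarrow> dim_over_conj d p = real d * (1 - 1 / p)"
  by (auto simp: dim_over_conj_def field_simps)

lemma convergence_Lp:
  fixes k q m :: nat and a p \<alpha> :: real
  assumes m: "1 \<le> m" and a: "1 \<le> a" and p: "1 \<le> p"
    and \<alpha>': "\<alpha> > (real q + real k + dim_over_conj CARD('d::finite) p) / real m"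
  shows "\<exists>C>0. \<forall>(\<eta> :: real \<Rightarrow> real) (f :: nat \<Rightarrow> real^'d \<Rightarrow> real) (\<mu> :: (real^'d) set \<Rightarrow> real).
           growth_function a \<eta> \<longrightarrow>
           finite_signed_measure \<mu> \<longrightarrow>
           (\<forall>n. integrable lborel (f n)) \<longrightarrow>
           (\<forall>n. weighted_norm (q + 2 * m) (2 * m) p (f n) \<le> ennreal (\<eta> (real n) powr (1 / \<alpha>)) \<and>
                dist_k k \<mu> (density_sm (f n)) \<le> ennreal (1 / \<eta> (real n))) \<longrightarrow>
           (\<exists>g. has_density \<mu> g \<and> g \<in> sobolev_space q p \<and>
              (\<forall>n. sobolev_norm q p (\<lambda>x. g x - f n x)
                 \<le> ennreal (C * \<eta> (real n) powr
                     (- min (1 / \<alpha>)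
                          (1 - (real q + real k + dim_over_conj CARD('d) p) / (\<alpha> * real m))))))"
proof -
  interpret Y: young "\<lambda>t. \<bar>t\<bar> powr p" by (rule young_powr[OF p])
  let ?d = "CARD('d)" and ?D = "dim_over_conj CARD('d) p" and ?e = "1 / (\<alpha> * real m)"
  have D: "?D = real ?d * (1 - 1 / p)" by (rule dim_over_conj_eq[OF p])
  have D0: "0 \<le> ?D" unfolding D using p by simp
  have m0: "0 < real m" using m by simp
  have "0 \<le> (real q + real k + ?D) / real m" using D0 by simp
  then have \<alpha>: "0 < \<alpha>" using \<alpha>' by linarith
  define \<kappa> where "\<kappa> = 1 - (real q + real k + ?D) / (\<alpha> * real m)"
  have "real q + real k + ?D < \<alpha> * real m" using \<alpha>' m0 by (simp add: pos_divide_less_eq)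
  then have \<kappa>: "0 < \<kappa>" using \<alpha> m0 by (simp add: \<kappa>_def)
  define \<theta> where "\<theta> = min (1 / \<alpha>) \<kappa>"
  have \<theta>: "0 < \<theta>" "\<theta> \<le> 1 / \<alpha>" "\<theta> \<le> \<kappa>" using \<alpha> \<kappa> by (auto simp: \<theta>_def)
  define Z where "Z = 2 powr (- \<theta>)"
  have "2 powr (- \<theta>) < 2 powr 0" using \<theta> by (intro powr_less_mono) auto
  then have Z: "0 < Z" "Z < 1" by (auto simp: Z_def)
  define K where "K = 2 / (1 - Z)"
  have K: "2 \<le> K" using Z by (simp add: K_def pos_le_divide_eq)
  \<comment> \<open>the \<open>L\<^sup>p\<close> norm of a function with \<open>L\<^sup>1\<close> norm \<open>1\<close> and height \<open>X\<close> is at most \<open>X\<^sup>1\<^sup>-\<^sup>1\<^sup>/\<^sup>p\<close>\<close>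
  define b where "b s = ((s powr ?e) ^ ?d) powr (1 - 1 / p)" for s :: real
  have pw: "(s powr ?e) ^ n = s powr (real n * ?e)" if "0 < s" for s and n :: nat
    using that by (simp add: powr_powr mult.commute flip: powr_realpow)
  have err: "(s powr ?e) ^ (q + k) * b s / s = s powr (- \<kappa>)" if s: "0 < s" for s
  proof -
    have "(s powr ?e) ^ (q + k) * b s / s = s powr (real (q + k) * ?e) * s powr (real ?d * ?e * (1 - 1 / p)) * s powr (- 1)"
      unfolding b_def pw[OF s] using s by (simp add: powr_powr powr_minus_divide)
    also have "\<dots> = s powr (real (q + k) * ?e + real ?d * ?e * (1 - 1 / p) + - 1)" by (simp only: powr_add)
    also have "real (q + k) * ?e + real ?d * ?e * (1 - 1 / p) + - 1 = - \<kappa>"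
      unfolding \<kappa>_def D by (simp add: add_divide_distrib diff_divide_distrib algebra_simps)
    finally show ?thesis .
  qed
  have "\<exists>C>0. \<forall>\<eta> (f :: nat \<Rightarrow> real^'d \<Rightarrow> real) \<mu> W.
    growth_function a \<eta> \<longrightarrow> finite_signed_measure \<mu> \<longrightarrow> (\<forall>n. integrable lborel (f n)) \<longrightarrow>
    (\<forall>n \<beta>. mi_order \<beta> \<le> q + 2 * m \<longrightarrow> has_weak_deriv \<beta> (f n) (W n \<beta>) \<and>
      Y.lux (1 * max 1 (\<eta> (real n) powr (1 / \<alpha>))) (W n \<beta>)) \<longrightarrow>
    (\<forall>n. dist_k k \<mu> (density_sm (f n)) \<le> ennreal (1 / \<eta> (real n))) \<longrightarrow>
    (\<exists>g G. has_density \<mu> g \<and> (\<forall>\<beta>. mi_order \<beta> \<le> q \<longrightarrow> has_weak_deriv \<beta> g (G \<beta>) \<and>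
      (\<forall>n. Y.lux (C * \<eta> (real n) powr (- \<theta>)) (\<lambda>x. G \<beta> x - W n \<beta> x))))"
  proof (rule Y.approximation_rate[where b = b and rate = "\<lambda>s. s powr (- \<theta>)" and K = K, OF m a \<alpha>])
    fix s :: real assume s: "1 \<le> s"
    let ?X = "(s powr ?e) ^ ?d"
    have X: "0 < ?X" using s by simp
    have "?X / b s = ?X powr 1 / ?X powr (1 - 1 / p)" unfolding b_def using X by simp
    also have "\<dots> = ?X powr (1 - (1 - 1 / p))" by (rule powr_diff[symmetric])
    also have "1 - (1 - 1 / p) = 1 / p" by simp
    finally have "\<bar>?X / b s\<bar> powr p = ?X powr (1 / p * p)" by (simp add: powr_powr)
    also have "\<dots> = ?X" using p X by simp
    finally show "0 < b s \<and> \<bar>?X / b s\<bar> powr p \<le> ?X" using X s by (simp add: b_def)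
  next
    fix \<sigma> :: "nat \<Rightarrow> real"
    assume 1: "1 \<le> \<sigma> 0" and st: "\<And>j. 2 * \<sigma> j \<le> \<sigma> (Suc j) \<and> \<sigma> (Suc j) \<le> 2 * a * \<sigma> j"
    note gg = geometric_growth[OF 1 st a]
    show "summable (\<lambda>j. \<sigma> j powr (- (1 / \<alpha>)) + (\<sigma> j powr ?e) ^ (q + k) * b (\<sigma> j) / \<sigma> j) \<and>
       (\<Sum>j. \<sigma> j powr (- (1 / \<alpha>)) + (\<sigma> j powr ?e) ^ (q + k) * b (\<sigma> j) / \<sigma> j) \<le> K * \<sigma> 0 powr (- \<theta>)"
    proof (rule summable_bound)
      fix j
      have pos: "0 < \<sigma> j" using gg(3)[of j] by linarith
      show "0 \<le> \<sigma> j powr (- (1 / \<alpha>)) + (\<sigma> j powr ?e) ^ (q + k) * b (\<sigma> j) / \<sigma> j"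
        unfolding err[OF pos] by simp
      have "\<sigma> j powr (- (1 / \<alpha>)) \<le> \<sigma> j powr (- \<theta>)" "\<sigma> j powr (- \<kappa>) \<le> \<sigma> j powr (- \<theta>)"
        using \<theta> gg(3)[of j] by (auto intro: powr_mono)
      moreover have "\<sigma> j powr (- \<theta>) \<le> \<sigma> 0 powr (- \<theta>) * Z ^ j"
        unfolding Z_def by (rule powr_decay[where \<sigma>=\<sigma> and j=j, OF gg(1) 1]) (use \<theta> in simp)
      ultimately show "\<sigma> j powr (- (1 / \<alpha>)) + (\<sigma> j powr ?e) ^ (q + k) * b (\<sigma> j) / \<sigma> j
          \<le> 2 * \<sigma> 0 powr (- \<theta>) * Z ^ j" unfolding err[OF pos] by linarith
      show "(\<lambda>j. 2 * \<sigma> 0 powr (- \<theta>) * Z ^ j) sums (2 * \<sigma> 0 powr (- \<theta>) * (1 / (1 - Z)))"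
        using Z by (intro sums_mult geometric_sums) auto
      show "2 * \<sigma> 0 powr (- \<theta>) * (1 / (1 - Z)) \<le> K * \<sigma> 0 powr (- \<theta>)" by (simp add: K_def)
    qed
  next
    fix s :: real assume "0 < s" "s < 1"
    then show "1 \<le> s powr (- \<theta>)" using powr_mono'[of "- \<theta>" 0 s] \<theta> by simp
  next
    fix s :: real assume "1 \<le> s"
    then have "s powr (- \<theta>) \<le> s powr 0" using \<theta> by (intro powr_mono) auto
    then show "s powr (- \<theta>) \<le> K" using K \<open>1 \<le> s\<close> by simp
  qed (use K in auto)
  then obtain C where C: "0 < C" and main: "\<And>\<eta> (f :: nat \<Rightarrow> real^'d \<Rightarrow> real) \<mu> W.
    growth_function a \<eta> \<Longrightarrow> finite_signed_measure \<mu> \<Longrightarrow> \<forall>n. integrable lborel (f n) \<Longrightarrow>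
    \<forall>n \<beta>. mi_order \<beta> \<le> q + 2 * m \<longrightarrow> has_weak_deriv \<beta> (f n) (W n \<beta>) \<and>
      Y.lux (1 * max 1 (\<eta> (real n) powr (1 / \<alpha>))) (W n \<beta>) \<Longrightarrow>
    \<forall>n. dist_k k \<mu> (density_sm (f n)) \<le> ennreal (1 / \<eta> (real n)) \<Longrightarrow>
    \<exists>g G. has_density \<mu> g \<and> (\<forall>\<beta>. mi_order \<beta> \<le> q \<longrightarrow> has_weak_deriv \<beta> g (G \<beta>) \<and>
      (\<forall>n. Y.lux (C * \<eta> (real n) powr (- \<theta>)) (\<lambda>x. G \<beta> x - W n \<beta> x)))"
    by blast
  let ?card = "real (card (multi_indices q :: ('d \<Rightarrow> nat) set))"
  have card: "0 < ?card" using multi_indices_card_pos by simp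
  have N: "Lp_norm p g \<le> ennreal c" if "Y.lux c g" for c and g :: "real^'d \<Rightarrow> real"
    using Lp_norm_le_iff_lux[OF p Y.lux_measurable[OF that] Y.lux_pos[OF that]] that by blast
  show ?thesis
  proof (intro exI[of _ "?card * C"] conjI allI impI)
    show "0 < ?card * C" using card C by simp
    fix \<eta> :: "real \<Rightarrow> real" and f :: "nat \<Rightarrow> real^'d \<Rightarrow> real" and \<mu> :: "(real^'d) set \<Rightarrow> real"
    assume g: "growth_function a \<eta>" and \<mu>: "finite_signed_measure \<mu>" and f: "\<forall>n. integrable lborel (f n)"
      and A: "\<forall>n. weighted_norm (q + 2 * m) (2 * m) p (f n) \<le> ennreal (\<eta> (real n) powr (1 / \<alpha>)) \<and>
                dist_k k \<mu> (density_sm (f n)) \<le> ennreal (1 / \<eta> (real n))"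
    define W where "W n \<beta> = weak_deriv \<beta> (f n)" for n \<beta>
    have W: "has_weak_deriv \<beta> (f n) (W n \<beta>) \<and> Y.lux (1 * max 1 (\<eta> (real n) powr (1 / \<alpha>))) (W n \<beta>)"
      if \<beta>: "mi_order \<beta> \<le> q + 2 * m" for n \<beta>
    proof -
      have A': "deriv_norm (q + 2 * m) (\<lambda>g. \<Sum>\<gamma>\<in>multi_indices (2 * m). Lp_norm p (\<lambda>x. monomial \<gamma> x * g x)) (f n)
          \<le> ennreal (\<eta> (real n) powr (1 / \<alpha>))"
        using A unfolding weighted_norm_def by blast
      have w: "has_weak_deriv \<beta> (f n) (W n \<beta>)" unfolding W_def by (rule deriv_normD(1)[OF A' \<beta>])
      then have ms: "W n \<beta> \<in> borel_measurable borel"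
        by (intro locally_integrable_measurable) (simp add: has_weak_deriv_def)
      have "monomial (\<lambda>_. 0) x = 1" for x :: "real^'d" by (simp add: monomial_def)
      then have "Lp_norm p (W n \<beta>) = Lp_norm p (\<lambda>x. monomial (\<lambda>_. 0) x * W n \<beta> x)" by simp
      also have "\<dots> \<le> (\<Sum>\<gamma>\<in>multi_indices (2 * m). Lp_norm p (\<lambda>x. monomial \<gamma> x * W n \<beta> x))"
        by (rule member_le_sum[of "\<lambda>_. 0"]) auto
      also have "\<dots> \<le> ennreal (\<eta> (real n) powr (1 / \<alpha>))" unfolding W_def by (rule deriv_normD(2)[OF A' \<beta>])
      also have "\<dots> \<le> ennreal (max 1 (\<eta> (real n) powr (1 / \<alpha>)))" by (intro ennreal_leI) simp
      finally have "Lp_norm p (W n \<beta>) \<le> ennreal (max 1 (\<eta> (real n) powr (1 / \<alpha>)))" .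
      then show ?thesis using w Lp_norm_le_iff_lux[OF p ms, of "max 1 (\<eta> (real n) powr (1 / \<alpha>))"] by simp
    qed
    obtain h G where h: "has_density \<mu> h" and G: "\<And>\<beta>. mi_order \<beta> \<le> q \<Longrightarrow> has_weak_deriv \<beta> h (G \<beta>)"
      "\<And>n \<beta>. mi_order \<beta> \<le> q \<Longrightarrow> Y.lux (C * \<eta> (real n) powr (- \<theta>)) (\<lambda>x. G \<beta> x - W n \<beta> x)"
      using main[OF g \<mu> f, of W] W A by blast
    have W': "has_weak_deriv \<beta> (f n) (W n \<beta>)" "Y.lux (1 * max 1 (\<eta> (real n) powr (1 / \<alpha>))) (W n \<beta>)"
      if "mi_order \<beta> \<le> q" for n \<beta> using W[of \<beta> n] that by auto
    have G0: "Y.lux (C * \<eta> (real 0) powr (- \<theta>)) (\<lambda>x. G \<beta> x - W 0 \<beta> x)" if "mi_order \<beta> \<le> q" for \<beta>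
      by (rule G(2)[OF that])
    have "sobolev_norm q p h < \<infinity>"
      unfolding sobolev_norm_def by (rule Y.deriv_norm_finite[OF N G(1) G0 W'(2)])
    moreover have "sobolev_norm q p (\<lambda>x. h x - f n x) \<le> ennreal (?card * C * \<eta> (real n) powr (- \<theta>))" for n
      unfolding sobolev_norm_def mult.assoc
      by (rule Y.deriv_norm_le[OF N has_weak_deriv_diff[OF G(1) W'(1)] G(2)])
    ultimately show "\<exists>g. has_density \<mu> g \<and> g \<in> sobolev_space q p \<and>
              (\<forall>n. sobolev_norm q p (\<lambda>x. g x - f n x)
                 \<le> ennreal (?card * C * \<eta> (real n) powr
                     (- min (1 / \<alpha>)
                          (1 - (real q + real k + dim_over_conj CARD('d) p) / (\<alpha> * real m)))))"
      using h unfolding \<theta>_def \<kappa>_def sobolev_space_def by blast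
  qed
qed

lemma convergence_e_log:
  fixes k q m :: nat and a \<alpha> :: real
  assumes m: "1 \<le> m" and a: "1 \<le> a" and \<alpha>': "\<alpha> > (real q + real k) / real m"
  shows "\<exists>C>0. \<forall>(\<eta> :: real \<Rightarrow> real) (f :: nat \<Rightarrow> real^'d::finite \<Rightarrow> real) (\<mu> :: (real^'d) set \<Rightarrow> real).
           growth_function a \<eta> \<longrightarrow>
           finite_signed_measure \<mu> \<longrightarrow>
           (\<forall>n. integrable lborel (f n)) \<longrightarrow>
           (\<forall>n. weighted_log_norm (q + 2 * m) (2 * m) (f n) \<le> ennreal (\<eta> (real n) powr (1 / \<alpha>)) \<and>
                dist_k k \<mu> (density_sm (f n)) \<le> ennreal (1 / \<eta> (real n))) \<longrightarrow>
           (\<exists>g. has_density \<mu> g \<and> g \<in> sobolev_e_log_space q \<and>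
              (\<forall>n. let \<epsilon>\<^sub>n = C * log_rate \<alpha> k q m (\<eta> (real n)) in
                 sobolev_e_log_norm q (\<lambda>x. g x - f n x) \<le> ennreal \<epsilon>\<^sub>n \<and>
                 (\<epsilon>\<^sub>n \<le> 1 \<longrightarrow>
                   (\<forall>\<epsilon>. admissible_eps \<epsilon> \<longrightarrow>
                     (\<Sum>\<beta>\<in>multi_indices q.
                        \<integral>\<^sup>+x. ennreal (\<bar>weak_deriv \<beta> g x - weak_deriv \<beta> (f n) x\<bar>
                                * (1 + lnp (weak_deriv \<beta> g x - weak_deriv \<beta> (f n) x))) \<partial>lborel)
                     \<le> ennreal (2 * C_star \<epsilon> * \<epsilon>\<^sub>n)))))"
proof -
  interpret Y: young e_log by (rule young_e_log)
  let ?d = "CARD('d)" and ?e = "1 / (\<alpha> * real m)"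
  have m0: "0 < real m" using m by simp
  have "0 \<le> (real q + real k) / real m" by simp
  then have \<alpha>: "0 < \<alpha>" using \<alpha>' by linarith
  define \<kappa> where "\<kappa> = 1 - (real q + real k) / (\<alpha> * real m)"
  have "real q + real k < \<alpha> * real m" using \<alpha>' m0 by (simp add: pos_divide_less_eq)
  then have \<kappa>: "0 < \<kappa>" using \<alpha> m0 by (simp add: \<kappa>_def)
  let ?rate = "\<lambda>s. s powr (- (1 / \<alpha>)) + max 0 (log 2 s) * s powr (- \<kappa>)"
  have pw: "(s powr ?e) ^ n = s powr (real n * ?e)" if "0 < s" for s and n :: nat
    using that by (simp add: powr_powr mult.commute flip: powr_realpow)
  \<comment> \<open>the Luxemburg norm of a function with \<open>L\<^sup>1\<close> norm \<open>1\<close> and height \<open>X\<close> is at most \<open>1 + ln (1 + X)\<close>\<close>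
  define b where "b s = 1 + ln (1 + (s powr ?e) ^ ?d)" for s :: real
  define E where "E = real ?d * ?e"
  have E: "0 \<le> E" using \<alpha> by (simp add: E_def)
  have bs: "b s \<le> 2 + E * ln s" "1 \<le> b s" if s: "1 \<le> s" for s
  proof -
    have X: "1 \<le> (s powr ?e) ^ ?d" using s \<alpha> by (intro one_le_power ge_one_powr_ge_zero) auto
    have "ln (1 + (s powr ?e) ^ ?d) \<le> ln (2 * (s powr ?e) ^ ?d)" using X by (subst ln_le_cancel_iff) auto
    also have "\<dots> = ln 2 + ln ((s powr ?e) ^ ?d)" using X by (intro ln_mult_pos) auto
    also have "ln ((s powr ?e) ^ ?d) = E * ln s" using s by (simp add: pw E_def ln_powr)
    finally show "b s \<le> 2 + E * ln s" unfolding b_def using ln_2_less_1 by linarith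
    show "1 \<le> b s" using X by (simp add: b_def)
  qed
  have err: "(s powr ?e) ^ (q + k) * b s / s = s powr (- \<kappa>) * b s" if s: "0 < s" for s
  proof -
    have "(s powr ?e) ^ (q + k) * b s / s = (s powr (real (q + k) * ?e) * s powr (- 1)) * b s"
      unfolding pw[OF s] using s by (simp add: powr_minus_divide)
    also have "s powr (real (q + k) * ?e) * s powr (- 1) = s powr (real (q + k) * ?e + - 1)" by (simp only: powr_add)
    also have "real (q + k) * ?e + - 1 = - \<kappa>" unfolding \<kappa>_def by simp
    finally show ?thesis .
  qed
  \<comment> \<open>the ratios of the geometric series that bound the errors along a chain; since \<open>ln \<sigma>\<^sub>j\<close> grows linearly
    in \<open>j\<close>, the derivative of the geometric series, with sum \<open>S3\<close>, occurs as well\<close>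
  define x where "x = 2 powr (- (1 / \<alpha>))"
  define z where "z = 2 powr (- \<kappa>)"
  have "2 powr (- (1 / \<alpha>)) < 2 powr 0" "2 powr (- \<kappa>) < 2 powr 0"
    by (rule powr_less_mono; use \<alpha> \<kappa> in simp)+
  then have x: "0 < x" "x < 1" and z: "0 < z" "z < 1" by (auto simp: x_def z_def)
  define S1 S2 S3 where "S1 = 1 / (1 - x)" and "S2 = 1 / (1 - z)" and "S3 = 1 / (1 - z)\<^sup>2"
  have S: "0 < S1" "0 < S2" "0 < S3" using x z by (auto simp: S1_def S2_def S3_def)
  define La where "La = E * ln (2 * a)"
  have La: "0 \<le> La" using E a by (simp add: La_def)
  define P where "P = 2 * S2 + La * S3"
  define Q where "Q = E * S2"
  have PQ: "0 \<le> P" "0 \<le> Q" using S La E by (auto simp: P_def Q_def)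
  define K where "K = S1 + (P + Q) * 2 powr (1 / \<alpha>) + 1 + log 2 a"
  have la: "0 \<le> log 2 a" using a by simp
  have two: "1 \<le> 2 powr (1 / \<alpha>)" using \<alpha> by (intro ge_one_powr_ge_zero) auto
  have K: "0 < K" "S1 + (P + Q) * 2 powr (1 / \<alpha>) \<le> K" "1 + log 2 a \<le> K"
  proof -
    have "0 \<le> (P + Q) * 2 powr (1 / \<alpha>)" using PQ by simp
    then show "0 < K" "S1 + (P + Q) * 2 powr (1 / \<alpha>) \<le> K" "1 + log 2 a \<le> K"
      using S la by (simp_all add: K_def)
  qed
  have "\<exists>C>0. \<forall>\<eta> (f :: nat \<Rightarrow> real^'d \<Rightarrow> real) \<mu> W.
    growth_function a \<eta> \<longrightarrow> finite_signed_measure \<mu> \<longrightarrow> (\<forall>n. integrable lborel (f n)) \<longrightarrow>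
    (\<forall>n \<beta>. mi_order \<beta> \<le> q + 2 * m \<longrightarrow> has_weak_deriv \<beta> (f n) (W n \<beta>) \<and>
      Y.lux (2 * max 1 (\<eta> (real n) powr (1 / \<alpha>))) (W n \<beta>)) \<longrightarrow>
    (\<forall>n. dist_k k \<mu> (density_sm (f n)) \<le> ennreal (1 / \<eta> (real n))) \<longrightarrow>
    (\<exists>g G. has_density \<mu> g \<and> (\<forall>\<beta>. mi_order \<beta> \<le> q \<longrightarrow> has_weak_deriv \<beta> g (G \<beta>) \<and>
      (\<forall>n. Y.lux (C * ?rate (\<eta> (real n))) (\<lambda>x. G \<beta> x - W n \<beta> x))))"
  proof (rule Y.approximation_rate[where b = b and rate = ?rate and K = K, OF m a \<alpha>])
    fix s :: real assume s: "1 \<le> s"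
    let ?X = "(s powr ?e) ^ ?d"
    have X: "0 < ?X" using s by simp
    have b: "0 < b s" using bs(2)[OF s] by linarith
    have ab: "\<bar>?X / b s\<bar> = ?X / b s" using X b by (intro abs_of_pos divide_pos_pos)
    have "e_log (?X / b s) \<le> ?X / b s * (1 + ln (1 + ?X / b s))" using e_log_le[of "?X / b s"] unfolding ab .
    also have "\<dots> \<le> ?X / b s * b s"
    proof (rule mult_left_mono)
      have "?X / b s \<le> ?X / 1" using bs(2)[OF s] X b by (intro divide_left_mono) auto
      moreover have "0 < ?X / b s" using X b by (rule divide_pos_pos)
      ultimately have "ln (1 + ?X / b s) \<le> ln (1 + ?X)" using X by (subst ln_le_cancel_iff) linarith+
      then show "1 + ln (1 + ?X / b s) \<le> b s" using b_def[of s] by linarith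
    qed (use X b in simp)
    also have "\<dots> = ?X" using b by simp
    finally show "0 < b s \<and> e_log (?X / b s) \<le> ?X" using b by simp
  next
    fix \<sigma> :: "nat \<Rightarrow> real"
    assume 1: "1 \<le> \<sigma> 0" and st: "\<And>j. 2 * \<sigma> j \<le> \<sigma> (Suc j) \<and> \<sigma> (Suc j) \<le> 2 * a * \<sigma> j"
    note gg = geometric_growth[OF 1 st a]
    let ?s = "\<sigma> 0"
    let ?g = "\<lambda>j. ?s powr (- (1 / \<alpha>)) * x ^ j + ?s powr (- \<kappa>) * ((2 + E * ln ?s) * z ^ j + La * (real (Suc j) * z ^ j))"
    have lns: "0 \<le> ln ?s" using 1 by simp
    show "summable (\<lambda>j. \<sigma> j powr (- (1 / \<alpha>)) + (\<sigma> j powr ?e) ^ (q + k) * b (\<sigma> j) / \<sigma> j) \<and>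
       (\<Sum>j. \<sigma> j powr (- (1 / \<alpha>)) + (\<sigma> j powr ?e) ^ (q + k) * b (\<sigma> j) / \<sigma> j) \<le> K * ?rate ?s"
    proof (rule summable_bound[where g="?g"])
      fix j
      have pos: "0 < \<sigma> j" using gg(3)[of j] by linarith
      show "0 \<le> \<sigma> j powr (- (1 / \<alpha>)) + (\<sigma> j powr ?e) ^ (q + k) * b (\<sigma> j) / \<sigma> j"
        unfolding err[OF pos] using bs(2)[OF gg(3)[of j]] by simp
      have d1: "\<sigma> j powr (- (1 / \<alpha>)) \<le> ?s powr (- (1 / \<alpha>)) * x ^ j"
        unfolding x_def by (rule powr_decay[where \<sigma>=\<sigma> and j=j, OF gg(1) 1]) (use \<alpha> in simp)
      have d2: "\<sigma> j powr (- \<kappa>) \<le> ?s powr (- \<kappa>) * z ^ j"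
        unfolding z_def by (rule powr_decay[where \<sigma>=\<sigma> and j=j, OF gg(1) 1]) (use \<kappa> in simp)
      have "ln (\<sigma> j) \<le> ln ((2 * a) ^ j * ?s)" using gg(2)[of j] pos a 1 by (subst ln_le_cancel_iff) auto
      also have "\<dots> = ln ((2 * a) ^ j) + ln ?s" using a 1 by (intro ln_mult_pos) auto
      also have "ln ((2 * a) ^ j) = real j * ln (2 * a)" by (rule ln_realpow)
      finally have "E * ln (\<sigma> j) \<le> E * (real j * ln (2 * a) + ln ?s)" using E by (rule mult_left_mono)
      also have "\<dots> = real j * La + E * ln ?s" by (simp add: La_def algebra_simps)
      also have "real j * La \<le> real (Suc j) * La" using La by (intro mult_right_mono) auto
      finally have "b (\<sigma> j) \<le> 2 + E * ln ?s + real (Suc j) * La" using bs(1)[OF gg(3)[of j]] by linarith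
      then have "\<sigma> j powr (- \<kappa>) * b (\<sigma> j) \<le> (?s powr (- \<kappa>) * z ^ j) * (2 + E * ln ?s + real (Suc j) * La)"
        using d2 bs(2)[OF gg(3)[of j]] z by (intro mult_mono) auto
      also have "\<dots> = ?s powr (- \<kappa>) * ((2 + E * ln ?s) * z ^ j + La * (real (Suc j) * z ^ j))"
        by (simp add: algebra_simps)
      finally show "\<sigma> j powr (- (1 / \<alpha>)) + (\<sigma> j powr ?e) ^ (q + k) * b (\<sigma> j) / \<sigma> j \<le> ?g j"
        unfolding err[OF pos] using d1 by linarith
      have "(\<lambda>j. of_nat (Suc j) * z ^ j) sums (1 / (1 - z)\<^sup>2)"
        by (rule geometric_deriv_sums) (use z in auto)
      then have s3: "(\<lambda>j. real (Suc j) * z ^ j) sums S3" by (simp add: S3_def)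
      have s1: "(\<lambda>j. x ^ j) sums S1" "(\<lambda>j. z ^ j) sums S2"
        unfolding S1_def S2_def using x z by (auto intro!: geometric_sums)
      show "?g sums (?s powr (- (1 / \<alpha>)) * S1 + ?s powr (- \<kappa>) * ((2 + E * ln ?s) * S2 + La * S3))"
        by (intro sums_add sums_mult s1 s3)
      let ?A = "?s powr (- (1 / \<alpha>))" and ?B = "?s powr (- \<kappa>)" and ?l = "max 0 (log 2 ?s)"
      have l: "?l = log 2 ?s" using 1 by simp
      have AB: "0 \<le> ?A" "0 \<le> ?B" "0 \<le> ?l" by auto
      have lnlog: "ln ?s \<le> ?l"
      proof -
        have "ln ?s = ln 2 * log 2 ?s" by (simp add: log_def)
        also have "\<dots> \<le> 1 * log 2 ?s" using ln_2_less_1 1 by (intro mult_right_mono) auto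
        finally show ?thesis using l by simp
      qed
      have "(2 + E * ln ?s) * S2 + La * S3 = P + Q * ln ?s" by (simp add: P_def Q_def algebra_simps)
      also have "\<dots> \<le> P + Q * ?l" using PQ lnlog by (intro add_left_mono mult_left_mono) auto
      finally have PQl: "(2 + E * ln ?s) * S2 + La * S3 \<le> P + Q * ?l" .
      have "?B * (P + Q * ?l) \<le> (P + Q) * 2 powr (1 / \<alpha>) * (?A + ?l * ?B)"
      proof (cases "2 \<le> ?s")
        case True
        then have l1: "1 \<le> ?l" using 1 by (simp add: l le_log_iff)
        have "P * 1 + Q * ?l \<le> P * ?l + Q * ?l" using PQ l1 by (intro add_right_mono mult_left_mono) auto
        then have "?B * (P + Q * ?l) \<le> ?B * ((P + Q) * ?l)" by (intro mult_left_mono) (auto simp: distrib_right)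
        also have "\<dots> = (P + Q) * 1 * (0 + ?l * ?B)" by simp
        also have "\<dots> \<le> (P + Q) * 2 powr (1 / \<alpha>) * (?A + ?l * ?B)"
          using two PQ AB by (intro mult_mono add_mono) auto
        finally show ?thesis .
      next
        case False
        \<comment> \<open>here the logarithm may vanish, and the first term of the rate has to absorb the constant\<close>
        have B1: "?B \<le> 1" using powr_mono[of "- \<kappa>" 0 ?s] 1 \<kappa> by simp
        have l1: "?l \<le> 1" using False 1 by (simp add: l log_le_iff)
        have "P + Q * ?l \<le> P + Q * 1" using PQ l1 by (intro add_left_mono mult_left_mono) auto
        then have "?B * (P + Q * ?l) \<le> 1 * (P + Q * 1)" using B1 PQ AB by (intro mult_mono) auto
        also have "\<dots> \<le> (P + Q) * (2 powr (1 / \<alpha>) * ?A)"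
        proof -
          have "?s powr (1 / \<alpha>) \<le> 2 powr (1 / \<alpha>)" using False 1 \<alpha> by (intro powr_mono2) auto
          then have "?s powr (1 / \<alpha>) * ?A \<le> 2 powr (1 / \<alpha>) * ?A" by (rule mult_right_mono) simp
          moreover have "?s powr (1 / \<alpha>) * ?A = 1" using 1 by (simp flip: powr_add)
          ultimately have "1 \<le> 2 powr (1 / \<alpha>) * ?A" by simp
          then show ?thesis using mult_left_mono[of 1 "2 powr (1 / \<alpha>) * ?A" "P + Q"] PQ by simp
        qed
        also have "\<dots> = (P + Q) * 2 powr (1 / \<alpha>) * (?A + 0)" by simp
        also have "\<dots> \<le> (P + Q) * 2 powr (1 / \<alpha>) * (?A + ?l * ?B)"
          using PQ AB by (intro mult_left_mono add_left_mono) auto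
        finally show ?thesis .
      qed
      moreover have "?B * ((2 + E * ln ?s) * S2 + La * S3) \<le> ?B * (P + Q * ?l)"
        by (intro mult_left_mono PQl) simp
      moreover have "?A * S1 \<le> S1 * (?A + ?l * ?B)"
        using S AB by (simp add: distrib_left mult.commute)
      moreover have "(S1 + (P + Q) * 2 powr (1 / \<alpha>)) * (?A + ?l * ?B) \<le> K * (?A + ?l * ?B)"
        by (intro mult_right_mono K(2)) (use AB in auto)
      ultimately show "?A * S1 + ?B * ((2 + E * ln ?s) * S2 + La * S3) \<le> K * ?rate ?s"
        unfolding distrib_right[of S1] by linarith
    qed
  next
    fix s :: real assume s: "0 < s" "s < 1"
    then have "1 \<le> s powr (- (1 / \<alpha>))" using powr_mono'[of "- (1 / \<alpha>)" 0 s] \<alpha> by simp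
    moreover have "0 \<le> max 0 (log 2 s) * s powr (- \<kappa>)" by simp
    ultimately show "1 \<le> ?rate s" by linarith
  next
    fix s :: real assume s: "1 \<le> s" "s \<le> a"
    have "s powr (- (1 / \<alpha>)) \<le> s powr 0" "s powr (- \<kappa>) \<le> s powr 0"
      by (rule powr_mono; use s \<alpha> \<kappa> in simp)+
    then have 1: "s powr (- (1 / \<alpha>)) \<le> 1" "s powr (- \<kappa>) \<le> 1" using s by auto
    have "max 0 (log 2 s) \<le> log 2 a" using s by simp
    then have "max 0 (log 2 s) * s powr (- \<kappa>) \<le> log 2 a * 1" using 1 la by (intro mult_mono) auto
    then show "?rate s \<le> K" using 1 K(3) by linarith
  qed (use K in auto)
  then obtain C where C: "0 < C" and main: "\<And>\<eta> (f :: nat \<Rightarrow> real^'d \<Rightarrow> real) \<mu> W.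
    growth_function a \<eta> \<Longrightarrow> finite_signed_measure \<mu> \<Longrightarrow> \<forall>n. integrable lborel (f n) \<Longrightarrow>
    \<forall>n \<beta>. mi_order \<beta> \<le> q + 2 * m \<longrightarrow> has_weak_deriv \<beta> (f n) (W n \<beta>) \<and>
      Y.lux (2 * max 1 (\<eta> (real n) powr (1 / \<alpha>))) (W n \<beta>) \<Longrightarrow>
    \<forall>n. dist_k k \<mu> (density_sm (f n)) \<le> ennreal (1 / \<eta> (real n)) \<Longrightarrow>
    \<exists>g G. has_density \<mu> g \<and> (\<forall>\<beta>. mi_order \<beta> \<le> q \<longrightarrow> has_weak_deriv \<beta> g (G \<beta>) \<and>
      (\<forall>n. Y.lux (C * ?rate (\<eta> (real n))) (\<lambda>x. G \<beta> x - W n \<beta> x)))"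
    by blast
  have rate: "?rate s = log_rate \<alpha> k q m s" for s by (simp add: log_rate_def \<kappa>_def)
  let ?card = "real (card (multi_indices q :: ('d \<Rightarrow> nat) set))"
  have "0 < card (multi_indices q :: ('d \<Rightarrow> nat) set)" by (rule multi_indices_card_pos)
  then have card: "1 \<le> ?card" by linarith
  note N = e_log_norm_le[where 'd='d]
  show ?thesis
    unfolding Let_def
  proof (intro exI[of _ "?card * C"] conjI allI impI)
    show "0 < ?card * C" using card C by simp
    fix \<eta> :: "real \<Rightarrow> real" and f :: "nat \<Rightarrow> real^'d \<Rightarrow> real" and \<mu> :: "(real^'d) set \<Rightarrow> real"
    assume g: "growth_function a \<eta>" and \<mu>: "finite_signed_measure \<mu>" and f: "\<forall>n. integrable lborel (f n)"
      and A: "\<forall>n. weighted_log_norm (q + 2 * m) (2 * m) (f n) \<le> ennreal (\<eta> (real n) powr (1 / \<alpha>)) \<and>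
                dist_k k \<mu> (density_sm (f n)) \<le> ennreal (1 / \<eta> (real n))"
    define W where "W n \<beta> = weak_deriv \<beta> (f n)" for n \<beta>
    have W: "has_weak_deriv \<beta> (f n) (W n \<beta>) \<and> Y.lux (2 * max 1 (\<eta> (real n) powr (1 / \<alpha>))) (W n \<beta>)"
      if \<beta>: "mi_order \<beta> \<le> q + 2 * m" for n \<beta>
    proof
      have A': "deriv_norm (q + 2 * m) (log_weight_norm (2 * m)) (f n) \<le> ennreal (\<eta> (real n) powr (1 / \<alpha>))"
        using A unfolding weighted_log_norm_def by blast
      show w: "has_weak_deriv \<beta> (f n) (W n \<beta>)" unfolding W_def by (rule deriv_normD(1)[OF A' \<beta>])
      then have ms: "W n \<beta> \<in> borel_measurable borel"
        by (intro locally_integrable_measurable) (simp add: has_weak_deriv_def)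
      have "log_weight_norm (2 * m) (W n \<beta>) \<le> ennreal (\<eta> (real n) powr (1 / \<alpha>))"
        unfolding W_def by (rule deriv_normD(2)[OF A' \<beta>])
      also have "\<dots> \<le> ennreal (max 1 (\<eta> (real n) powr (1 / \<alpha>)))" by (intro ennreal_leI) simp
      finally show "Y.lux (2 * max 1 (\<eta> (real n) powr (1 / \<alpha>))) (W n \<beta>)"
        by (intro log_weight_norm_lux[OF ms]) simp
    qed
    obtain h G where h: "has_density \<mu> h" and G: "\<And>\<beta>. mi_order \<beta> \<le> q \<Longrightarrow> has_weak_deriv \<beta> h (G \<beta>)"
      "\<And>n \<beta>. mi_order \<beta> \<le> q \<Longrightarrow> Y.lux (C * ?rate (\<eta> (real n))) (\<lambda>x. G \<beta> x - W n \<beta> x)"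
      using main[OF g \<mu> f, of W] W A by blast
    have W': "has_weak_deriv \<beta> (f n) (W n \<beta>)" "Y.lux (2 * max 1 (\<eta> (real n) powr (1 / \<alpha>))) (W n \<beta>)"
      if "mi_order \<beta> \<le> q" for n \<beta> using W[of \<beta> n] that by auto
    have G0: "Y.lux (C * ?rate (\<eta> (real 0))) (\<lambda>x. G \<beta> x - W 0 \<beta> x)" if "mi_order \<beta> \<le> q" for \<beta>
      by (rule G(2)[OF that])
    have space: "h \<in> sobolev_e_log_space q"
      unfolding sobolev_e_log_norm_def sobolev_e_log_space_def mem_Collect_eq
      by (rule Y.deriv_norm_finite[OF N G(1) G0 W'(2)])
    have norm: "sobolev_e_log_norm q (\<lambda>x. h x - f n x) \<le> ennreal (?card * C * log_rate \<alpha> k q m (\<eta> (real n)))" for n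
      unfolding sobolev_e_log_norm_def mult.assoc rate[symmetric]
      by (rule Y.deriv_norm_le[OF N has_weak_deriv_diff[OF G(1) W'(1)] G(2)])
    have mod: "(\<Sum>\<beta>\<in>(multi_indices q :: ('d \<Rightarrow> nat) set).
          \<integral>\<^sup>+x. ennreal (\<bar>weak_deriv \<beta> h x - weak_deriv \<beta> (f n) x\<bar>
            * (1 + lnp (weak_deriv \<beta> h x - weak_deriv \<beta> (f n) x))) \<partial>lborel)
        \<le> ennreal (2 * C_star \<epsilon> * (?card * C * log_rate \<alpha> k q m (\<eta> (real n))))"
      if le1: "?card * C * log_rate \<alpha> k q m (\<eta> (real n)) \<le> 1" and \<epsilon>: "admissible_eps \<epsilon>" for n \<epsilon>
    proof -
      let ?c = "C * log_rate \<alpha> k q m (\<eta> (real n))"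
      have lx: "Y.lux ?c (\<lambda>x. weak_deriv \<beta> h x - W n \<beta> x)" if \<beta>: "mi_order \<beta> \<le> q" for \<beta>
      proof (rule Y.lux_AE_cong[OF G(2)[OF \<beta>, of n, unfolded rate]])
        have "locally_integrable (weak_deriv \<beta> h)" "locally_integrable (W n \<beta>)"
          using weak_deriv_AE_eq(1)[OF G(1)[OF \<beta>]] W'(1)[OF \<beta>] by (auto simp: has_weak_deriv_def)
        note [measurable] = this[THEN locally_integrable_measurable]
        show "(\<lambda>x. weak_deriv \<beta> h x - W n \<beta> x) \<in> borel_measurable borel" by measurable
        show "AE x in lborel. weak_deriv \<beta> h x - W n \<beta> x = G \<beta> x - W n \<beta> x"
          using weak_deriv_AE_eq(2)[OF G(1)[OF \<beta>]] by eventually_elim simp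
      qed
      have "mi_order (\<lambda>_::'d. 0) \<le> q" by (simp add: mi_order_def)
      from Y.lux_pos[OF lx[OF this]] have c0: "0 < ?c" .
      have "1 * ?c \<le> ?card * ?c" using card c0 by (intro mult_right_mono) auto
      then have c1: "?c \<le> 1" using le1 by (simp add: mult.assoc)
      have "(\<Sum>\<beta>\<in>(multi_indices q :: ('d \<Rightarrow> nat) set).
          \<integral>\<^sup>+x. ennreal (\<bar>weak_deriv \<beta> h x - W n \<beta> x\<bar> * (1 + lnp (weak_deriv \<beta> h x - W n \<beta> x))) \<partial>lborel)
        \<le> (\<Sum>\<beta>\<in>(multi_indices q :: ('d \<Rightarrow> nat) set). ennreal (2 * C_star \<epsilon> * ?c))"
        by (intro sum_mono modular_bound[OF lx c1 \<epsilon>]) (simp add: multi_indices_def)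
      also have "\<dots> = ennreal ?card * ennreal (2 * C_star \<epsilon> * ?c)"
        by (simp only: sum_constant ennreal_of_nat_eq_real_of_nat)
      also have "\<dots> = ennreal (?card * (2 * C_star \<epsilon> * ?c))"
        using C_star_bound(2)[OF \<epsilon>] c0 by (intro ennreal_mult[symmetric]) auto
      also have "?card * (2 * C_star \<epsilon> * ?c) = 2 * C_star \<epsilon> * (?card * C * log_rate \<alpha> k q m (\<eta> (real n)))"
        by (simp only: mult_ac)
      finally show ?thesis unfolding W_def .
    qed
    show "\<exists>g. has_density \<mu> g \<and> g \<in> sobolev_e_log_space q \<and>
      (\<forall>n. sobolev_e_log_norm q (\<lambda>x. g x - f n x) \<le> ennreal (?card * C * log_rate \<alpha> k q m (\<eta> (real n))) \<and>
        (?card * C * log_rate \<alpha> k q m (\<eta> (real n)) \<le> 1 \<longrightarrow>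
          (\<forall>\<epsilon>. admissible_eps \<epsilon> \<longrightarrow>
            (\<Sum>\<beta>\<in>multi_indices q. \<integral>\<^sup>+x. ennreal (\<bar>weak_deriv \<beta> g x - weak_deriv \<beta> (f n) x\<bar>
                * (1 + lnp (weak_deriv \<beta> g x - weak_deriv \<beta> (f n) x))) \<partial>lborel)
            \<le> ennreal (2 * C_star \<epsilon> * (?card * C * log_rate \<alpha> k q m (\<eta> (real n)))))))"
      using h space norm mod by blast
  qed
qed

theorem theorem2p11:
  fixes k q m :: nat and a :: real
  assumes "m \<ge> 1" and "a \<ge> 1"
  shows
    "(\<forall>p \<alpha> :: real. p \<ge> 1 \<longrightarrow>
        \<alpha> > (real q + real k + dim_over_conj CARD('d::finite) p) / real m \<longrightarrow>
        (\<exists>C>0. \<forall>(\<eta> :: real \<Rightarrow> real) (f :: nat \<Rightarrow> real^'d \<Rightarrow> real) (\<mu> :: (real^'d) set \<Rightarrow> real).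
           growth_function a \<eta> \<longrightarrow>
           finite_signed_measure \<mu> \<longrightarrow>
           (\<forall>n. integrable lborel (f n)) \<longrightarrow>
           (\<forall>n. weighted_norm (q + 2 * m) (2 * m) p (f n) \<le> ennreal (\<eta> (real n) powr (1 / \<alpha>)) \<and>
                dist_k k \<mu> (density_sm (f n)) \<le> ennreal (1 / \<eta> (real n))) \<longrightarrow>
           (\<exists>g. has_density \<mu> g \<and> g \<in> sobolev_space q p \<and>
              (\<forall>n. sobolev_norm q p (\<lambda>x. g x - f n x)
                 \<le> ennreal (C * \<eta> (real n) powr
                     (- min (1 / \<alpha>)
                          (1 - (real q + real k + dim_over_conj CARD('d) p) / (\<alpha> * real m))))))))
     \<and>
     (\<forall>\<alpha> :: real. \<alpha> > (real q + real k) / real m \<longrightarrow>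
        (\<exists>C>0. \<forall>(\<eta> :: real \<Rightarrow> real) (f :: nat \<Rightarrow> real^'d \<Rightarrow> real) (\<mu> :: (real^'d) set \<Rightarrow> real).
           growth_function a \<eta> \<longrightarrow>
           finite_signed_measure \<mu> \<longrightarrow>
           (\<forall>n. integrable lborel (f n)) \<longrightarrow>
           (\<forall>n. weighted_log_norm (q + 2 * m) (2 * m) (f n) \<le> ennreal (\<eta> (real n) powr (1 / \<alpha>)) \<and>
                dist_k k \<mu> (density_sm (f n)) \<le> ennreal (1 / \<eta> (real n))) \<longrightarrow>
           (\<exists>g. has_density \<mu> g \<and> g \<in> sobolev_e_log_space q \<and>
              (\<forall>n. let \<epsilon>\<^sub>n = C * log_rate \<alpha> k q m (\<eta> (real n)) in
                 sobolev_e_log_norm q (\<lambda>x. g x - f n x) \<le> ennreal \<epsilon>\<^sub>n \<and>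
                 (\<epsilon>\<^sub>n \<le> 1 \<longrightarrow>
                   (\<forall>\<epsilon>. admissible_eps \<epsilon> \<longrightarrow>
                     (\<Sum>\<beta>\<in>multi_indices q.
                        \<integral>\<^sup>+x. ennreal (\<bar>weak_deriv \<beta> g x - weak_deriv \<beta> (f n) x\<bar>
                                * (1 + lnp (weak_deriv \<beta> g x - weak_deriv \<beta> (f n) x))) \<partial>lborel)
                     \<le> ennreal (2 * C_star \<epsilon> * \<epsilon>\<^sub>n)))))))"
  using convergence_Lp[OF assms, where 'd='d] convergence_e_log[OF assms, where 'd='d] by blast

end
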